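(* Let $V$ be an $n$-dimensional vector space over a field $F$, let $n\ge 3$ and $1\le k\le n-1$. Then the following two statements hold. (1) If $n\ne 2k$, then every regular transformation of $\mathbb{G}_k(V)$ is induced by a collineation of $V$. (2) If $n=2k$, then every regular transformation of $\mathbb{G}_k(V)$ is either induced by a collineation of $V$ or defined by some non-degenerate sesquilinear form on $V$.
   Context: $\mathbb{G}_k(V)$ is the set of all $k$-dimensional linear subspaces ("planes") of $V$. A transformation of a set is a bijection of the set onto itself. $R$-sets: a set $\mathcal{R}\subset\mathbb{G}_k(V)$ is an $R$-set if there is a basis of $V$ such that every element of $\mathcal{R}$ contains $k$ vectors of this basis (i.e. is spanned by $k$ of the basis vectors). A transformation $f$ of $\mathbb{G}_k(V)$ is regular if both $f$ and $f^{-1}$ map every $R$-set to an $R$-set. A collineation of $V$ is a semilinear bijection $g:V\to V$ (with respect to some automorphism of $F$); it induces the transformation $U\mapsto g(U)$ of $\mathbb{G}_k(V)$. A sesquilinear form on $V$ is a map $\Omega:V\times V\to F$, additive in each variable, with $\Omega(ax,by)=a\,\varphi(b)\,\Omega(x,y)$ for some automorphism $\varphi$ of $F$. A non-degenerate sesquilinear form $\Omega$ defines the bijection $f_{k\,n-k}(\Omega):\mathbb{G}_k(V)\to\mathbb{G}_{n-k}(V)$, sending $U$ to its $\Omega$-orthogonal complement $\{y\in V:\Omega(x,y)=0\ \forall x\in U\}$. When $n=2k$ this is a transformation of $\mathbb{G}_k(V)$, called the transformation defined by $\Omega$. *)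

theory Defs
  imports HOL.Vector_Spaces
begin

definition field_automorphism :: "('a::field \<Rightarrow> 'a) \<Rightarrow> bool" where
  "field_automorphism \<phi> \<longleftrightarrow> bij \<phi> \<and> \<phi> 1 = 1 \<and>
     (\<forall>a b. \<phi> (a + b) = \<phi> a + \<phi> b) \<and> (\<forall>a b. \<phi> (a * b) = \<phi> a * \<phi> b)"

context vector_space
begin

definition basis_of_space :: "'b set \<Rightarrow> bool" where
  "basis_of_space B \<longleftrightarrow> independent B \<and> span B = UNIV"

definition grassmannian :: "nat \<Rightarrow> 'b set set" where
  "grassmannian k = {U. subspace U \<and> dim U = k}"

definition R_set :: "nat \<Rightarrow> 'b set set \<Rightarrow> bool" where
  "R_set k R \<longleftrightarrow> R \<subseteq> grassmannian k \<and>
     (\<exists>B. basis_of_space B \<and> (\<forall>U\<in>R. \<exists>S. S \<subseteq> B \<and> finite S \<and> card S = k \<and> S \<subseteq> U))"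

text \<open>
  A transformation of the Grassmannian is a function on all subsets of the space of which only
  the restriction to \<^term>\<open>grassmannian k\<close> matters; its inverse is taken relative to that set.
\<close>

definition regular_transformation :: "nat \<Rightarrow> ('b set \<Rightarrow> 'b set) \<Rightarrow> bool" where
  "regular_transformation k f \<longleftrightarrow>
     bij_betw f (grassmannian k) (grassmannian k) \<and>
     (\<forall>R. R_set k R \<longrightarrow> R_set k (f ` R)) \<and>
     (\<forall>R. R_set k R \<longrightarrow> R_set k (the_inv_into (grassmannian k) f ` R))"

definition collineation :: "('b \<Rightarrow> 'b) \<Rightarrow> bool" where
  "collineation g \<longleftrightarrow> bij g \<and> (\<forall>x y. g (x + y) = g x + g y) \<and>
     (\<exists>\<phi>. field_automorphism \<phi> \<and> (\<forall>a x. g (a *s x) = \<phi> a *s g x))"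

definition induced_by_collineation :: "nat \<Rightarrow> ('b set \<Rightarrow> 'b set) \<Rightarrow> bool" where
  "induced_by_collineation k f \<longleftrightarrow>
     (\<exists>g. collineation g \<and> (\<forall>U\<in>grassmannian k. f U = g ` U))"

definition sesquilinear_form :: "('b \<Rightarrow> 'b \<Rightarrow> 'a) \<Rightarrow> bool" where
  "sesquilinear_form \<Omega> \<longleftrightarrow>
     (\<forall>x x' y. \<Omega> (x + x') y = \<Omega> x y + \<Omega> x' y) \<and>
     (\<forall>x y y'. \<Omega> x (y + y') = \<Omega> x y + \<Omega> x y') \<and>
     (\<exists>\<phi>. field_automorphism \<phi> \<and>
        (\<forall>a b x y. \<Omega> (a *s x) (b *s y) = a * \<phi> b * \<Omega> x y))"

definition nondegenerate_form :: "('b \<Rightarrow> 'b \<Rightarrow> 'a) \<Rightarrow> bool" where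
  "nondegenerate_form \<Omega> \<longleftrightarrow>
     (\<forall>x. (\<forall>y. \<Omega> x y = 0) \<longrightarrow> x = 0) \<and> (\<forall>y. (\<forall>x. \<Omega> x y = 0) \<longrightarrow> y = 0)"

definition orthogonal_complement :: "('b \<Rightarrow> 'b \<Rightarrow> 'a) \<Rightarrow> 'b set \<Rightarrow> 'b set" where
  "orthogonal_complement \<Omega> U = {y. \<forall>x\<in>U. \<Omega> x y = 0}"

definition defined_by_form :: "nat \<Rightarrow> ('b set \<Rightarrow> 'b set) \<Rightarrow> bool" where
  "defined_by_form k f \<longleftrightarrow>
     (\<exists>\<Omega>. sesquilinear_form \<Omega> \<and> nondegenerate_form \<Omega> \<and>
        (\<forall>U\<in>grassmannian k. f U = orthogonal_complement \<Omega> U))"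

end

end

theory Submission
  imports Defs "HOL.Binomial"
begin

text \<open>
  The elements of a maximal R-set, given by a basis \<open>B\<close>, correspond to the \<open>k\<close>-subsets of \<open>B\<close>. Call a subset
  of it inexact if it lies in a second maximal R-set. For \<open>2 \<le> k \<le> n - 2\<close> the maximal inexact subsets
  are \<open>{S. i \<in> S \<longrightarrow> j \<in> S}\<close> for \<open>i \<noteq> j\<close>, so the number of those disjoint from a family \<open>X\<close> is
  \<open>|\<Inter>X| (n - |\<Union>X|)\<close>. This number is invariant under regular transformations; for pairs it determines the
  dimension of the intersection, and if \<open>n \<noteq> 2k\<close>, for triples of pairwise adjacent planes it tells those
  with a common \<open>(k-1)\<close>-plane (stars) from those in a common \<open>(k+1)\<close>-plane (tops). The triples which are both
  are recognised by not being R-sets.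

  A transformation preserving stars descends to \<open>(k-1)\<close>-planes, and finally to the points, where
  the fundamental theorem of projective geometry yields the collineation. If \<open>n = 2k\<close>, stars are mapped
  either all to stars or all to tops; the latter case reduces to the former by composing with the
  orthogonal complement of a symmetric non-degenerate form.
\<close>

section \<open>Adjacent planes\<close>

context finite_dimensional_vector_space
begin

text \<open>Replacing the basis vector \<open>i\<close> by \<open>i + j\<close> changes none of the
  spans of the sets in \<open>{S. i \<in> S \<longrightarrow> j \<in> S}\<close>, so these are
  inexact. Conversely, if a subset violates each such implication, every line
  \<open>span {i}\<close> is an intersection of its members, and the basis is fixed up to scaling.
  Such an implication misses a family exactly when \<open>i\<close> is in all members and
  \<open>j\<close> in none, whence the product. The count is (k-1)(n-k-2) for stars that are not
  tops and (k-2)(n-k-1) for tops that are not stars; the difference is n-2k. The coincidence at n =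
  2k is unavoidable: orthogonal complements are then regular and exchange stars with tops. There the
  type is controlled globally, by comparing stars over adjacent (k-1)-planes, through which any two
  stars are connected. For k = 1 or k = n-1 the implications no longer determine both
  \<open>i\<close> and \<open>j\<close>. But then any two distinct planes are adjacent, and all
  information is in the triples that are both stars and tops.\<close>

lemma dim_join:
  assumes "subspace U" "subspace W"
  shows "dim (span (U \<union> W)) + dim (U \<inter> W) = dim U + dim W"
proof -
  have "span (U \<union> W) = {x + y |x y. x \<in> U \<and> y \<in> W}"
    using assms by (simp add: span_Un span_eq_iff[THEN iffD2])
  then show ?thesis using dim_sums_Int[OF assms] by simp
qed

lemma grassmannianD:
  assumes "U \<in> grassmannian k"
  shows "subspace U" "dim U = k" "span U = U"
  using assms by (auto simp: grassmannian_def)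

lemma grassmannianI: "subspace U \<Longrightarrow> dim U = k \<Longrightarrow> U \<in> grassmannian k"
  by (simp add: grassmannian_def)

lemma grassmannian_eqI:
  assumes "U \<in> grassmannian k" "W \<in> grassmannian k" "U \<subseteq> W"
  shows "U = W"
  using assms subspace_dim_equal[of U W] by (auto simp: grassmannian_def)

lemma subspace_step:
  assumes "subspace P" "subspace W" "P \<subseteq> W" "dim P < dim W"
  obtains x U where "x \<in> W" "x \<notin> P" "U = span (insert x P)" "U \<in> grassmannian (Suc (dim P))" "P \<subseteq> U" "U \<subseteq> W"
proof -
  obtain x where x: "x \<in> W" "x \<notin> P" using assms by (metis subsetI subset_antisym less_irrefl)
  have "x \<notin> span P" using x assms by (metis span_eq_iff)
  then have "dim (span (insert x P)) = Suc (dim P)" by (simp add: dim_insert)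
  then show ?thesis
    using that[OF x refl] assms x
    by (metis grassmannianI insert_subset span_minimal span_superset subspace_span)
qed

text \<open>The \<open>Suc\<close> form avoids truncated subtraction and yields \<open>0 < k\<close>
  at once.\<close>

definition adjacent :: "nat \<Rightarrow> 'b set \<Rightarrow> 'b set \<Rightarrow> bool" where
  "adjacent k U W \<longleftrightarrow> U \<in> grassmannian k \<and> W \<in> grassmannian k \<and> U \<noteq> W \<and> Suc (dim (U \<inter> W)) = k"

lemma adjacent_sym: "adjacent k U W \<Longrightarrow> adjacent k W U"
  by (auto simp: adjacent_def Int_commute)

lemma dim_Int_less:
  assumes "U \<in> grassmannian k" "W \<in> grassmannian k" "U \<noteq> W"
  shows "dim (U \<inter> W) < k"
proof (rule ccontr)
  assume "\<not> dim (U \<inter> W) < k"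
  then have "U \<inter> W = U" "U \<inter> W = W"
    using assms subspace_dim_equal[of "U \<inter> W" U] subspace_dim_equal[of "U \<inter> W" W]
    by (auto simp: grassmannian_def subspace_inter)
  then show False using assms by blast
qed

lemma adjacentI_common:
  assumes "U \<in> grassmannian k" "W \<in> grassmannian k" "U \<noteq> W"
    and "P \<subseteq> U" "P \<subseteq> W" "Suc (dim P) = k"
  shows "adjacent k U W"
  using assms dim_Int_less[of U k W] dim_subset[of P "U \<inter> W"] by (auto simp: adjacent_def)

lemma adjacent_Int_eq:
  assumes "adjacent k U W" "subspace P" "P \<subseteq> U" "P \<subseteq> W" "Suc (dim P) = k"
  shows "U \<inter> W = P"
  using assms subspace_dim_equal[of P "U \<inter> W"]
  by (auto simp: adjacent_def grassmannian_def subspace_inter)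

text \<open>The dimension formula makes adjacency self-dual; this is the source of the symmetry
  between stars and tops.\<close>

lemma adjacent_iff_join:
  "adjacent k U W \<longleftrightarrow> U \<in> grassmannian k \<and> W \<in> grassmannian k \<and> U \<noteq> W \<and> dim (span (U \<union> W)) = Suc k"
proof (cases "U \<in> grassmannian k \<and> W \<in> grassmannian k")
  case True
  then have "dim (span (U \<union> W)) + dim (U \<inter> W) = k + k"
    using dim_join[of U W] by (auto simp: grassmannian_def)
  then show ?thesis unfolding adjacent_def by auto
qed (auto simp: adjacent_def)

lemma dim_join_greater:
  assumes "U \<in> grassmannian k" "W \<in> grassmannian k" "U \<noteq> W"
  shows "dim (span (U \<union> W)) > k"
  using dim_Int_less[OF assms] dim_join[of U W] assms by (auto simp: grassmannian_def)

lemma join_eq: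
  assumes "U \<in> grassmannian k" "W \<in> grassmannian k" "U \<noteq> W"
    and "U \<subseteq> Q" "W \<subseteq> Q" "Q \<in> grassmannian (Suc k)"
  shows "span (U \<union> W) = Q"
proof (rule subspace_dim_equal)
  show "span (U \<union> W) \<subseteq> Q" using assms by (intro span_minimal) (auto simp: grassmannian_def)
qed (use assms dim_join_greater[of U k W] in \<open>auto simp: grassmannian_def\<close>)

lemma adjacentI_join:
  assumes "U \<in> grassmannian k" "W \<in> grassmannian k" "U \<noteq> W"
    and "U \<subseteq> Q" "W \<subseteq> Q" "Q \<in> grassmannian (Suc k)"
  shows "adjacent k U W"
  using join_eq[OF assms] assms by (auto simp: adjacent_iff_join grassmannian_def simp del: dim_span)

lemma adjacent_grassmannian:
  assumes "adjacent k U W"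
  shows "U \<in> grassmannian k" "W \<in> grassmannian k" "U \<noteq> W" "U \<inter> W \<in> grassmannian (k - 1)"
    "span (U \<union> W) \<in> grassmannian (Suc k)" "0 < k"
  using assms adjacent_iff_join[of k U W]
  by (auto simp: adjacent_def grassmannian_def subspace_inter simp del: dim_span)

definition clique_triple :: "nat \<Rightarrow> 'b set \<Rightarrow> 'b set \<Rightarrow> 'b set \<Rightarrow> bool" where
  "clique_triple k U V W \<longleftrightarrow> adjacent k U V \<and> adjacent k U W \<and> adjacent k V W"

text \<open>One inclusion suffices: all pairwise intersections have dimension k-1, so they coincide
  as soon as one lies in the third plane. Dually for tops and pairwise sums.\<close>

definition star_triple :: "nat \<Rightarrow> 'b set \<Rightarrow> 'b set \<Rightarrow> 'b set \<Rightarrow> bool" where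
  "star_triple k U V W \<longleftrightarrow> clique_triple k U V W \<and> U \<inter> V \<subseteq> W"

definition top_triple :: "nat \<Rightarrow> 'b set \<Rightarrow> 'b set \<Rightarrow> 'b set \<Rightarrow> bool" where
  "top_triple k U V W \<longleftrightarrow> clique_triple k U V W \<and> W \<subseteq> span (U \<union> V)"

lemma star_tripleE:
  assumes "star_triple k U V W"
  obtains P where "P \<in> grassmannian (k - 1)" "Suc (dim P) = k" "U \<inter> V = P" "U \<inter> W = P" "V \<inter> W = P"
proof -
  have c: "adjacent k U V" "adjacent k U W" "adjacent k V W" "U \<inter> V \<subseteq> W"
    using assms by (auto simp: star_triple_def clique_triple_def)
  have P: "subspace (U \<inter> V)" "Suc (dim (U \<inter> V)) = k"
    using c by (auto simp: adjacent_def grassmannian_def subspace_inter)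
  have "U \<inter> W = U \<inter> V" "V \<inter> W = U \<inter> V"
    using adjacent_Int_eq[OF c(2) P(1)] adjacent_Int_eq[OF c(3) P(1)] c P by blast+
  then show ?thesis using that[of "U \<inter> V"] P adjacent_grassmannian[OF c(1)] by blast
qed

lemma star_tripleI:
  assumes "U \<in> grassmannian k" "V \<in> grassmannian k" "W \<in> grassmannian k"
    and "U \<noteq> V" "U \<noteq> W" "V \<noteq> W"
    and "subspace P" "Suc (dim P) = k" "P \<subseteq> U" "P \<subseteq> V" "P \<subseteq> W"
  shows "star_triple k U V W"
proof -
  have c: "adjacent k U V" "adjacent k U W" "adjacent k V W"
    using assms adjacentI_common by blast+
  moreover have "U \<inter> V = P" using adjacent_Int_eq[OF c(1)] assms by blast
  ultimately show ?thesis using assms by (simp add: star_triple_def clique_triple_def)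
qed

lemma top_tripleE:
  assumes "top_triple k U V W"
  obtains Q where "Q \<in> grassmannian (Suc k)" "span (U \<union> V) = Q" "span (U \<union> W) = Q" "span (V \<union> W) = Q"
    "U \<subseteq> Q" "V \<subseteq> Q" "W \<subseteq> Q"
proof -
  have c: "adjacent k U V" "adjacent k U W" "adjacent k V W" "W \<subseteq> span (U \<union> V)"
    using assms by (auto simp: top_triple_def clique_triple_def)
  let ?Q = "span (U \<union> V)"
  have Q: "?Q \<in> grassmannian (Suc k)" "U \<subseteq> ?Q" "V \<subseteq> ?Q"
    using adjacent_grassmannian[OF c(1)] span_superset[of "U \<union> V"] by blast+
  have "span (U \<union> W) = ?Q" "span (V \<union> W) = ?Q"
    using join_eq[OF adjacent_grassmannian(1-3)[OF c(2)] _ _ Q(1)]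
      join_eq[OF adjacent_grassmannian(1-3)[OF c(3)] _ _ Q(1)] Q c by blast+
  then show ?thesis using that[of ?Q] Q c by blast
qed

lemma top_tripleI:
  assumes "U \<in> grassmannian k" "V \<in> grassmannian k" "W \<in> grassmannian k"
    and "U \<noteq> V" "U \<noteq> W" "V \<noteq> W"
    and "Q \<in> grassmannian (Suc k)" "U \<subseteq> Q" "V \<subseteq> Q" "W \<subseteq> Q"
  shows "top_triple k U V W"
proof -
  have c: "adjacent k U V" "adjacent k U W" "adjacent k V W"
    using assms adjacentI_join by blast+
  moreover have "span (U \<union> V) = Q" using join_eq assms by blast
  ultimately show ?thesis using assms by (simp add: top_triple_def clique_triple_def)
qed

text \<open>If \<open>U \<inter> W\<close> and \<open>V \<inter> W\<close> differ, they are two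
  hyperplanes of \<open>W\<close> and span it, so \<open>W\<close> lies in the sum of
  \<open>U\<close> and \<open>V\<close>. If they agree, they equal \<open>U \<inter> V\<close> by
  dimension.\<close>

lemma clique_triple_cases:
  assumes "clique_triple k U V W"
  shows "star_triple k U V W \<or> top_triple k U V W"
proof (rule disjCI)
  assume nt: "\<not> top_triple k U V W"
  have c: "adjacent k U V" "adjacent k U W" "adjacent k V W"
    using assms by (auto simp: clique_triple_def)
  have G: "U \<inter> W \<in> grassmannian (k - 1)" "V \<inter> W \<in> grassmannian (k - 1)" "U \<inter> V \<in> grassmannian (k - 1)"
     "W \<in> grassmannian (Suc (k - 1))" "0 < k"
    using adjacent_grassmannian[OF c(1)] adjacent_grassmannian[OF c(2)] adjacent_grassmannian[OF c(3)] by auto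
  have "U \<inter> W = V \<inter> W"
  proof (rule ccontr)
    assume "U \<inter> W \<noteq> V \<inter> W"
    then have "W = span (U \<inter> W \<union> V \<inter> W)" using join_eq[OF G(1,2) _ _ _ G(4)] by blast
    also have "\<dots> \<subseteq> span (U \<union> V)" by (rule span_mono) blast
    finally show False using nt assms by (simp add: top_triple_def)
  qed
  then have "U \<inter> W = U \<inter> V" using grassmannian_eqI[OF G(1,3)] by blast
  then show "star_triple k U V W" using assms by (auto simp: star_triple_def)
qed

text \<open>Modulo \<open>U \<inter> V\<close> the two planes are points of a projective line, and
  over every field this line has a third point, here the one of \<open>x + y\<close>.\<close>

lemma adjacent_pencil:
  assumes "adjacent k U V"
  obtains W where "star_triple k U V W" "top_triple k U V W"
proof -
  note a = adjacent_grassmannian[OF assms]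
  have sk: "Suc (dim (U \<inter> V)) = k" using assms by (simp add: adjacent_def)
  obtain x where x: "x \<in> U" "x \<notin> V" using grassmannian_eqI[of U k V] a by blast
  obtain y where y: "y \<in> V" "y \<notin> U" using grassmannian_eqI[of V k U] a by blast
  let ?W = "span (insert (x + y) (U \<inter> V))"
  have xy: "x + y \<notin> U" "x + y \<notin> V"
    using x y a by (metis grassmannianD(1,3) span_add_eq, metis grassmannianD(1,3) span_add_eq2)
  have "x + y \<notin> span (U \<inter> V)" using xy a(4) grassmannianD(3) by blast
  then have W: "?W \<in> grassmannian k" using sk by (auto intro!: grassmannianI simp: dim_insert)
  have P: "U \<inter> V \<subseteq> ?W" "x + y \<in> ?W" using span_superset[of "insert (x + y) (U \<inter> V)"] by auto
  have Q: "?W \<subseteq> span (U \<union> V)"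
  proof (rule span_minimal)
    have "x \<in> span (U \<union> V)" "y \<in> span (U \<union> V)" using x y span_superset[of "U \<union> V"] by blast+
    then show "insert (x + y) (U \<inter> V) \<subseteq> span (U \<union> V)" using span_superset[of "U \<union> V"] by (auto intro: span_add)
  qed simp
  have "star_triple k U V ?W"
    using star_tripleI[of U k V ?W "U \<inter> V"] a W P xy sk by (auto simp: grassmannian_def)
  moreover have "top_triple k U V ?W"
    using calculation Q by (simp add: star_triple_def top_triple_def)
  ultimately show ?thesis using that by blast
qed

end

section \<open>The fundamental theorem of projective geometry\<close>

context vector_space
begin

text \<open>Independence is expressed by coefficients because the set \<open>{x, y}\<close>
  collapses when \<open>x = y\<close>, a case that must count as dependent.\<close>

definition lin2 :: "'b \<Rightarrow> 'b \<Rightarrow> bool" where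
  "lin2 x y \<longleftrightarrow> (\<forall>a b. a *s x + b *s y = 0 \<longrightarrow> a = 0 \<and> b = 0)"

definition lin3 :: "'b \<Rightarrow> 'b \<Rightarrow> 'b \<Rightarrow> bool" where
  "lin3 x y z \<longleftrightarrow> (\<forall>a b c. a *s x + b *s y + c *s z = 0 \<longrightarrow> a = 0 \<and> b = 0 \<and> c = 0)"

lemma in_span_pair: "z \<in> span {x, y} \<longleftrightarrow> (\<exists>a b. z = a *s x + b *s y)"
proof -
  have "z \<in> span {x, y} \<longleftrightarrow> (\<exists>a b. z - a *s x = b *s y)"
    by (auto simp: span_breakdown_eq[of z x] span_singleton)
  then show ?thesis by (simp add: diff_eq_eq add.commute)
qed

lemma in_span_single: "z \<in> span {x} \<longleftrightarrow> (\<exists>a. z = a *s x)"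
  by (auto simp: span_singleton)

lemma scale_inverse_eq: "b \<noteq> 0 \<Longrightarrow> b *s y = z \<Longrightarrow> y = inverse b *s z"
  by auto

lemma lin2_iff: "lin2 x y \<longleftrightarrow> x \<noteq> 0 \<and> y \<notin> span {x}"
proof
  assume l: "lin2 x y"
  have "x \<noteq> 0" using l[unfolded lin2_def, rule_format, of 1 0] by auto
  moreover have "y \<noteq> a *s x" for a using l[unfolded lin2_def, rule_format, of "-a" 1] by auto
  ultimately show "x \<noteq> 0 \<and> y \<notin> span {x}" by (auto simp: in_span_single)
next
  assume r: "x \<noteq> 0 \<and> y \<notin> span {x}"
  show "lin2 x y" unfolding lin2_def
  proof (intro allI impI)
    fix a b assume e: "a *s x + b *s y = 0"
    have "b = 0"
    proof (rule ccontr)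
      assume "b \<noteq> 0"
      moreover have "b *s y = (- a) *s x" using e by (simp add: eq_neg_iff_add_eq_0 add.commute)
      ultimately have "y = inverse b *s ((- a) *s x)" by (rule scale_inverse_eq)
      then show False using r by (metis in_span_single scale_scale)
    qed
    then show "a = 0 \<and> b = 0" using e r by simp
  qed
qed

lemma lin3_iff: "lin3 x y z \<longleftrightarrow> lin2 x y \<and> z \<notin> span {x, y}"
proof
  assume l: "lin3 x y z"
  have "lin2 x y" unfolding lin2_def
  proof (intro allI impI)
    fix a b assume "a *s x + b *s y = 0"
    then show "a = 0 \<and> b = 0" using l[unfolded lin3_def, rule_format, of a b 0] by simp
  qed
  moreover have "z \<noteq> a *s x + b *s y" for a b
  proof
    assume "z = a *s x + b *s y"
    then have "(-a) *s x + (-b) *s y + 1 *s z = 0" by simp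
    then show False using l unfolding lin3_def by (metis zero_neq_one)
  qed
  ultimately show "lin2 x y \<and> z \<notin> span {x, y}" by (auto simp: in_span_pair)
next
  assume r: "lin2 x y \<and> z \<notin> span {x, y}"
  show "lin3 x y z" unfolding lin3_def
  proof (intro allI impI)
    fix a b c assume e: "a *s x + b *s y + c *s z = 0"
    have "c = 0"
    proof (rule ccontr)
      assume c: "c \<noteq> 0"
      have "c *s z = - (a *s x + b *s y)" using e by (metis eq_neg_iff_add_eq_0 add.commute)
      then have "z = inverse c *s (- (a *s x + b *s y))" by (rule scale_inverse_eq[OF c])
      moreover have "a *s x + b *s y \<in> span {x, y}" by (auto simp: in_span_pair)
      ultimately show False using r by (metis span_neg span_scale)
    qed
    then show "a = 0 \<and> b = 0 \<and> c = 0" using e r by (simp add: lin2_def)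
  qed
qed

lemma lin2_sym: "lin2 x y \<Longrightarrow> lin2 y x"
  unfolding lin2_def by (metis add.commute)

lemma lin3_rot: "lin3 x y z \<Longrightarrow> lin3 y z x"
  unfolding lin3_def by (metis add.commute add.left_commute)

lemma lin3_swap: "lin3 x y z \<Longrightarrow> lin3 y x z"
  unfolding lin3_def by (metis add.commute)

lemma lin3_lin2: "lin3 x y z \<Longrightarrow> lin2 x y" "lin3 x y z \<Longrightarrow> lin2 x z" "lin3 x y z \<Longrightarrow> lin2 y z"
  using lin3_iff lin3_rot lin3_swap by blast+

lemma lin2_nonzero: "lin2 x y \<Longrightarrow> x \<noteq> 0" "lin2 x y \<Longrightarrow> y \<noteq> 0"
  using lin2_iff lin2_sym by blast+

lemma lin2_add: "lin2 x y \<Longrightarrow> lin2 x (x + y)"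
  unfolding lin2_iff using span_add_eq[of x "{x}" y] span_base by blast

lemma lin2_sum_nonzero: "lin2 x y \<Longrightarrow> x + y \<noteq> 0"
  using lin2_add lin2_nonzero by blast

lemma lin2_scale: "lin2 x y \<Longrightarrow> a \<noteq> 0 \<Longrightarrow> lin2 (a *s x) y"
  unfolding lin2_def by (metis no_zero_divisors scale_scale)

lemma lin3_coeff_eq:
  assumes "lin3 x y z" "a *s x + b *s y + c *s z = a' *s x + b' *s y + c' *s z"
  shows "a = a'" "b = b'" "c = c'"
proof -
  have "(a - a') *s x + (b - b') *s y + (c - c') *s z = 0"
    using assms(2) by (simp add: scale_left_diff_distrib algebra_simps)
  then show "a = a'" "b = b'" "c = c'" using assms(1) unfolding lin3_def by (metis eq_iff_diff_eq_0)+
qed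

lemma lin2_coeff_eq:
  assumes "lin2 x y" "a *s x + b *s y = a' *s x + b' *s y"
  shows "a = a'" "b = b'"
proof -
  have "(a - a') *s x + (b - b') *s y = 0"
    using assms(2) by (simp add: scale_left_diff_distrib algebra_simps)
  then show "a = a'" "b = b'" using assms(1) unfolding lin2_def by (metis eq_iff_diff_eq_0)+
qed

end

text \<open>\<open>H\<close> picks a vector in the image of each projective point, arbitrarily
  scaled and not assumed additive; nothing is said about \<open>H 0\<close>. With
  \<open>y = z\<close>, \<open>H_line\<close> says that proportional vectors, and only these, have
  proportional images.\<close>

locale point_collineation = finite_dimensional_vector_space +
  fixes H :: "'b \<Rightarrow> 'b"
  assumes H_nonzero: "x \<noteq> 0 \<Longrightarrow> H x \<noteq> 0"
    and H_line: "\<lbrakk>x \<noteq> 0; y \<noteq> 0; z \<noteq> 0\<rbrakk> \<Longrightarrow> x \<in> span {y, z} \<longleftrightarrow> H x \<in> span {H y, H z}"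
    and H_surj: "y \<noteq> 0 \<Longrightarrow> \<exists>x. x \<noteq> 0 \<and> y \<in> span {H x}"
    and dim_ge_3: "3 \<le> dim (UNIV :: 'b set)"
begin

lemma ex_lin3: "lin2 x y \<Longrightarrow> \<exists>z. lin3 x y z"
proof -
  assume l: "lin2 x y"
  have "dim {x, y} \<le> 2" by (simp add: dim_insert)
  then have "dim (span {x, y}) \<noteq> dim (UNIV :: 'b set)" using dim_ge_3 unfolding dim_span by linarith
  then show ?thesis using l lin3_iff by (metis UNIV_eq_I)
qed

lemma ex_lin2: "x \<noteq> 0 \<Longrightarrow> \<exists>y. lin2 x y"
proof -
  assume "x \<noteq> 0"
  have "dim {x} \<le> 1" by simp
  then have "dim (span {x}) \<noteq> dim (UNIV :: 'b set)" using dim_ge_3 unfolding dim_span by linarith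
  then show ?thesis using \<open>x \<noteq> 0\<close> lin2_iff by (metis UNIV_eq_I)
qed

text \<open>These are the candidates for the value at \<open>x\<close> of a semilinear map inducing
  \<open>H\<close>.\<close>

definition pt :: "'b \<Rightarrow> 'b \<Rightarrow> bool" where
  "pt x x' \<longleftrightarrow> x \<noteq> 0 \<and> x' \<noteq> 0 \<and> x' \<in> span {H x}"

lemma ptE:
  assumes "pt x x'" obtains a where "a \<noteq> 0" "x' = a *s H x" "x \<noteq> 0" "H x \<noteq> 0"
  using assms H_nonzero unfolding pt_def in_span_single by auto

lemma pt_H: "x \<noteq> 0 \<Longrightarrow> pt x (H x)"
  by (simp add: pt_def H_nonzero span_base)

lemma pt_scale: "pt x x' \<Longrightarrow> a \<noteq> 0 \<Longrightarrow> pt x (a *s x')"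
  by (auto simp: pt_def span_scale)

lemma pt_nonzero: "pt x x' \<Longrightarrow> x \<noteq> 0" "pt x x' \<Longrightarrow> x' \<noteq> 0"
  by (simp_all add: pt_def)

lemma pt_unique_scale:
  assumes "pt x x'" "pt x x''" obtains a where "a \<noteq> 0" "x'' = a *s x'"
proof -
  obtain a where a: "a \<noteq> 0" "x' = a *s H x" using assms(1) by (rule ptE)
  obtain b where b: "b \<noteq> 0" "x'' = b *s H x" using assms(2) by (rule ptE)
  have "x'' = (b / a) *s x'" using a b by simp
  then show ?thesis using that[of "b / a"] a b by simp
qed

lemma span_pair_scale:
  assumes "a \<noteq> 0" "b \<noteq> 0"
  shows "span {a *s x, b *s y} = span {x, y}"
proof -
  have "x = inverse a *s (a *s x)" "y = inverse b *s (b *s y)" using assms by auto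
  then have "x \<in> span {a *s x, b *s y}" "y \<in> span {a *s x, b *s y}"
    by (metis insertI1 span_base span_scale, metis insertCI span_base span_scale)
  then show ?thesis unfolding span_eq by (simp add: span_base span_scale)
qed

lemma pt_line:
  assumes "pt x x'" "pt y y'" "pt z z'"
  shows "z \<in> span {x, y} \<longleftrightarrow> z' \<in> span {x', y'}"
proof -
  obtain a where a: "a \<noteq> 0" "x' = a *s H x" "x \<noteq> 0" using assms(1) by (rule ptE)
  obtain b where b: "b \<noteq> 0" "y' = b *s H y" "y \<noteq> 0" using assms(2) by (rule ptE)
  obtain c where c: "c \<noteq> 0" "z' = c *s H z" "z \<noteq> 0" using assms(3) by (rule ptE)
  have "z' \<in> span {x', y'} \<longleftrightarrow> c *s H z \<in> span {H x, H y}"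
    using a b c by (simp add: span_pair_scale)
  also have "\<dots> \<longleftrightarrow> H z \<in> span {H x, H y}"
    using c(1) by (metis scale_inverse_eq span_scale)
  finally show ?thesis using H_line a b c by blast
qed

lemma pt_lin2: "pt x x' \<Longrightarrow> pt y y' \<Longrightarrow> lin2 x y \<longleftrightarrow> lin2 x' y'"
  using pt_line[of x x' x x' y y'] pt_nonzero by (auto simp: lin2_iff)

lemma pt_lin3: "pt x x' \<Longrightarrow> pt y y' \<Longrightarrow> pt z z' \<Longrightarrow> lin3 x y z \<longleftrightarrow> lin3 x' y' z'"
  using pt_line[of x x' y y' z z'] pt_lin2[of x x' y y'] by (auto simp: lin3_iff)

text \<open>A semilinear map inducing \<open>H\<close> can map \<open>e\<close> to \<open>e'\<close> and \<open>x\<close> to \<open>x'\<close> only if these are linked. A choice of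
  \<open>e'\<close> thus determines \<open>x'\<close>, and the images of all other vectors.\<close>

definition link :: "'b \<Rightarrow> 'b \<Rightarrow> 'b \<Rightarrow> 'b \<Rightarrow> bool" where
  "link e e' x x' \<longleftrightarrow> lin2 e x \<and> pt e e' \<and> pt x x' \<and> pt (e + x) (e' + x')"

lemma link_sym: "link e e' x x' \<Longrightarrow> link x x' e e'"
  by (simp add: link_def lin2_sym add.commute)

text \<open>The image point of \<open>e + x\<close> lies on the line joining those of
  \<open>e\<close> and \<open>x\<close> and differs from both, so \<open>H (e + x)\<close> has
  nonzero coefficients along \<open>e'\<close> and \<open>H x\<close>. Dividing by the first makes
  the coefficient of \<open>e'\<close> equal to 1; the other summand is \<open>x'\<close>.\<close>

lemma ex_link:
  assumes "lin2 e x" "pt e e'"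
  shows "\<exists>x'. link e e' x x'"
proof -
  have nz: "e \<noteq> 0" "x \<noteq> 0" "e + x \<noteq> 0"
    using assms lin2_nonzero lin2_sum_nonzero by blast+
  note p = assms(2) pt_H[OF nz(2)] pt_H[OF nz(3)]
  have "e + x \<in> span {e, x}" unfolding in_span_pair by (metis scale_one)
  then obtain a b where ab: "H (e + x) = a *s e' + b *s H x"
    using pt_line[OF p] unfolding in_span_pair by blast
  have l1: "lin2 e' (H (e + x))" using assms lin2_add pt_lin2[OF p(1,3)] by blast
  have l2: "lin2 (H x) (H (e + x))"
    using assms lin2_add[of x e] lin2_sym pt_lin2[OF p(2,3)] by (metis add.commute)
  have a: "a \<noteq> 0" using l2 ab by (auto simp: lin2_iff in_span_single)
  have b: "b \<noteq> 0" using l1 ab by (auto simp: lin2_iff in_span_single)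
  have "e' + (b / a) *s H x = (1 / a) *s H (e + x)" using a ab by (simp add: scale_right_distrib)
  moreover have "pt (e + x) ((1 / a) *s H (e + x))" using p(3) a pt_scale by simp
  moreover have "pt x ((b / a) *s H x)" using p(2) a b pt_scale by simp
  ultimately show ?thesis using assms unfolding link_def by metis
qed

lemma link_unique:
  assumes "link e e' x x'" "link e e' x x''"
  shows "x' = x''"
proof -
  have p: "pt x x'" "pt x x''" "pt (e + x) (e' + x')" "pt (e + x) (e' + x'')" "pt e e'" "lin2 e x"
    using assms by (auto simp: link_def)
  obtain a where a: "x'' = a *s x'" using pt_unique_scale[OF p(1,2)] by blast
  obtain b where b: "e' + x'' = b *s (e' + x')" using pt_unique_scale[OF p(3,4)] by blast
  have l: "lin2 e' x'" using p pt_lin2 by blast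
  have "1 *s e' + a *s x' = b *s e' + b *s x'" using a b by (simp add: scale_right_distrib)
  then have "1 = b" "a = b" using lin2_coeff_eq[OF l] by blast+
  then show ?thesis using a by simp
qed

text \<open>The point of \<open>e + x + y\<close> is where the line through \<open>e + x\<close> and
  \<open>y\<close> meets the line through \<open>e + y\<close> and \<open>x\<close>; comparing
  coefficients identifies its image as the point of \<open>e' + x' + y'\<close>. Then
  \<open>x + y\<close> is where the line through \<open>x\<close> and \<open>y\<close> meets the one
  through \<open>e\<close> and \<open>e + x + y\<close>, which gives \<open>x' + y'\<close>.\<close>

lemma link_triangle:
  assumes ex: "link e e' x x'" and ey: "link e e' y y'" and l: "lin3 e x y"
  shows "link x x' y y'" "link e e' (x + y) (x' + y')"
proof -
  have p: "pt e e'" "pt x x'" "pt y y'" "pt (e + x) (e' + x')" "pt (e + y) (e' + y')"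
    using ex ey by (auto simp: link_def)
  have l': "lin3 e' x' y'" using pt_lin3 p l by blast
  have xy: "lin2 x y" using l lin3_lin2 by blast
  have exy: "lin2 e (x + y)"
  proof -
    have "a *s e + b *s (x + y) = 0 \<Longrightarrow> a = 0 \<and> b = 0" for a b
      using l unfolding lin3_def by (metis add.assoc scale_right_distrib)
    then show ?thesis by (simp add: lin2_def)
  qed
  let ?s = "e + x + y"
  have s: "?s \<noteq> 0" using lin2_sum_nonzero[OF exy] by (simp add: add.assoc)
  define w where "w = H ?s"
  have pw: "pt ?s w" using s by (simp add: w_def pt_H)
  have "?s = 1 *s (e + x) + 1 *s y" "?s = 1 *s (e + y) + 1 *s x" by (simp_all add: algebra_simps)
  then have "?s \<in> span {e + x, y}" "?s \<in> span {e + y, x}" unfolding in_span_pair by blast+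
  then have "w \<in> span {e' + x', y'}" "w \<in> span {e' + y', x'}" using pt_line pw p by blast+
  then obtain a b c d where ab: "w = a *s (e' + x') + b *s y'" and cd: "w = c *s (e' + y') + d *s x'"
    unfolding in_span_pair by blast
  have "a *s e' + a *s x' + b *s y' = c *s e' + d *s x' + c *s y'"
    using ab cd by (simp add: scale_right_distrib algebra_simps)
  from lin3_coeff_eq[OF l' this] have "w = a *s (e' + x' + y')"
    using ab by (simp add: scale_right_distrib)
  moreover from this have "a \<noteq> 0" using pt_nonzero(2)[OF pw] by auto
  ultimately have ps: "pt ?s (e' + x' + y')"
    using pt_scale[OF pw, of "inverse a"] by simp
  have nz: "x + y \<noteq> 0" using lin2_sum_nonzero[OF xy] .
  define u where "u = H (x + y)"
  have pu: "pt (x + y) u" using nz by (simp add: u_def pt_H)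
  have "x + y = 1 *s x + 1 *s y" "x + y = (-1) *s e + 1 *s ?s" by (simp_all add: algebra_simps)
  then have "x + y \<in> span {x, y}" "x + y \<in> span {e, ?s}" unfolding in_span_pair by blast+
  then have "u \<in> span {x', y'}" "u \<in> span {e', e' + x' + y'}" using pt_line pu p ps by blast+
  then obtain a b c d where ab: "u = a *s x' + b *s y'" and cd: "u = c *s e' + d *s (e' + x' + y')"
    unfolding in_span_pair by blast
  have "0 *s e' + a *s x' + b *s y' = (c + d) *s e' + d *s x' + d *s y'"
    using ab cd by (simp add: scale_right_distrib scale_left_distrib algebra_simps)
  from lin3_coeff_eq[OF l' this] have "u = a *s (x' + y')"
    using ab by (simp add: scale_right_distrib)
  moreover from this have "a \<noteq> 0" using pt_nonzero(2)[OF pu] by auto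
  ultimately have pxy: "pt (x + y) (x' + y')"
    using pt_scale[OF pu, of "inverse a"] by simp
  show "link x x' y y'" using xy p pxy by (simp add: link_def)
  show "link e e' (x + y) (x' + y')" using exy p pxy ps by (simp add: link_def add.assoc)
qed

text \<open>For independent \<open>e\<close>, \<open>f\<close>, \<open>x\<close> this is
  \<open>link_triangle\<close>. Otherwise they lie in one plane, and a vector \<open>z\<close>
  outside it, which exists in dimension at least 3, is linked first with \<open>f\<close> and
  \<open>x\<close> through \<open>e\<close>; then \<open>f\<close> and \<open>x\<close> are linked
  through \<open>z\<close>.\<close>

lemma link_coherent:
  assumes ef: "link e e' f f'" and ex: "link e e' x x'" and fx: "lin2 f x"
  shows "link f f' x x'"
proof (cases "lin3 e f x")
  case True
  then show ?thesis using link_triangle(1)[OF ef ex] by blast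
next
  case False
  have l: "lin2 e f" "lin2 e x" "pt e e'" using ef ex by (auto simp: link_def)
  then have x: "x \<in> span {e, f}" using False by (simp add: lin3_iff)
  obtain z where z: "lin3 e f z" using ex_lin3 l by blast
  have "lin3 e x z"
  proof -
    have "span {e, x} \<subseteq> span {e, f}" using x by (intro span_minimal) (auto intro: span_base)
    then show ?thesis using z l by (auto simp: lin3_iff)
  qed
  moreover have "lin3 f x z"
  proof -
    have "span {f, x} \<subseteq> span {e, f}" using x by (intro span_minimal) (auto intro: span_base)
    then show ?thesis using z fx by (auto simp: lin3_iff)
  qed
  moreover obtain z' where ez: "link e e' z z'" using ex_link z l lin3_lin2 by blast
  ultimately have "link z z' f f'" "link z z' x x'" "lin3 z f x"
    using link_triangle(1)[OF ez ef] link_triangle(1)[OF ez ex] z lin3_rot lin3_swap by blast+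
  then show ?thesis using link_triangle(1) by blast
qed

lemma ex_lift:
  obtains g where "\<And>x. x \<noteq> 0 \<Longrightarrow> pt x (g x)" "g 0 = 0" "\<And>x y. lin2 x y \<Longrightarrow> link x (g x) y (g y)"
proof -
  obtain e where e: "(e::'b) \<noteq> 0" using dim_ge_3 dim_eq_0[of "UNIV::'b set"] by force
  define e' where "e' = H e"
  have pe: "pt e e'" using e by (simp add: e'_def pt_H)
  \<comment> \<open>A link needs independent vectors, so multiples of \<open>e\<close>, including
    \<open>e\<close> itself, cannot be linked with \<open>e\<close>; their values are obtained in
    two steps through some \<open>z\<close>.\<close>
  define good where "good x x' \<longleftrightarrow> x \<noteq> 0 \<and>
     (if lin2 e x then link e e' x x' else (\<exists>z z'. link e e' z z' \<and> link z z' x x'))" for x x'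
  have dep: "lin2 z x" if "lin2 e z" "x \<noteq> 0" "\<not> lin2 e x" for x z
  proof -
    have "x \<in> span {e}" using that e by (simp add: lin2_iff)
    then obtain a where "x = a *s e" by (auto simp: in_span_single)
    then show ?thesis using that lin2_scale[OF that(1), of a] lin2_sym by auto
  qed
  have ex_good: "\<exists>x'. good x x'" if "x \<noteq> 0" for x
  proof (cases "lin2 e x")
    case True
    then show ?thesis using ex_link[OF True pe] that by (auto simp: good_def)
  next
    case False
    obtain z where z: "lin2 e z" using ex_lin2 e by blast
    obtain z' where z': "link e e' z z'" using ex_link[OF z pe] by blast
    have "\<exists>x'. link z z' x x'" using ex_link[OF dep[OF z that False]] z' by (auto simp: link_def)
    then show ?thesis using z' that False by (auto simp: good_def)
  qed
  have move: "link w w' x x'"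
    if "link e e' z z'" "link z z' x x'" "link e e' w w'" "\<not> lin2 e x" "lin2 z w" for x x' z z' w w'
  proof -
    have "link z z' w w'" using link_coherent that by blast
    moreover have "lin2 w x" using dep[of w x] that lin2_nonzero by (auto simp: link_def)
    ultimately show ?thesis using link_coherent that(2) by blast
  qed
  \<comment> \<open>The value obtained at a multiple of \<open>e\<close> does not depend on the
    intermediate vector.\<close>
  have special: "link w w' x x'" if gx: "good x x'" and "link e e' w w'" and nex: "\<not> lin2 e x" for x x' w w'
  proof -
    obtain z z' where z: "link e e' z z'" "link z z' x x'" using gx nex by (auto simp: good_def)
    have ez: "lin2 e z" and ew: "lin2 e w" using z that by (auto simp: link_def)
    show ?thesis
    proof (cases "lin2 z w")
      case True
      then show ?thesis using move z that by blast
    next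
      case False
      \<comment> \<open>If \<open>w\<close> is a multiple of \<open>z\<close>, no link joins them
        directly; the detour uses \<open>v\<close>, independent of both.\<close>
      obtain v where v: "lin3 e z v" using ex_lin3 ez by blast
      then obtain v' where v': "link e e' v v'" using ex_link pe lin3_lin2 by blast
      have zv: "lin2 z v" using v lin3_lin2 by blast
      obtain a where "w = a *s z" "a \<noteq> 0"
        using False ez ew lin2_nonzero[OF ez] lin2_nonzero[OF ew] by (auto simp: lin2_iff in_span_single)
      then have "lin2 v w" using zv lin2_scale lin2_sym by blast
      moreover have "link v v' x x'" using move z v' zv that by blast
      ultimately show ?thesis using move v' that by blast
    qed
  qed
  have good_link: "link x x' y y'" if "good x x'" "good y y'" "lin2 x y" for x x' y y'
  proof -
    consider "lin2 e x" "lin2 e y" | "\<not> lin2 e x" "lin2 e y" | "lin2 e x" "\<not> lin2 e y"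
      | "\<not> lin2 e x" "\<not> lin2 e y" by blast
    then show ?thesis
    proof cases
      case 1
      then have "link e e' x x'" "link e e' y y'" using that by (simp_all add: good_def)
      then show ?thesis using that(3) by (rule link_coherent)
    next
      case 2
      then have "link e e' y y'" using that by (simp add: good_def)
      then show ?thesis using special[OF that(1) _ 2(1)] link_sym by blast
    next
      case 3
      then have "link e e' x x'" using that by (simp add: good_def)
      then show ?thesis using special[OF that(2) _ 3(2)] by blast
    next
      case 4
      then obtain a b where "x = a *s e" "y = b *s e" using e by (auto simp: lin2_iff in_span_single)
      then have "b *s x + (- a) *s y = 0" by (simp add: mult.commute)
      then have "a = 0" using that(3) unfolding lin2_def by (metis neg_equal_0_iff_equal)
      then show ?thesis using \<open>x = a *s e\<close> that(1) by (simp add: good_def)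
    qed
  qed
  define g where "g x = (if x = 0 then 0 else (SOME x'. good x x'))" for x
  have gg: "good x (g x)" if "x \<noteq> 0" for x
    using someI_ex[OF ex_good[OF that]] that by (simp add: g_def)
  have gl: "lin2 x y \<Longrightarrow> link x (g x) y (g y)" for x y
    using good_link gg lin2_nonzero by blast
  moreover have "pt x (g x)" if "x \<noteq> 0" for x
    using gl ex_lin2[OF that] by (auto simp: link_def)
  ultimately show ?thesis using that[of g] by (simp add: g_def)
qed

theorem ex_collineation:
  obtains g where "collineation g" "\<And>x. x \<noteq> 0 \<Longrightarrow> g x \<noteq> 0 \<and> g x \<in> span {H x}"
proof -
  obtain g where gp: "\<And>x. x \<noteq> 0 \<Longrightarrow> pt x (g x)" and g0: "g 0 = 0"
    and gl: "\<And>x y. lin2 x y \<Longrightarrow> link x (g x) y (g y)" by (rule ex_lift) blast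
  have add2: "g (x + y) = g x + g y" if xy: "lin2 x y" for x y
  proof -
    obtain z where z: "lin3 x y z" using ex_lin3 xy by blast
    have l3: "lin3 z x y" using lin3_rot[OF lin3_rot[OF z]] .
    have l: "link z (g z) x (g x)" "link z (g z) y (g y)"
      using gl lin3_lin2(1,2)[OF l3] by blast+
    note t = link_triangle(2)[OF l l3]
    then have "lin2 z (x + y)" by (simp add: link_def)
    then have "link z (g z) (x + y) (g (x + y))" by (rule gl)
    then show ?thesis using t link_unique by blast
  qed
  have add: "g (x + y) = g x + g y" for x y
  proof (cases "x = 0 \<or> y = 0 \<or> lin2 x y")
    case True
    then show ?thesis using add2 g0 by auto
  next
    case False
    then have nz: "x \<noteq> 0" "y \<noteq> 0" and dep: "y \<in> span {x}" by (auto simp: lin2_iff)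
    \<comment> \<open>A vector \<open>z\<close> off the common line reduces the dependent case to
      \<open>add2\<close>: \<open>g (x + y + z)\<close> is evaluated in both bracketings.\<close>
    obtain z where z: "lin2 x z" using ex_lin2 nz by blast
    have yz: "lin2 y z" using dep z nz lin2_scale by (auto simp: in_span_single)
    have x_yz: "lin2 x (y + z)" using z dep by (auto simp: lin2_iff span_add_eq)
    have xy_z: "x + y = 0 \<or> lin2 (x + y) z"
    proof -
      obtain a where "y = a *s x" using dep by (auto simp: in_span_single)
      then have "x + y = (1 + a) *s x" by (simp add: scale_left_distrib)
      then show ?thesis using z lin2_scale by force
    qed
    have "g (x + y) + g z = g (x + y + z)" using xy_z add2 g0 by auto
    also have "\<dots> = g x + (g y + g z)" using add2[OF x_yz] add2[OF yz] by (simp add: add.assoc)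
    finally show ?thesis by (simp add: add.assoc[symmetric])
  qed
  \<comment> \<open>The factor may a priori depend on \<open>x\<close>. Comparing it at
    \<open>x\<close>, \<open>y\<close> and \<open>x + y\<close> for independent \<open>x\<close>,
    \<open>y\<close>, and passing through a third vector for dependent ones, shows that it does
    not.\<close>
  define s where "s a x = (SOME c. g (a *s x) = c *s g x)" for a x
  have s: "g (a *s x) = s a x *s g x" if "x \<noteq> 0" for a x
  proof -
    have "\<exists>c. g (a *s x) = c *s g x"
    proof (cases "a = 0")
      case True
      then show ?thesis using g0 by (auto intro: exI[of _ 0])
    next
      case False
      have "a *s x \<in> span {x, x}" by (simp add: span_scale span_base)
      moreover have "pt (a *s x) (g (a *s x))" using gp that False by simp
      ultimately have "g (a *s x) \<in> span {g x, g x}" using pt_line[OF gp[OF that] gp[OF that]] by blast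
      then show ?thesis by (simp add: in_span_single)
    qed
    then show ?thesis unfolding s_def by (rule someI_ex)
  qed
  have s2: "s a x = s a y" if xy: "lin2 x y" for a x y
  proof -
    have nz: "x \<noteq> 0" "y \<noteq> 0" "x + y \<noteq> 0" using xy lin2_nonzero lin2_sum_nonzero by blast+
    have l: "lin2 (g x) (g y)" using pt_lin2 gp nz xy by blast
    have "s a x *s g x + s a y *s g y = g (a *s (x + y))" using nz add s by (simp add: scale_right_distrib)
    also have "\<dots> = s a (x + y) *s g x + s a (x + y) *s g y" using s[OF nz(3)] add by (simp add: scale_right_distrib)
    finally show ?thesis using lin2_coeff_eq[OF l] by metis
  qed
  have s_const: "s a x = s a y" if nz: "x \<noteq> 0" "y \<noteq> 0" for a x y
  proof (cases "lin2 x y")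
    case False
    obtain z where z: "lin2 x z" using ex_lin2 nz by blast
    have "y \<in> span {x}" using False nz by (simp add: lin2_iff)
    then have "lin2 y z" using z nz lin2_scale by (auto simp: in_span_single)
    then show ?thesis using s2 z by metis
  qed (rule s2)
  obtain e where e: "(e::'b) \<noteq> 0" using dim_ge_3 dim_eq_0[of "UNIV::'b set"] by force
  define \<phi> where "\<phi> a = s a e" for a
  have sc: "g (a *s x) = \<phi> a *s g x" for a x
    using s[of x a] s_const[of x e a] e g0 by (cases "x = 0") (auto simp: \<phi>_def)
  have ge: "g e \<noteq> 0" using gp[OF e] pt_nonzero by blast
  have phi_add: "\<phi> (a + b) = \<phi> a + \<phi> b" for a b
  proof -
    have "\<phi> (a + b) *s g e = g (a *s e + b *s e)" using sc[of "a + b" e] by (simp add: scale_left_distrib)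
    also have "\<dots> = (\<phi> a + \<phi> b) *s g e" by (simp only: add sc scale_left_distrib)
    finally show ?thesis using ge by (metis scale_cancel_right)
  qed
  have phi_mult: "\<phi> (a * b) = \<phi> a * \<phi> b" for a b
  proof -
    have "\<phi> (a * b) *s g e = g (a *s (b *s e))" using sc[of "a * b" e] by simp
    also have "\<dots> = \<phi> a *s (\<phi> b *s g e)" by (simp only: sc)
    also have "\<dots> = (\<phi> a * \<phi> b) *s g e" by simp
    finally show ?thesis using ge by (metis scale_cancel_right)
  qed
  have phi_1: "\<phi> 1 = 1" using sc[of 1 e] ge by (metis scale_one scale_cancel_right)
  have phi_0: "a = 0" if "\<phi> a = 0" for a
    using phi_mult[of a "inverse a"] phi_1 that by (cases "a = 0") auto
  have phi_inj: "inj \<phi>"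
  proof (rule injI)
    fix a b assume "\<phi> a = \<phi> b"
    then have "\<phi> (a - b) = 0" using phi_add[of "a - b" b] by simp
    then show "a = b" using phi_0 by fastforce
  qed
  \<comment> \<open>The point of \<open>b *s g e + g y\<close> lies on the image of the line through
    \<open>e\<close> and \<open>y\<close>, so it comes from some \<open>c *s e + d *s y\<close>. Up
    to a common scalar its coefficients are \<open>\<phi> c\<close> and \<open>\<phi> d\<close>, so
    \<open>b\<close> is the value of \<open>\<phi>\<close> at the quotient of \<open>c\<close> by
    \<open>d\<close>.\<close>
  have phi_surj: "\<exists>a. b = \<phi> a" for b
  proof -
    obtain y where y: "lin2 e y" using ex_lin2 e by blast
    have nz: "y \<noteq> 0" using y lin2_nonzero by blast
    have l: "lin2 (g e) (g y)" using pt_lin2 gp e nz y by blast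
    let ?v = "b *s g e + 1 *s g y"
    have v: "?v \<noteq> 0" using l unfolding lin2_def by (metis zero_neq_one)
    obtain x where x: "x \<noteq> 0" "?v \<in> span {H x}" using H_surj[OF v] by blast
    then have px: "pt x ?v" using v by (simp add: pt_def)
    have "?v \<in> span {g e, g y}" unfolding in_span_pair by blast
    then have "x \<in> span {e, y}" using pt_line[OF gp[OF e] gp[OF nz] px] by blast
    then obtain c d where cd: "x = c *s e + d *s y" by (auto simp: in_span_pair)
    then have gx: "g x = \<phi> c *s g e + \<phi> d *s g y" by (simp add: add sc)
    obtain t where "t \<noteq> 0" "?v = t *s g x" using pt_unique_scale[OF gp[OF x(1)] px] by blast
    then have "b *s g e + 1 *s g y = (t * \<phi> c) *s g e + (t * \<phi> d) *s g y"
      using gx by (simp add: scale_right_distrib)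
    then have b: "b = t * \<phi> c" "1 = t * \<phi> d" using lin2_coeff_eq[OF l] by blast+
    then have d: "\<phi> d \<noteq> 0" by auto
    then have "d \<noteq> 0" using sc[of 0 e] g0 ge by auto
    then have "\<phi> (inverse d) * \<phi> d = 1" using phi_mult[of "inverse d" d] phi_1 by simp
    then have "t = \<phi> (inverse d)" using b(2) d by (metis mult_right_cancel)
    then show ?thesis using b(1) phi_mult by metis
  qed
  have "field_automorphism \<phi>"
    unfolding field_automorphism_def using phi_inj phi_surj phi_1 phi_add phi_mult
    by (auto simp: bij_def surj_def)
  moreover have "bij g"
  proof -
    have gz: "x = 0" if "g x = 0" for x using gp[of x] that pt_nonzero by blast
    have "inj g"
    proof (rule injI)
      fix x y assume "g x = g y"
      then have "g (x - y) = 0" using add[of "x - y" y] by simp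
      then show "x = y" using gz by fastforce
    qed
    moreover have "\<exists>x. y = g x" for y
    proof (cases "y = 0")
      case False
      obtain x where x: "x \<noteq> 0" "y \<in> span {H x}" using H_surj[OF False] by blast
      then have "pt x y" using False by (simp add: pt_def)
      then obtain a where "y = a *s g x" using pt_unique_scale[OF gp[OF x(1)]] by blast
      then show ?thesis using phi_surj sc by metis
    qed (metis g0)
    ultimately show ?thesis by (auto simp: bij_def surj_def)
  qed
  ultimately have "collineation g" unfolding collineation_def using add sc by blast
  then show ?thesis using that gp by (simp add: pt_def)
qed

end

section \<open>Maps preserving stars\<close>

context finite_dimensional_vector_space
begin

text \<open>For \<open>k = 1\<close> any three points form a star triple, so the last condition, which then says that
  collinearity is preserved, is not redundant.\<close>

definition star_map :: "nat \<Rightarrow> ('b set \<Rightarrow> 'b set) \<Rightarrow> ('b set \<Rightarrow> 'b set) \<Rightarrow> bool" where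
  "star_map k f f' \<longleftrightarrow> (\<forall>U\<in>grassmannian k. f U \<in> grassmannian k \<and> f' (f U) = U) \<and>
     (\<forall>U V W. star_triple k U V W \<longrightarrow> star_triple k (f U) (f V) (f W)) \<and>
     (\<forall>U V W. star_triple k U V W \<and> top_triple k U V W \<longrightarrow> top_triple k (f U) (f V) (f W))"

definition star_iso :: "nat \<Rightarrow> ('b set \<Rightarrow> 'b set) \<Rightarrow> ('b set \<Rightarrow> 'b set) \<Rightarrow> bool" where
  "star_iso k f f' \<longleftrightarrow> star_map k f f' \<and> star_map k f' f"

lemma star_iso_sym: "star_iso k f f' \<Longrightarrow> star_iso k f' f"
  by (simp add: star_iso_def)

lemma star_mapD:
  assumes "star_map k f f'"
  shows "U \<in> grassmannian k \<Longrightarrow> f U \<in> grassmannian k" "U \<in> grassmannian k \<Longrightarrow> f' (f U) = U"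
    and "star_triple k U V W \<Longrightarrow> star_triple k (f U) (f V) (f W)"
    and "star_triple k U V W \<Longrightarrow> top_triple k U V W \<Longrightarrow> top_triple k (f U) (f V) (f W)"
  using assms unfolding star_map_def by blast+

section \<open>Descent from (k+1)-planes to k-planes\<close>

lemma ex_intermediate:
  assumes "subspace P" "subspace W" "P \<subseteq> W" "dim P \<le> m" "m \<le> dim W"
  shows "\<exists>U\<in>grassmannian m. P \<subseteq> U \<and> U \<subseteq> W"
  using assms(4,5)
proof (induction m rule: dec_induct)
  case base
  then show ?case using assms by (auto simp: grassmannian_def)
next
  case (step m)
  then obtain U where U: "U \<in> grassmannian m" "P \<subseteq> U" "U \<subseteq> W" by auto
  have "subspace U" "dim U < dim W" using U step by (auto simp: grassmannian_def)
  then obtain U' where "U' \<in> grassmannian (Suc (dim U))" "U \<subseteq> U'" "U' \<subseteq> W"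
    using U assms(2) by (metis subspace_step)
  then show ?case using U grassmannianD(2)[OF U(1)] by auto
qed

lemma ex_above:
  assumes "P \<in> grassmannian k" "k < dim (UNIV :: 'b set)"
  shows "\<exists>U\<in>grassmannian (Suc k). P \<subseteq> U"
  using ex_intermediate[of P UNIV "Suc k"] assms by (auto simp: grassmannian_def)

lemma other_above:
  assumes "P \<in> grassmannian k" "U \<in> grassmannian (Suc k)" "P \<subseteq> U" "Suc k < dim (UNIV :: 'b set)"
  shows "\<exists>V\<in>grassmannian (Suc k). V \<noteq> U \<and> P \<subseteq> V"
proof -
  have "U \<noteq> UNIV" using assms by (auto simp: grassmannian_def)
  then obtain x where x: "x \<notin> U" by blast
  then have "x \<notin> span P" using assms(3) grassmannianD(3)[OF assms(1)] by blast
  then have V: "span (insert x P) \<in> grassmannian (Suc k)"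
    using assms by (auto simp: grassmannian_def dim_insert)
  have "insert x P \<subseteq> span (insert x P)" by (rule span_superset)
  then show ?thesis using V x by blast
qed

text \<open>The plane \<open>P\<close> is known from the star of planes above it, and its image is
  read off from the images of these. By \<open>down_eq\<close> any two distinct planes of the star
  already give this intersection.\<close>

definition down :: "nat \<Rightarrow> ('b set \<Rightarrow> 'b set) \<Rightarrow> 'b set \<Rightarrow> 'b set" where
  "down k f P = \<Inter> (f ` {U \<in> grassmannian (Suc k). P \<subseteq> U})"

lemma down_eq:
  assumes "star_map (Suc k) f f'" "P \<in> grassmannian k"
    and "U \<in> grassmannian (Suc k)" "V \<in> grassmannian (Suc k)" "U \<noteq> V" "P \<subseteq> U" "P \<subseteq> V"
  shows "down k f P = f U \<inter> f V" "down k f P \<in> grassmannian k"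
proof -
  note s = star_mapD[OF assms(1)]
  have P: "subspace P" "Suc (dim P) = Suc k" using assms(2) by (auto simp: grassmannian_def)
  have "adjacent (Suc k) U V" using adjacentI_common[OF assms(3-7) P(2)] .
  \<comment> \<open>\<open>star_map\<close> controls triples only; adjacency of \<open>f U\<close>
    and \<open>f V\<close> is extracted from the image of a star triple containing \<open>U\<close>
    and \<open>V\<close>.\<close>
  then obtain W where "star_triple (Suc k) U V W" by (rule adjacent_pencil)
  then have a: "adjacent (Suc k) (f U) (f V)" using s by (auto simp: star_triple_def clique_triple_def)
  have "f U \<inter> f V \<subseteq> f W" if "W \<in> grassmannian (Suc k)" "P \<subseteq> W" for W
  proof (cases "W = U \<or> W = V")
    case False
    then have "star_triple (Suc k) U V W" using star_tripleI[of U _ V W P] assms P that by auto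
    then show ?thesis using s(3) by (simp add: star_triple_def)
  qed auto
  then show e: "down k f P = f U \<inter> f V" using assms unfolding down_def by blast
  show "down k f P \<in> grassmannian k" unfolding e using adjacent_grassmannian[OF a] by simp
qed

lemma down_incident:
  assumes "star_map (Suc k) f f'" "Suc k < dim (UNIV :: 'b set)"
    and "P \<in> grassmannian k" "U \<in> grassmannian (Suc k)" "P \<subseteq> U"
  shows "down k f P \<subseteq> f U"
  using other_above[OF assms(3,4,5,2)] down_eq(1)[OF assms(1,3,4)] assms(5) by blast

lemma down_grassmannian:
  assumes "star_map (Suc k) f f'" "Suc k < dim (UNIV :: 'b set)" "P \<in> grassmannian k"
  shows "down k f P \<in> grassmannian k"
proof -
  obtain U where U: "U \<in> grassmannian (Suc k)" "P \<subseteq> U"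
    using ex_above[OF assms(3)] assms(2) by auto
  then show ?thesis using other_above[OF assms(3) U assms(2)] down_eq(2)[OF assms(1,3)] by blast
qed

lemma down_inverse:
  assumes "star_iso (Suc k) f f'" "Suc k < dim (UNIV :: 'b set)" "P \<in> grassmannian k"
  shows "down k f' (down k f P) = P"
proof -
  have s: "star_map (Suc k) f f'" "star_map (Suc k) f' f" using assms by (auto simp: star_iso_def)
  obtain U where U: "U \<in> grassmannian (Suc k)" "P \<subseteq> U"
    using ex_above[OF assms(3)] assms(2) by auto
  obtain V where V: "V \<in> grassmannian (Suc k)" "V \<noteq> U" "P \<subseteq> V"
    using other_above[OF assms(3) U assms(2)] by blast
  have d: "down k f P = f U \<inter> f V" "down k f P \<in> grassmannian k"
    using down_eq[OF s(1) assms(3)] U V by blast+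
  have ne: "f U \<noteq> f V" using star_mapD(2)[OF s(1)] U V by metis
  have "down k f' (down k f P) = f' (f U) \<inter> f' (f V)"
    using down_eq(1)[OF s(2) d(2) _ _ ne] d(1) star_mapD(1)[OF s(1)] U V by blast
  also have "\<dots> = U \<inter> V" using star_mapD(2)[OF s(1)] U V by simp
  also have "\<dots> = P"
  proof (rule adjacent_Int_eq)
    show "adjacent (Suc k) U V"
      using U V assms(3) by (intro adjacentI_common[of U _ V P]) (auto simp: grassmannian_def)
  qed (use U V assms(3) in \<open>auto simp: grassmannian_def\<close>)
  finally show ?thesis .
qed

text \<open>Incidence with planes one dimension higher is preserved, so tops go to tops, for
  \<open>down k f\<close> and for its inverse. Hence a star triple that is not a top cannot acquire
  a top as image, since the inverse would carry it back; its image, still a clique, is a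
  star.\<close>

lemma down_star_map:
  assumes iso: "star_iso (Suc k) f f'" and k: "Suc k < dim (UNIV :: 'b set)"
  shows "star_map k (down k f) (down k f')"
proof -
  have s: "star_map (Suc k) f f'" "star_map (Suc k) f' f" using iso by (auto simp: star_iso_def)
  note G = down_grassmannian[OF s(1) k] down_grassmannian[OF s(2) k]
  note inv = down_inverse[OF iso k] down_inverse[OF star_iso_sym[OF iso] k]
  have top_map: "top_triple k (down k g P) (down k g Q) (down k g R)"
    if g: "star_iso (Suc k) g g'" and t: "top_triple k P Q R" for g g' P Q R
  proof -
    have sg: "star_map (Suc k) g g'" using g by (simp add: star_iso_def)
    obtain X where X: "X \<in> grassmannian (Suc k)" "P \<subseteq> X" "Q \<subseteq> X" "R \<subseteq> X" using t by (rule top_tripleE)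
    have d: "P \<in> grassmannian k" "Q \<in> grassmannian k" "R \<in> grassmannian k" "P \<noteq> Q" "P \<noteq> R" "Q \<noteq> R"
      using t by (auto simp: top_triple_def clique_triple_def adjacent_def)
    note i = down_inverse[OF g k]
    show ?thesis
      by (rule top_tripleI[of _ _ _ _ "g X"])
        (use d i X star_mapD(1)[OF sg X(1)] down_grassmannian[OF sg k] down_incident[OF sg k _ X(1)] in \<open>metis+\<close>)
  qed
  have adj: "adjacent k (down k f P) (down k f Q)" if "adjacent k P Q" for P Q
  proof -
    note a = adjacent_grassmannian[OF that]
    let ?X = "span (P \<union> Q)"
    have X: "P \<subseteq> ?X" "Q \<subseteq> ?X" using span_superset[of "P \<union> Q"] by auto
    have "down k f P \<noteq> down k f Q" using a inv(1) by metis
    then show ?thesis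
      using adjacentI_join[OF G(1)[OF a(1)] G(1)[OF a(2)]] down_incident[OF s(1) k a(1,5) X(1)]
        down_incident[OF s(1) k a(2,5) X(2)] star_mapD(1)[OF s(1) a(5)] by blast
  qed
  have clique: "clique_triple k (down k f P) (down k f Q) (down k f R)" if "clique_triple k P Q R" for P Q R
    using that adj by (simp add: clique_triple_def)
  have strict: "star_triple k (down k f P) (down k f Q) (down k f R)"
    if st: "star_triple k P Q R" and nt: "\<not> top_triple k P Q R" for P Q R
  proof (rule ccontr)
    assume n: "\<not> star_triple k (down k f P) (down k f Q) (down k f R)"
    have c: "clique_triple k P Q R" using st by (simp add: star_triple_def)
    have "top_triple k (down k f P) (down k f Q) (down k f R)"
      using clique_triple_cases[OF clique[OF c]] n by blast
    then have "top_triple k (down k f' (down k f P)) (down k f' (down k f Q)) (down k f' (down k f R))"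
      by (rule top_map[OF star_iso_sym[OF iso]])
    moreover have "P \<in> grassmannian k" "Q \<in> grassmannian k" "R \<in> grassmannian k"
      using c by (auto simp: clique_triple_def adjacent_def)
    ultimately show False using inv(1) nt by simp
  qed
  have star: "star_triple k (down k f P) (down k f Q) (down k f R)" if st: "star_triple k P Q R" for P Q R
  proof (cases "top_triple k P Q R")
    case True
    obtain N where N: "Suc (dim N) = k" "P \<inter> Q = N" "P \<inter> R = N" "Q \<inter> R = N" "N \<in> grassmannian (k - 1)"
      using st by (rule star_tripleE)
    obtain X where X: "X \<in> grassmannian (Suc k)" "P \<subseteq> X" "Q \<subseteq> X" "R \<subseteq> X" "span (P \<union> Q) = X" "span (P \<union> R) = X"
      using True by (rule top_tripleE)
    have d: "P \<in> grassmannian k" "Q \<in> grassmannian k" "R \<in> grassmannian k" "P \<noteq> Q" "P \<noteq> R" "Q \<noteq> R"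
      using True by (auto simp: top_triple_def clique_triple_def adjacent_def)
    have "X \<noteq> UNIV" using X(1) k by (auto simp: grassmannian_def)
    then obtain x where x: "x \<notin> X" by blast
    \<comment> \<open>A triple that is both star and top is compared with a member of the star over
      \<open>N\<close> outside \<open>X\<close>. Replacing \<open>R\<close> or \<open>Q\<close> by
      \<open>?Z\<close> gives strict stars, whose images show that \<open>down k f P\<close> has the
      same intersection with the images of \<open>Q\<close> and \<open>R\<close>.\<close>
    let ?Z = "span (insert x N)"
    have sN: "subspace N" using N(5) by (rule grassmannianD)
    have "span N = N" using grassmannianD(3)[OF N(5)] .
    then have "x \<notin> span N" using x X N(2) by blast
    then have Z: "?Z \<in> grassmannian k" using N(1) by (auto intro!: grassmannianI simp: dim_insert)
    have NZ: "insert x N \<subseteq> ?Z" by (rule span_superset)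
    have "star_triple k P Q ?Z" "star_triple k P R ?Z"
      using d Z N NZ X x sN by (auto intro!: star_tripleI[where P=N])
    moreover have "\<not> top_triple k P Q ?Z" "\<not> top_triple k P R ?Z"
      using NZ x X by (auto simp: top_triple_def)
    ultimately have "star_triple k (down k f P) (down k f Q) (down k f ?Z)"
      "star_triple k (down k f P) (down k f R) (down k f ?Z)"
      using strict by blast+
    then have "down k f P \<inter> down k f Q = down k f P \<inter> down k f R" by (metis star_tripleE)
    moreover have "clique_triple k (down k f P) (down k f Q) (down k f R)"
      using clique st by (simp add: star_triple_def)
    ultimately show ?thesis by (auto simp: star_triple_def)
  qed (rule strict[OF st])
  show ?thesis
    unfolding star_map_def
  proof (intro conjI ballI allI impI)
    fix P Q R
    show "P \<in> grassmannian k \<Longrightarrow> down k f P \<in> grassmannian k" by (rule G(1))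
    show "P \<in> grassmannian k \<Longrightarrow> down k f' (down k f P) = P" by (rule inv(1))
    show "star_triple k P Q R \<Longrightarrow> star_triple k (down k f P) (down k f Q) (down k f R)" by (rule star)
    show "star_triple k P Q R \<and> top_triple k P Q R \<Longrightarrow> top_triple k (down k f P) (down k f Q) (down k f R)"
      using top_map[OF iso] by blast
  qed
qed

lemma down_star_iso:
  assumes "star_iso (Suc k) f f'" "Suc k < dim (UNIV :: 'b set)"
  shows "star_iso k (down k f) (down k f')"
  using down_star_map[OF assms] down_star_map[OF star_iso_sym[OF assms(1)] assms(2)]
  by (simp add: star_iso_def)

text \<open>The descent is iterated down to points. Incidence of a point with a plane passes through
  a plane of one dimension less between them; for the converse such a plane is taken on the image
  side and pulled back by \<open>down k f'\<close>.\<close>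

lemma star_iso_point_map:
  assumes "star_iso k f f'" "1 \<le> k" "k < dim (UNIV :: 'b set)"
  shows "\<exists>h h'. star_iso 1 h h' \<and>
    (\<forall>p\<in>grassmannian 1. \<forall>U\<in>grassmannian k. p \<subseteq> U \<longleftrightarrow> h p \<subseteq> f U)"
  using assms(2,1,3)
proof (induction k arbitrary: f f' rule: dec_induct)
  case base
  have "p \<subseteq> U \<longleftrightarrow> f p \<subseteq> f U" if "p \<in> grassmannian 1" "U \<in> grassmannian 1" for p U
    using that base grassmannian_eqI[of _ 1] unfolding star_iso_def by (metis order_refl star_mapD(1,2))
  then show ?case using base by blast
next
  case (step k)
  note s = step.prems(1)[unfolded star_iso_def]
  note k = step.prems(2)
  note d = down_star_iso[OF step.prems]
  obtain h h' where h: "star_iso 1 h h'"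
    "\<forall>p\<in>grassmannian 1. \<forall>U\<in>grassmannian k. p \<subseteq> U \<longleftrightarrow> h p \<subseteq> down k f U"
    using step.IH[OF d Suc_lessD[OF k]] by blast
  have mid: "\<exists>P\<in>grassmannian k. p \<subseteq> P \<and> P \<subseteq> U" if "p \<in> grassmannian 1" "U \<in> grassmannian (Suc k)" "p \<subseteq> U" for p U
    using ex_intermediate[of p U k] that step.hyps by (auto simp: grassmannian_def)
  have "p \<subseteq> U \<longleftrightarrow> h p \<subseteq> f U" if p: "p \<in> grassmannian 1" and U: "U \<in> grassmannian (Suc k)" for p U
  proof
    assume "p \<subseteq> U"
    then obtain P where P: "P \<in> grassmannian k" "p \<subseteq> P" "P \<subseteq> U" using mid p U by blast
    then have "h p \<subseteq> down k f P" using h p by blast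
    also have "\<dots> \<subseteq> f U" using down_incident s k P U by blast
    finally show "h p \<subseteq> f U" .
  next
    assume "h p \<subseteq> f U"
    moreover have "h p \<in> grassmannian 1" "f U \<in> grassmannian (Suc k)"
      using h(1) s p U star_mapD(1) by (auto simp: star_iso_def)
    ultimately obtain P where P: "P \<in> grassmannian k" "h p \<subseteq> P" "P \<subseteq> f U" using mid by blast
    let ?P = "down k f' P"
    have "?P \<subseteq> f' (f U)" using down_incident s k P \<open>f U \<in> _\<close> by blast
    then have "?P \<subseteq> U" using star_mapD(2) s U by metis
    moreover have "down k f ?P = P" using down_inverse[OF star_iso_sym[OF step.prems(1)] k P(1)] .
    moreover have "?P \<in> grassmannian k" using down_grassmannian s k P by blast
    ultimately show "p \<subseteq> U" using h(2) p P(2) by (metis subset_trans)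
  qed
  then show ?case using h(1) by blast
qed

section \<open>From the map on points to the collineation\<close>

lemma span_single_grassmannian: "x \<noteq> 0 \<Longrightarrow> span {x} \<in> grassmannian 1"
  by (simp add: grassmannian_def)

lemma grassmannian_1E:
  assumes "p \<in> grassmannian 1"
  obtains x where "x \<noteq> 0" "p = span {x}"
proof -
  have p: "subspace p" "dim p = 1" using assms by (auto simp: grassmannian_def)
  then obtain x where x: "x \<in> p" "x \<noteq> 0" by (metis dim_eq_0 insert_iff subsetI zero_neq_one)
  have "span {x} = p"
    using x p by (intro subspace_dim_equal span_minimal) auto
  then show ?thesis using that x by blast
qed

text \<open>Three distinct points always form a star over \<open>{0}\<close>; if collinear they form
  a top as well, and the last clause of \<open>star_map\<close> applies.\<close>

lemma star_map_collinear:
  assumes h: "star_map 1 h h'" and p: "p \<in> grassmannian 1" "q \<in> grassmannian 1" "r \<in> grassmannian 1"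
    and r: "r \<subseteq> span (p \<union> q)"
  shows "h r \<subseteq> span (h p \<union> h q)"
proof -
  consider "r = p \<or> r = q" | "p = q" "r \<noteq> p" | "p \<noteq> q" "r \<noteq> p" "r \<noteq> q" by blast
  then show ?thesis
  proof cases
    case 1
    then show ?thesis using span_superset[of "h p \<union> h q"] by auto
  next
    case 2
    then have "r \<subseteq> p" using r grassmannianD(3)[OF p(1)] by (metis Un_absorb)
    then show ?thesis using 2 grassmannian_eqI[OF p(3,1)] by simp
  next
    case 3
    have "{0} \<subseteq> p" "{0} \<subseteq> q" "{0} \<subseteq> r" using p subspace_0 by (auto simp: grassmannian_def)
    then have "star_triple 1 p q r" using p 3 by (intro star_tripleI[where P="{0}"]) auto
    moreover from this have "top_triple 1 p q r" using r by (simp add: star_triple_def top_triple_def)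
    ultimately have "top_triple 1 (h p) (h q) (h r)" using star_mapD(4)[OF h] by blast
    then show ?thesis by (simp add: top_triple_def)
  qed
qed

lemma star_iso_induced:
  assumes iso: "star_iso k f f'" and k: "1 \<le> k" "k < dim (UNIV :: 'b set)" and n: "3 \<le> dim (UNIV :: 'b set)"
  shows "induced_by_collineation k f"
proof -
  obtain h h' where h: "star_iso 1 h h'"
    and inc: "\<forall>p\<in>grassmannian 1. \<forall>U\<in>grassmannian k. p \<subseteq> U \<longleftrightarrow> h p \<subseteq> f U"
    using star_iso_point_map[OF iso k] by blast
  have s: "star_map 1 h h'" "star_map 1 h' h" using h by (auto simp: star_iso_def)
  define H where "H x = (SOME v. v \<noteq> 0 \<and> h (span {x}) = span {v})" for x
  have H: "H x \<noteq> 0" "h (span {x}) = span {H x}" if "x \<noteq> 0" for x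
  proof -
    have "\<exists>v. v \<noteq> 0 \<and> h (span {x}) = span {v}"
      using star_mapD(1)[OF s(1) span_single_grassmannian[OF that]] by (metis grassmannian_1E)
    from someI_ex[OF this] show "H x \<noteq> 0" "h (span {x}) = span {H x}" by (simp_all add: H_def)
  qed
  have join: "span (span {y} \<union> span {z}) = span {y, z}" for y z
  proof -
    have "span {y} \<union> span {z} \<subseteq> span {y, z}"
      using span_mono[of "{y}" "{y, z}"] span_mono[of "{z}" "{y, z}"] by auto
    moreover have "{y, z} \<subseteq> span {y} \<union> span {z}" by (simp add: span_base)
    ultimately show ?thesis by (metis span_eq span_superset subset_trans)
  qed
  have col: "x \<in> span {y, z} \<longleftrightarrow> span {x} \<subseteq> span (span {y} \<union> span {z})" for x y z
    unfolding join by (metis empty_subsetI insert_subset span_base singletonI span_minimal subspace_span subsetD)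
  interpret pc: point_collineation scale Basis H
  proof unfold_locales
    fix x y z :: 'b assume nz: "x \<noteq> 0" "y \<noteq> 0" "z \<noteq> 0"
    note g = span_single_grassmannian[OF nz(1)] span_single_grassmannian[OF nz(2)] span_single_grassmannian[OF nz(3)]
    show "x \<in> span {y, z} \<longleftrightarrow> H x \<in> span {H y, H z}"
    proof
      assume "x \<in> span {y, z}"
      then show "H x \<in> span {H y, H z}"
        using star_map_collinear[OF s(1) g(2,3,1)] by (simp add: col H nz)
    next
      assume "H x \<in> span {H y, H z}"
      then have "h (span {x}) \<subseteq> span (h (span {y}) \<union> h (span {z}))" by (simp add: col H nz)
      then have "h' (h (span {x})) \<subseteq> span (h' (h (span {y})) \<union> h' (h (span {z})))"
        using star_map_collinear[OF s(2)] g star_mapD(1)[OF s(1)] by blast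
      then show "x \<in> span {y, z}" using star_mapD(2)[OF s(1)] g by (simp add: col)
    qed
  next
    fix y :: 'b assume "y \<noteq> 0"
    then have y: "span {y} \<in> grassmannian 1" by (rule span_single_grassmannian)
    then obtain x where x: "x \<noteq> 0" "h' (span {y}) = span {x}"
      using star_mapD(1)[OF s(2)] by (metis grassmannian_1E)
    then have "span {y} = span {H x}" using H(2)[OF x(1)] star_mapD(2)[OF s(2) y] by simp
    then have "y \<in> span {H x}" using span_base[of y "{y}"] by simp
    then show "\<exists>x. x \<noteq> 0 \<and> y \<in> span {H x}" using x by blast
  qed (use H n in auto)
  obtain g where g: "collineation g" "\<And>x. x \<noteq> 0 \<Longrightarrow> g x \<noteq> 0 \<and> g x \<in> span {H x}"
    using pc.ex_collineation by blast
  have gh: "h (span {x}) = span {g x}" if "x \<noteq> 0" for x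
  proof -
    have "span {g x} \<subseteq> span {H x}" using g(2)[OF that] by (simp add: span_minimal)
    then show ?thesis
      using grassmannian_eqI[of "span {g x}" 1 "span {H x}"] H[OF that] g(2)[OF that] span_single_grassmannian by auto
  qed
  have g0: "g 0 = 0" using g(1) unfolding collineation_def by (metis add_cancel_right_left)
  \<comment> \<open>\<open>g\<close> induces \<open>h\<close> on points, and \<open>inc\<close>
    recovers every k-plane from its points. The zero vector spans no point and is treated
    apart.\<close>
  have mem: "x \<in> U \<longleftrightarrow> g x \<in> f U" if U: "U \<in> grassmannian k" for x U
  proof -
    have sub: "subspace U" "subspace (f U)"
      using U star_mapD(1)[of k f f'] iso by (auto simp: star_iso_def grassmannian_def)
    have single: "span {v} \<subseteq> X \<longleftrightarrow> v \<in> X" if "subspace X" for v X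
      using that span_base[of v "{v}"] span_minimal[of "{v}" X] by auto
    show ?thesis
    proof (cases "x = 0")
      case True
      then show ?thesis using g0 sub subspace_0 by auto
    next
      case False
      then show ?thesis
        using inc[rule_format, OF span_single_grassmannian[OF False] U] gh single[OF sub(1)] single[OF sub(2)] by simp
    qed
  qed
  have "surj g" using g(1) by (simp add: collineation_def bij_def)
  have "f U = g ` U" if "U \<in> grassmannian k" for U
  proof (rule set_eqI)
    fix y
    obtain x where "y = g x" using \<open>surj g\<close> by blast
    moreover have "inj g" using g(1) by (simp add: collineation_def bij_def)
    ultimately show "y \<in> f U \<longleftrightarrow> y \<in> g ` U" using mem[OF that, of x] by (auto dest: injD)
  qed
  then show ?thesis using g(1) unfolding induced_by_collineation_def by blast
qed

end

section \<open>Maximal R-sets\<close>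

context finite_dimensional_vector_space
begin

lemma basis_of_spaceD:
  assumes "basis_of_space B"
  shows "independent B" "span B = UNIV" "finite B" "card B = dim (UNIV :: 'b set)"
  using assms finiteI_independent dim_eq_card[of B UNIV] by (auto simp: basis_of_space_def)

lemma ex_basis_superset:
  assumes "independent S"
  obtains B where "basis_of_space B" "S \<subseteq> B"
proof -
  obtain B where "S \<subseteq> B" "independent B" "UNIV \<subseteq> span B"
    using assms by (rule maximal_independent_subset_extend[OF subset_UNIV])
  then show ?thesis using that[of B] by (auto simp: basis_of_space_def)
qed

lemma dim_span_subset:
  assumes "independent B" "S \<subseteq> B"
  shows "dim (span S) = card S"
  using dim_span_eq_card_independent independent_mono[OF assms] .

lemma mem_span_subset:
  assumes "independent B" "S \<subseteq> B" "b \<in> B"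
  shows "b \<in> span S \<longleftrightarrow> b \<in> S"
proof
  assume b: "b \<in> span S"
  show "b \<in> S"
  proof (rule ccontr)
    assume "b \<notin> S"
    then have "span S \<subseteq> span (B - {b})" using assms by (intro span_mono) blast
    then show False using assms b by (auto simp: dependent_def)
  qed
qed (rule span_base)

lemma span_subset_iff:
  assumes "independent B" "S \<subseteq> B" "T \<subseteq> B"
  shows "span S \<subseteq> span T \<longleftrightarrow> S \<subseteq> T"
  using mem_span_subset[OF assms(1,3)] assms(2) span_base span_mono by (meson subset_iff)

lemma span_inject:
  assumes "independent B" "S \<subseteq> B" "T \<subseteq> B"
  shows "span S = span T \<longleftrightarrow> S = T"
  using span_subset_iff[OF assms] span_subset_iff[OF assms(1,3,2)] by (metis order_refl subset_antisym)

text \<open>The right side is contained in the left; the dimensions agree because sums and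
  intersections of such spans obey the same counting formula as unions and intersections of the
  sets.\<close>

lemma span_Int:
  assumes "independent B" "S \<subseteq> B" "T \<subseteq> B"
  shows "span S \<inter> span T = span (S \<inter> T)"
proof (rule subspace_dim_equal[symmetric])
  have fin: "finite S" "finite T" using assms finiteI_independent finite_subset by blast+
  have "span (span S \<union> span T) = span (S \<union> T)"
    by (simp add: span_Un span_span)
  then have "dim (span (span S \<union> span T)) = card (S \<union> T)"
    using dim_span_subset[OF assms(1), of "S \<union> T"] assms by simp
  moreover have "dim (span (span S \<union> span T)) + dim (span S \<inter> span T) = dim (span S) + dim (span T)"
    by (rule dim_join) simp_all
  moreover have "card (S \<union> T) + card (S \<inter> T) = card S + card T"
    using card_Un_Int[OF fin] by simp
  moreover have "dim (span (S \<inter> T)) = card (S \<inter> T)"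
    using dim_span_subset[OF assms(1), of "S \<inter> T"] assms by blast
  ultimately show "dim (span S \<inter> span T) \<le> dim (span (S \<inter> T))"
    using dim_span_subset[OF assms(1,2)] dim_span_subset[OF assms(1,3)] by linarith
  show "span (S \<inter> T) \<subseteq> span S \<inter> span T" using span_mono[of "S \<inter> T"] by blast
qed (auto intro: subspace_inter)

lemma span_Inter:
  assumes "independent B" "finite \<T>" "\<T> \<noteq> {}" "\<Union>\<T> \<subseteq> B"
  shows "\<Inter> (span ` \<T>) = span (\<Inter>\<T>)"
  using assms(2-4)
proof (induction rule: finite_ne_induct)
  case (insert T \<T>)
  have "\<Inter> (span ` insert T \<T>) = span T \<inter> span (\<Inter>\<T>)" using insert by simp
  also have "\<dots> = span (T \<inter> \<Inter>\<T>)"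
  proof (rule span_Int[OF assms(1)])
    obtain X where "X \<in> \<T>" using insert.hyps by auto
    then show "\<Inter>\<T> \<subseteq> B" using insert.prems by auto
  qed (use insert.prems in auto)
  finally show ?case by simp
qed simp

text \<open>The apartments of the Grassmannian. By \<open>R_set_iff\<close> the R-sets are their
  subsets, and as all apartments have the same finite size, these are the maximal R-sets.\<close>

definition apt :: "nat \<Rightarrow> 'b set \<Rightarrow> 'b set set" where
  "apt k B = span ` {S. S \<subseteq> B \<and> card S = k}"

definition apts :: "nat \<Rightarrow> 'b set set set" where
  "apts k = apt k ` {B. basis_of_space B}"

lemma apt_grassmannian:
  assumes "basis_of_space B"
  shows "apt k B \<subseteq> grassmannian k"
  using dim_span_subset basis_of_spaceD[OF assms] by (auto simp: apt_def grassmannian_def simp del: dim_span)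

lemma apts_grassmannian: "A \<in> apts k \<Longrightarrow> A \<subseteq> grassmannian k"
  using apt_grassmannian by (auto simp: apts_def)

lemma apt_memE:
  assumes "U \<in> apt k B"
  obtains S where "S \<subseteq> B" "card S = k" "U = span S"
  using assms by (auto simp: apt_def)

lemma span_mem_apt:
  assumes "basis_of_space B" "S \<subseteq> B"
  shows "span S \<in> apt k B \<longleftrightarrow> card S = k"
  using span_inject[OF basis_of_spaceD(1)[OF assms(1)] assms(2)] assms(2) by (auto simp: apt_def)

lemma card_apt:
  assumes "basis_of_space B"
  shows "card (apt k B) = dim (UNIV :: 'b set) choose k" "finite (apt k B)"
proof -
  note b = basis_of_spaceD[OF assms]
  have "inj_on span {S. S \<subseteq> B \<and> card S = k}"
    using span_inject[OF b(1)] by (auto intro!: inj_onI)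
  then show "card (apt k B) = dim (UNIV :: 'b set) choose k"
    unfolding apt_def using n_subsets[OF b(3), of k] b(4) by (simp add: card_image)
  show "finite (apt k B)" unfolding apt_def using b(3) by simp
qed

lemma apts_card:
  assumes "A \<in> apts k"
  shows "card A = dim (UNIV :: 'b set) choose k" "finite A"
  using assms card_apt unfolding apts_def by auto

lemma R_set_iff: "R_set k R \<longleftrightarrow> (\<exists>A\<in>apts k. R \<subseteq> A)"
proof
  assume "R_set k R"
  then obtain B where B: "basis_of_space B" "R \<subseteq> grassmannian k"
    "\<forall>U\<in>R. \<exists>S. S \<subseteq> B \<and> finite S \<and> card S = k \<and> S \<subseteq> U"
    unfolding R_set_def by blast
  have "U \<in> apt k B" if UR: "U \<in> R" for U
  proof -
    obtain S where S: "S \<subseteq> B" "card S = k" "S \<subseteq> U" using B(3) UR by blast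
    have U: "U \<in> grassmannian k" using B(2) UR by blast
    have "span S \<in> grassmannian k"
      using dim_span_subset[OF basis_of_spaceD(1)[OF B(1)] S(1)] S by (simp add: grassmannian_def del: dim_span)
    moreover have "span S \<subseteq> U" using S U by (simp add: grassmannian_def span_minimal)
    ultimately have "span S = U" using grassmannian_eqI U by blast
    then show ?thesis using S by (auto simp: apt_def)
  qed
  then show "\<exists>A\<in>apts k. R \<subseteq> A" using B(1) by (auto simp: apts_def)
next
  assume "\<exists>A\<in>apts k. R \<subseteq> A"
  then obtain B where B: "basis_of_space B" "R \<subseteq> apt k B" by (auto simp: apts_def)
  have "\<exists>S. S \<subseteq> B \<and> finite S \<and> card S = k \<and> S \<subseteq> U" if U: "U \<in> R" for U
  proof -
    have "U \<in> apt k B" using B U by blast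
    then obtain S where "S \<subseteq> B" "card S = k" "U = span S" by (rule apt_memE)
    then show ?thesis using span_superset[of S] finite_subset basis_of_spaceD(3)[OF B(1)] by blast
  qed
  moreover have "R \<subseteq> grassmannian k" using subset_trans[OF B(2) apt_grassmannian[OF B(1)]] .
  ultimately show "R_set k R" unfolding R_set_def using B(1) by blast
qed

definition apt_iso :: "nat \<Rightarrow> ('b set \<Rightarrow> 'b set) \<Rightarrow> ('b set \<Rightarrow> 'b set) \<Rightarrow> bool" where
  "apt_iso k f f' \<longleftrightarrow>
     (\<forall>U\<in>grassmannian k. f U \<in> grassmannian k \<and> f' (f U) = U) \<and> (\<forall>A\<in>apts k. f ` A \<in> apts k) \<and>
     (\<forall>U\<in>grassmannian k. f' U \<in> grassmannian k \<and> f (f' U) = U) \<and> (\<forall>A\<in>apts k. f' ` A \<in> apts k)"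

lemma apt_iso_sym: "apt_iso k f f' \<Longrightarrow> apt_iso k f' f"
  by (simp add: apt_iso_def)

lemma apt_isoD:
  assumes "apt_iso k f f'"
  shows "U \<in> grassmannian k \<Longrightarrow> f U \<in> grassmannian k" "U \<in> grassmannian k \<Longrightarrow> f' (f U) = U"
    and "A \<in> apts k \<Longrightarrow> f ` A \<in> apts k"
  using assms unfolding apt_iso_def by simp_all

lemma apt_iso_image_inv:
  assumes "apt_iso k f f'" "R \<subseteq> grassmannian k"
  shows "f' ` f ` R = R"
proof -
  have "f' (f U) = U" if "U \<in> R" for U using that assms(2) apt_isoD(2)[OF assms(1)] by blast
  then show ?thesis by (simp add: image_image)
qed

lemma R_set_image:
  assumes "apt_iso k f f'" "R_set k R"
  shows "R_set k (f ` R)"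
proof -
  obtain A where A: "A \<in> apts k" "R \<subseteq> A" using assms(2) R_set_iff by blast
  have "f ` A \<in> apts k" "f ` R \<subseteq> f ` A" using apt_isoD(3)[OF assms(1) A(1)] A(2) by auto
  then show ?thesis using R_set_iff by blast
qed

text \<open>An apartment is sent injectively into some apartment; both have
  \<open>n choose k\<close> elements, so the image is all of it.\<close>

lemma regular_apt_iso:
  assumes "regular_transformation k f"
  shows "apt_iso k f (the_inv_into (grassmannian k) f)"
proof -
  let ?g = "the_inv_into (grassmannian k) f"
  have b: "bij_betw f (grassmannian k) (grassmannian k)"
    and r: "\<And>R. R_set k R \<Longrightarrow> R_set k (f ` R)" "\<And>R. R_set k R \<Longrightarrow> R_set k (?g ` R)"
    using assms by (auto simp: regular_transformation_def)
  have b': "bij_betw ?g (grassmannian k) (grassmannian k)" using b by (rule bij_betw_the_inv_into)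
  have A: "h ` A \<in> apts k"
    if h: "bij_betw h (grassmannian k) (grassmannian k)" "\<And>R. R_set k R \<Longrightarrow> R_set k (h ` R)" and A: "A \<in> apts k" for h A
  proof -
    obtain A' where A': "A' \<in> apts k" "h ` A \<subseteq> A'" using h(2)[of A] A R_set_iff by blast
    have "inj_on h A" using h(1) apts_grassmannian[OF A] by (meson bij_betw_def inj_on_subset)
    then have "card (h ` A) = card A'" using apts_card(1)[OF A] apts_card(1)[OF A'(1)] by (simp add: card_image)
    then have "h ` A = A'" using A' apts_card(2)[OF A'(1)] by (metis card_subset_eq)
    then show ?thesis using A' by simp
  qed
  show ?thesis
    unfolding apt_iso_def
    using A[OF b r(1)] A[OF b' r(2)] b b'
    by (auto simp: bij_betwE the_inv_into_f_f f_the_inv_into_f bij_betw_def)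
qed

section \<open>A counting invariant\<close>

definition inexact :: "nat \<Rightarrow> 'b set set \<Rightarrow> 'b set set \<Rightarrow> bool" where
  "inexact k A R \<longleftrightarrow> R \<subseteq> A \<and> (\<exists>A'\<in>apts k. A' \<noteq> A \<and> R \<subseteq> A')"

definition max_inexact :: "nat \<Rightarrow> 'b set set \<Rightarrow> 'b set set set" where
  "max_inexact k A = {R. inexact k A R \<and> (\<forall>R'. inexact k A R' \<and> R \<subseteq> R' \<longrightarrow> R' = R)}"

definition missing :: "nat \<Rightarrow> 'b set set \<Rightarrow> 'b set set \<Rightarrow> nat" where
  "missing k A X = card {R \<in> max_inexact k A. R \<inter> X = {}}"

lemma inexact_image:
  assumes f: "apt_iso k f f'" and A: "A \<in> apts k" and R: "inexact k A R"
  shows "inexact k (f ` A) (f ` R)"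
proof -
  obtain A' where A': "A' \<in> apts k" "A' \<noteq> A" "R \<subseteq> A'" "R \<subseteq> A" using R by (auto simp: inexact_def)
  have "f ` A' \<noteq> f ` A"
    using A' apt_iso_image_inv[OF f] apts_grassmannian[OF A] apts_grassmannian[OF A'(1)] by metis
  moreover have "f ` A' \<in> apts k" using apt_isoD(3)[OF f] A' by blast
  moreover have "f ` R \<subseteq> f ` A" "f ` R \<subseteq> f ` A'" using A' by auto
  ultimately show ?thesis unfolding inexact_def by blast
qed

lemma max_inexact_image:
  assumes f: "apt_iso k f f'" and A: "A \<in> apts k" and R: "R \<in> max_inexact k A"
  shows "f ` R \<in> max_inexact k (f ` A)"
proof -
  have R': "inexact k A R" "\<And>R'. inexact k A R' \<Longrightarrow> R \<subseteq> R' \<Longrightarrow> R' = R"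
    using R by (auto simp: max_inexact_def)
  have RG: "R \<subseteq> grassmannian k" using R'(1) apts_grassmannian[OF A] by (auto simp: inexact_def)
  note inv = apt_iso_image_inv[OF f]
  note inv' = apt_iso_image_inv[OF apt_iso_sym[OF f]]
  have fA: "f ` A \<in> apts k" using apt_isoD(3)[OF f A] .
  have "T = f ` R" if T: "inexact k (f ` A) T" "f ` R \<subseteq> T" for T
  proof -
    have TG: "T \<subseteq> grassmannian k" using T(1) apts_grassmannian[OF fA] unfolding inexact_def by blast
    have "inexact k (f' ` f ` A) (f' ` T)" by (rule inexact_image[OF apt_iso_sym[OF f] fA T(1)])
    then have "inexact k A (f' ` T)" using inv[OF apts_grassmannian[OF A]] by simp
    moreover have "R \<subseteq> f' ` T" using image_mono[OF T(2), of f'] inv[OF RG] by simp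
    ultimately have "f' ` T = R" using R'(2) by blast
    then show ?thesis using inv'[OF TG] by simp
  qed
  then show ?thesis using inexact_image[OF f A R'(1)] by (simp add: max_inexact_def)
qed

lemma missing_image:
  assumes f: "apt_iso k f f'" and A: "A \<in> apts k" and X: "X \<subseteq> A"
  shows "missing k (f ` A) (f ` X) = missing k A X"
proof -
  note AG = apts_grassmannian[OF A]
  have fA: "f ` A \<in> apts k" using apt_isoD(3)[OF f A] .
  note inv = apt_iso_image_inv[OF f]
  note inv' = apt_iso_image_inv[OF apt_iso_sym[OF f]]
  have RA: "R \<subseteq> D" if "R \<in> max_inexact k D" for R D using that by (simp add: max_inexact_def inexact_def)
  have injf: "inj_on f A" using AG apt_isoD(2)[OF f] by (metis inj_on_inverseI subsetD)
  have "bij_betw (image f) {R \<in> max_inexact k A. R \<inter> X = {}} {R \<in> max_inexact k (f ` A). R \<inter> f ` X = {}}"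
  proof (rule bij_betw_byWitness[where f' = "image f'"])
    show "(`) f ` {R \<in> max_inexact k A. R \<inter> X = {}} \<subseteq> {R \<in> max_inexact k (f ` A). R \<inter> f ` X = {}}"
    proof (rule image_subsetI)
      fix R assume "R \<in> {R \<in> max_inexact k A. R \<inter> X = {}}"
      then have R: "R \<in> max_inexact k A" "R \<inter> X = {}" by auto
      have "f ` R \<inter> f ` X = {}" using inj_on_image_Int[OF injf RA[OF R(1)] X] R by simp
      then show "f ` R \<in> {R \<in> max_inexact k (f ` A). R \<inter> f ` X = {}}"
        using max_inexact_image[OF f A R(1)] by simp
    qed
    show "(`) f' ` {R \<in> max_inexact k (f ` A). R \<inter> f ` X = {}} \<subseteq> {R \<in> max_inexact k A. R \<inter> X = {}}"
    proof (rule image_subsetI)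
      fix R assume "R \<in> {R \<in> max_inexact k (f ` A). R \<inter> f ` X = {}}"
      then have R: "R \<in> max_inexact k (f ` A)" "R \<inter> f ` X = {}" by auto
      have "f' ` R \<in> max_inexact k A"
        using max_inexact_image[OF apt_iso_sym[OF f] fA R(1)] inv[OF AG] by simp
      moreover have "f' ` R \<inter> X = {}"
      proof -
        have "R \<subseteq> grassmannian k" using RA[OF R(1)] apts_grassmannian[OF fA] by blast
        then have "f ` f' ` R = R" by (rule inv')
        then show ?thesis using R(2) by blast
      qed
      ultimately show "f' ` R \<in> {R \<in> max_inexact k A. R \<inter> X = {}}" by simp
    qed
    show "\<forall>R\<in>{R \<in> max_inexact k A. R \<inter> X = {}}. f' ` f ` R = R"
      using inv subset_trans[OF RA AG] by blast
    show "\<forall>R\<in>{R \<in> max_inexact k (f ` A). R \<inter> f ` X = {}}. f ` f' ` R = R"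
    proof
      fix R assume "R \<in> {R \<in> max_inexact k (f ` A). R \<inter> f ` X = {}}"
      then have "R \<subseteq> f ` A" using RA by simp
      then show "f ` f' ` R = R" using apts_grassmannian[OF fA] by (intro inv') blast
    qed
  qed
  from bij_betw_same_card[OF this] show ?thesis by (simp add: missing_def)
qed

end

section \<open>Maximal inexact subsets\<close>

context finite_dimensional_vector_space
begin

definition apt_impl :: "nat \<Rightarrow> 'b set \<Rightarrow> 'b \<Rightarrow> 'b \<Rightarrow> 'b set set" where
  "apt_impl k B i j = span ` {S. S \<subseteq> B \<and> card S = k \<and> (i \<in> S \<longrightarrow> j \<in> S)}"

lemma span_mem_apt_impl:
  assumes "basis_of_space B" "S \<subseteq> B" "card S = k"
  shows "span S \<in> apt_impl k B i j \<longleftrightarrow> (i \<in> S \<longrightarrow> j \<in> S)"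
  using span_inject[OF basis_of_spaceD(1)[OF assms(1)] assms(2)] assms by (auto simp: apt_impl_def)

lemma ex_subset_between:
  assumes "finite B" "P \<subseteq> B - Q" "Q \<subseteq> B" "card P \<le> k" "k + card Q \<le> card B"
  shows "\<exists>S. P \<subseteq> S \<and> S \<subseteq> B \<and> S \<inter> Q = {} \<and> card S = k"
proof -
  have "card (B - Q) = card B - card Q" using assms by (simp add: card_Diff_subset finite_subset)
  then have "k \<le> card (B - Q)" using assms by linarith
  then have "\<exists>S. P \<subseteq> S \<and> S \<subseteq> B - Q \<and> card S = k"
    using exists_subset_between[of P k "B - Q"] assms by blast
  then show ?thesis by blast
qed

text \<open>The second apartment belongs to the basis \<open>C\<close> with \<open>i + j\<close> in
  place of \<open>i\<close>: when \<open>S\<close> contains both \<open>i\<close> and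
  \<open>j\<close>, the exchange does not change its span, and when it does not contain
  \<open>i\<close>, it is a subset of both bases.\<close>

lemma apt_impl_inexact:
  assumes B: "basis_of_space B" and ij: "i \<in> B" "j \<in> B" "i \<noteq> j"
    and k: "1 \<le> k" "k < dim (UNIV :: 'b set)"
  shows "inexact k (apt k B) (apt_impl k B i j)"
proof -
  note b = basis_of_spaceD[OF B]
  define C where "C = insert (i + j) (B - {i})"
  have new: "i + j \<notin> span (B - {i})" "i + j \<notin> span (B - {j})"
  proof -
    have "i \<notin> span (B - {i})" "j \<notin> span (B - {j})" using b(1) ij by (auto simp: dependent_def)
    moreover have "j \<in> span (B - {i})" "i \<in> span (B - {j})" using ij by (auto intro: span_base)
    ultimately show "i + j \<notin> span (B - {i})" "i + j \<notin> span (B - {j})"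
      by (simp_all add: span_add_eq span_add_eq2)
  qed
  have nB: "i + j \<notin> B - {i}" using new(1) span_base[of "i + j" "B - {i}"] by blast
  have C: "basis_of_space C"
  proof -
    have ind: "independent C" unfolding C_def
      using independent_insertI[OF new(1)] independent_mono[OF b(1), of "B - {i}"] by blast
    have "card C = card B"
      unfolding C_def using nB b(3) card.remove[OF b(3) ij(1)] by simp
    then have "UNIV \<subseteq> span C" using card_ge_dim_independent[OF subset_UNIV ind] b(4) by simp
    then show ?thesis using ind by (auto simp: basis_of_space_def)
  qed
  have sub: "apt_impl k B i j \<subseteq> apt k C"
  proof
    fix U assume "U \<in> apt_impl k B i j"
    then obtain S where S: "S \<subseteq> B" "card S = k" "i \<in> S \<longrightarrow> j \<in> S" "U = span S" by (auto simp: apt_impl_def)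
    show "U \<in> apt k C"
    proof (cases "i \<in> S")
      case False
      then show ?thesis using S by (auto simp: apt_def C_def)
    next
      case True
      let ?S = "insert (i + j) (S - {i})"
      have fin: "finite S" by (rule finite_subset[OF S(1) b(3)])
      have "i + j \<notin> S - {i}" using nB S(1) by blast
      then have "card ?S = Suc (card (S - {i}))" using fin by (intro card_insert_disjoint) auto
      then have "card ?S = k" using S(2) card.remove[OF fin True] by linarith
      moreover have "?S \<subseteq> C" using S by (auto simp: C_def)
      moreover have "span ?S = U"
      proof -
        have "i + j \<in> span S" using True S(3) by (simp add: span_add span_base)
        then have "?S \<subseteq> span S" by (auto intro: span_base)
        moreover have "S \<subseteq> span ?S"
        proof
          fix s assume s: "s \<in> S"
          have "i + j \<in> span ?S" "j \<in> span ?S" using True S(3) ij by (auto intro: span_base)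
          then have "i \<in> span ?S" using span_diff[of "i + j" ?S j] by simp
          then show "s \<in> span ?S" using s by (cases "s = i") (auto intro: span_base)
        qed
        ultimately show ?thesis using S(4) by (simp add: span_eq)
      qed
      ultimately show ?thesis unfolding apt_def by (metis (mono_tags, lifting) image_eqI mem_Collect_eq)
    qed
  qed
  \<comment> \<open>A set \<open>S\<close> of k-1 basis vectors other than \<open>i\<close>,
    \<open>j\<close> exists because k < n. Together with \<open>i + j\<close> it spans a member of
    \<open>apt k C\<close>; a subset of \<open>B\<close> with the same span would contain
    \<open>i\<close>, \<open>j\<close> and \<open>S\<close>, which are k+1 vectors.\<close>
  have "apt k C \<noteq> apt k B"
  proof
    assume eq: "apt k C = apt k B"
    have "card {i, j} = 2" using ij by simp
    then obtain S where S: "S \<subseteq> B" "S \<inter> {i, j} = {}" "card S = k - 1"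
      using ex_subset_between[OF b(3), of "{}" "{i, j}" "k - 1"] ij k b(4) by auto
    have fin: "finite S" by (rule finite_subset[OF S(1) b(3)])
    let ?S = "insert (i + j) S"
    have "i + j \<notin> S" using S nB by blast
    then have "card ?S = k" using fin S k by simp
    then have "span ?S \<in> apt k C" using S by (auto simp: apt_def C_def)
    then obtain T where T: "T \<subseteq> B" "card T = k" "span ?S = span T" using eq by (metis apt_memE)
    have ijT: "i + j \<in> span T" using T(3) span_base[of "i + j" ?S] by simp
    have "i \<in> T" using ijT new(1) T(1) span_mono[of T "B - {i}"] by blast
    moreover have "j \<in> T" using ijT new(2) T(1) span_mono[of T "B - {j}"] by blast
    moreover have "S \<subseteq> T"
    proof
      fix s assume "s \<in> S"
      then have "s \<in> span T" "s \<in> B" using T(3) span_base[of s ?S] S by auto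
      then show "s \<in> T" using mem_span_subset[OF b(1) T(1)] by blast
    qed
    ultimately have "insert i (insert j S) \<subseteq> T" by blast
    then have "card (insert i (insert j S)) \<le> k" using T b(3) by (metis card_mono finite_subset)
    moreover have "card (insert i (insert j S)) = Suc (Suc (card S))" using fin S ij by auto
    ultimately show False using S(3) k by simp
  qed
  moreover have "apt_impl k B i j \<subseteq> apt k B" by (auto simp: apt_impl_def apt_def)
  moreover have "apt k C \<in> apts k" using C by (simp add: apts_def)
  ultimately show ?thesis using sub unfolding inexact_def by (intro conjI bexI[of _ "apt k C"])
qed

text \<open>Otherwise every ordered pair \<open>i\<close>, \<open>j\<close> is separated by a member
  of \<open>R\<close>, so \<open>span {i}\<close> is the intersection of the members containing
  \<open>i\<close>. These members are spanned by subsets of \<open>C\<close> too, hence so is the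
  line, by a single vector of \<open>C\<close>. Thus the vectors of \<open>B\<close> are
  proportional to vectors of \<open>C\<close>, and the apartments agree.\<close>

lemma inexact_subset_impl:
  assumes B: "basis_of_space B" and k: "1 \<le> k" and n: "2 \<le> dim (UNIV :: 'b set)"
    and R: "inexact k (apt k B) R"
  shows "\<exists>i\<in>B. \<exists>j\<in>B. i \<noteq> j \<and> R \<subseteq> apt_impl k B i j"
proof (rule ccontr)
  assume contra: "\<not> ?thesis"
  note b = basis_of_spaceD[OF B]
  obtain C where C: "basis_of_space C" "apt k C \<noteq> apt k B" "R \<subseteq> apt k C" "R \<subseteq> apt k B"
    using R by (auto simp: inexact_def apts_def)
  note c = basis_of_spaceD[OF C(1)]
  have sep: "\<exists>S. S \<subseteq> B \<and> card S = k \<and> span S \<in> R \<and> i \<in> S \<and> j \<notin> S" if ij: "i \<in> B" "j \<in> B" "i \<noteq> j" for i j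
  proof -
    obtain U where U: "U \<in> R" "U \<notin> apt_impl k B i j" using contra ij by blast
    then obtain S where S: "S \<subseteq> B" "card S = k" "U = span S" using C(4) by (auto elim: apt_memE)
    then have "i \<in> S \<and> j \<notin> S" using U span_mem_apt_impl[OF B S(1,2)] by blast
    then show ?thesis using S U by blast
  qed
  have line: "\<exists>c\<in>C. span {c} = span {i}" if i: "i \<in> B" for i
  proof -
    define \<S> where "\<S> = {S. S \<subseteq> B \<and> card S = k \<and> span S \<in> R \<and> i \<in> S}"
    \<comment> \<open>A second basis vector makes \<open>\<S>\<close> nonempty; an empty
      intersection would be everything.\<close>
    have "B \<noteq> {i}" using n b(4) by auto
    then obtain j where "j \<in> B" "j \<noteq> i" using i by blast
    then have ne: "\<S> \<noteq> {}" using sep[of i j] i by (auto simp: \<S>_def)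
    have fin: "finite \<S>" using b(3) by (auto simp: \<S>_def intro: finite_subset[of _ "Pow B"])
    have "\<Inter>\<S> = {i}"
    proof
      show "\<Inter>\<S> \<subseteq> {i}"
      proof
        fix j assume j: "j \<in> \<Inter>\<S>"
        then have "j \<in> B" using ne by (auto simp: \<S>_def)
        then show "j \<in> {i}" using sep[of i j] i j by (auto simp: \<S>_def)
      qed
    qed (auto simp: \<S>_def)
    moreover have "\<Union>\<S> \<subseteq> B" by (auto simp: \<S>_def)
    ultimately have span_i: "\<Inter> (span ` \<S>) = span {i}" using span_Inter[OF b(1) fin ne] by simp
    define t where "t S = (SOME T. T \<subseteq> C \<and> span S = span T)" for S
    have t: "t S \<subseteq> C" "span S = span (t S)" if "S \<in> \<S>" for S
    proof -
      have "span S \<in> apt k C" using that C(3) by (auto simp: \<S>_def)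
      then have "\<exists>T. T \<subseteq> C \<and> span S = span T" by (metis apt_memE)
      from someI_ex[OF this] show "t S \<subseteq> C" "span S = span (t S)" by (simp_all add: t_def)
    qed
    have "\<Inter> (span ` t ` \<S>) = span (\<Inter> (t ` \<S>))"
      using t(1) fin ne by (intro span_Inter[OF c(1)]) auto
    moreover have "\<Inter> (span ` t ` \<S>) = \<Inter> (span ` \<S>)" using t(2) by auto
    ultimately have eq: "span {i} = span (\<Inter> (t ` \<S>))" using span_i by simp
    have sub: "\<Inter> (t ` \<S>) \<subseteq> C" using t(1) ne by blast
    have "i \<noteq> 0" using i b(1) dependent_zero by blast
    then have "dim (span (\<Inter> (t ` \<S>))) = 1" unfolding eq[symmetric] by simp
    then have "card (\<Inter> (t ` \<S>)) = 1" using dim_span_subset[OF c(1) sub] by simp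
    then obtain x where "\<Inter> (t ` \<S>) = {x}" by (auto simp: card_1_singleton_iff)
    then show ?thesis using eq sub by auto
  qed
  then obtain \<phi> where \<phi>: "\<And>i. i \<in> B \<Longrightarrow> \<phi> i \<in> C \<and> span {\<phi> i} = span {i}" by metis
  have "apt k B \<subseteq> apt k C"
  proof
    fix U assume "U \<in> apt k B"
    then obtain S where S: "S \<subseteq> B" "card S = k" "U = span S" by (rule apt_memE)
    have "span (\<phi> ` S) = span S"
    proof -
      have "\<phi> s \<in> span S" "s \<in> span (\<phi> ` S)" if "s \<in> S" for s
      proof -
        have "\<phi> s \<in> span {s}" "s \<in> span {\<phi> s}" using \<phi> S(1) that span_base[of _ "{_}"] by (metis insertI1 subsetD)+
        then show "\<phi> s \<in> span S" "s \<in> span (\<phi> ` S)"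
          using span_mono[of "{s}" S] span_mono[of "{\<phi> s}" "\<phi> ` S"] that by auto
      qed
      then show ?thesis by (auto simp: span_eq)
    qed
    moreover have sub: "\<phi> ` S \<subseteq> C" using \<phi> S(1) by blast
    ultimately have "card (\<phi> ` S) = k"
      using dim_span_subset[OF c(1) sub] dim_span_subset[OF b(1) S(1)] S(2) by simp
    then show "U \<in> apt k C" using S(3) sub \<open>span (\<phi> ` S) = span S\<close> unfolding apt_def by blast
  qed
  then have "apt k B = apt k C" using card_subset_eq[of "apt k C" "apt k B"] card_apt[OF B] card_apt[OF C(1)] by simp
  then show False using C(2) by simp
qed

text \<open>The bounds on \<open>k\<close> leave room for a k-set containing \<open>i'\<close> but
  avoiding \<open>i\<close> and \<open>j'\<close>, and for one containing \<open>i\<close> and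
  \<open>j\<close> but avoiding \<open>j'\<close>; either would refute the inclusion.\<close>

lemma apt_impl_mono:
  assumes B: "basis_of_space B" and ij: "i \<in> B" "j \<in> B" "i \<noteq> j" "i' \<in> B" "j' \<in> B" "i' \<noteq> j'"
    and k: "2 \<le> k" "k + 2 \<le> dim (UNIV :: 'b set)"
    and sub: "apt_impl k B i j \<subseteq> apt_impl k B i' j'"
  shows "i = i' \<and> j = j'"
proof -
  note b = basis_of_spaceD[OF B]
  have noS: False if S: "S \<subseteq> B" "card S = k" "i \<in> S \<longrightarrow> j \<in> S" "i' \<in> S" "j' \<notin> S" for S
    using sub S span_mem_apt_impl[OF B S(1,2)] by blast
  have i: "i = i'"
  proof (rule ccontr)
    assume ne: "i \<noteq> i'"
    have "card {i, j'} \<le> 2" by (simp add: card_insert_if)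
    then obtain S where "{i'} \<subseteq> S" "S \<subseteq> B" "S \<inter> {i, j'} = {}" "card S = k"
      using ex_subset_between[OF b(3), of "{i'}" "{i, j'}" k] ij ne k b(4) by auto
    then show False using noS[of S] by auto
  qed
  moreover have "j = j'"
  proof (rule ccontr)
    assume ne: "j \<noteq> j'"
    have "card {i, j} \<le> 2" by (simp add: card_insert_if)
    then obtain S where "{i, j} \<subseteq> S" "S \<subseteq> B" "S \<inter> {j'} = {}" "card S = k"
      using ex_subset_between[OF b(3), of "{i, j}" "{j'}" k] ij ne k b(4) i by auto
    then show False using noS[of S] i by auto
  qed
  ultimately show ?thesis by blast
qed

lemma max_inexact_eq:
  assumes B: "basis_of_space B" and k: "2 \<le> k" "k + 2 \<le> dim (UNIV :: 'b set)"
  shows "max_inexact k (apt k B) = {apt_impl k B i j |i j. i \<in> B \<and> j \<in> B \<and> i \<noteq> j}"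
proof (intro equalityI subsetI)
  fix R assume "R \<in> max_inexact k (apt k B)"
  then have R: "inexact k (apt k B) R" "\<And>R'. inexact k (apt k B) R' \<Longrightarrow> R \<subseteq> R' \<Longrightarrow> R' = R"
    by (auto simp: max_inexact_def)
  obtain i j where ij: "i \<in> B" "j \<in> B" "i \<noteq> j" "R \<subseteq> apt_impl k B i j"
    using inexact_subset_impl[OF B _ _ R(1)] k by auto
  then have "apt_impl k B i j = R" using R(2) apt_impl_inexact[OF B ij(1-3)] k by simp
  then show "R \<in> {apt_impl k B i j |i j. i \<in> B \<and> j \<in> B \<and> i \<noteq> j}" using ij by blast
next
  fix R assume "R \<in> {apt_impl k B i j |i j. i \<in> B \<and> j \<in> B \<and> i \<noteq> j}"
  then obtain i j where ij: "i \<in> B" "j \<in> B" "i \<noteq> j" "R = apt_impl k B i j" by blast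
  have "R' = R" if R': "inexact k (apt k B) R'" "R \<subseteq> R'" for R'
  proof -
    obtain i' j' where ij': "i' \<in> B" "j' \<in> B" "i' \<noteq> j'" "R' \<subseteq> apt_impl k B i' j'"
      using inexact_subset_impl[OF B _ _ R'(1)] k by auto
    have "apt_impl k B i j \<subseteq> apt_impl k B i' j'" using ij(4) ij'(4) R'(2) by simp
    then have "i = i' \<and> j = j'" using apt_impl_mono[OF B ij(1-3) ij'(1-3) k] by blast
    then show ?thesis using ij(4) ij'(4) R'(2) by blast
  qed
  then show "R \<in> max_inexact k (apt k B)"
    using apt_impl_inexact[OF B ij(1-3)] k ij(4) by (simp add: max_inexact_def)
qed

lemma missing_eq:
  assumes B: "basis_of_space B" and k: "2 \<le> k" "k + 2 \<le> dim (UNIV :: 'b set)"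
    and X: "\<X> \<noteq> {}" "\<And>S. S \<in> \<X> \<Longrightarrow> S \<subseteq> B \<and> card S = k"
  shows "missing k (apt k B) (span ` \<X>) = card (\<Inter>\<X>) * (dim (UNIV :: 'b set) - card (\<Union>\<X>))"
proof -
  note b = basis_of_spaceD[OF B]
  have Int: "apt_impl k B i j \<inter> span ` \<X> = {} \<longleftrightarrow> i \<in> \<Inter>\<X> \<and> j \<notin> \<Union>\<X>" for i j
  proof -
    have "apt_impl k B i j \<inter> span ` \<X> = {} \<longleftrightarrow> (\<forall>S\<in>\<X>. span S \<notin> apt_impl k B i j)" by blast
    also have "\<dots> \<longleftrightarrow> (\<forall>S\<in>\<X>. i \<in> S \<and> j \<notin> S)" using span_mem_apt_impl[OF B] X(2) by simp
    finally show ?thesis by blast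
  qed
  have sub: "\<Inter>\<X> \<subseteq> B" "\<Union>\<X> \<subseteq> B" using X by blast+
  have "{R \<in> max_inexact k (apt k B). R \<inter> span ` \<X> = {}} = (\<lambda>(i, j). apt_impl k B i j) ` (\<Inter>\<X> \<times> (B - \<Union>\<X>))"
    (is "?L = ?f ` ?P")
  proof (intro equalityI subsetI)
    fix R assume "R \<in> ?L"
    then obtain i j where "i \<in> B" "j \<in> B" "R = apt_impl k B i j" "R \<inter> span ` \<X> = {}"
      unfolding max_inexact_eq[OF B k] by blast
    then show "R \<in> ?f ` ?P" using Int by force
  next
    fix R assume "R \<in> ?f ` ?P"
    then obtain i j where ij: "i \<in> \<Inter>\<X>" "j \<in> B - \<Union>\<X>" "R = apt_impl k B i j" by auto
    \<comment> \<open>Some member of the nonempty family contains \<open>i\<close> and not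
      \<open>j\<close>.\<close>
    then have "i \<noteq> j" using X(1) by blast
    then have "R \<in> max_inexact k (apt k B)" unfolding max_inexact_eq[OF B k] using ij sub by blast
    moreover have "R \<inter> span ` \<X> = {}" using ij Int by simp
    ultimately show "R \<in> ?L" by simp
  qed
  moreover have "inj_on ?f ?P"
  proof (rule inj_onI)
    fix p q assume pq: "p \<in> ?P" "q \<in> ?P" "?f p = ?f q"
    obtain i j i' j' where e: "p = (i, j)" "q = (i', j')" by (metis surj_pair)
    have "i \<in> B" "j \<in> B" "i \<noteq> j" "i' \<in> B" "j' \<in> B" "i' \<noteq> j'" using pq e sub X(1) by auto
    moreover have "apt_impl k B i j \<subseteq> apt_impl k B i' j'" using pq(3) e by simp
    ultimately show "p = q" using apt_impl_mono[OF B _ _ _ _ _ _ k] e by blast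
  qed
  ultimately have "missing k (apt k B) (span ` \<X>) = card ?P"
    unfolding missing_def by (simp add: card_image)
  also have "\<dots> = card (\<Inter>\<X>) * (card B - card (\<Union>\<X>))"
    using sub b(3) by (simp add: card_cartesian_product card_Diff_subset finite_subset)
  finally show ?thesis using b(4) by simp
qed

end

section \<open>Adjacency in terms of R-sets\<close>

context finite_dimensional_vector_space
begin

text \<open>Any two planes lie in a common apartment: a basis of the intersection is extended to
  bases \<open>S\<close> of \<open>U\<close> and \<open>T\<close> of \<open>W\<close>. Then
  \<open>S \<union> T\<close> spans the sum and, by inclusion-exclusion, has no more elements than
  its dimension, so it is independent.\<close>

lemma ex_common_basis:
  assumes "subspace U" "subspace W"
  shows "\<exists>B S T. basis_of_space B \<and> S \<subseteq> B \<and> T \<subseteq> B \<and> U = span S \<and> W = span T"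
proof -
  obtain N where N: "N \<subseteq> U \<inter> W" "independent N" "span N = U \<inter> W" "card N = dim (U \<inter> W)"
    using basis_subspace_exists[of "U \<inter> W"] subspace_inter[OF assms] by metis
  obtain S where S: "N \<subseteq> S" "S \<subseteq> U" "independent S" "U \<subseteq> span S"
    using N by (metis maximal_independent_subset_extend le_inf_iff)
  obtain T where T: "N \<subseteq> T" "T \<subseteq> W" "independent T" "W \<subseteq> span T"
    using N by (metis maximal_independent_subset_extend le_inf_iff)
  have US: "U = span S" using span_minimal[OF S(2) assms(1)] S(4) by blast
  have WT: "W = span T" using span_minimal[OF T(2) assms(2)] T(4) by blast
  have fin: "finite S" "finite T" using S T finiteI_independent by blast+
  have "card N \<le> card (S \<inter> T)" using S T fin by (intro card_mono) auto
  moreover have "card (S \<union> T) + card (S \<inter> T) = card S + card T" using card_Un_Int[OF fin] by simp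
  moreover have "card S = dim U" "card T = dim W"
    using US WT dim_span_eq_card_independent S(3) T(3) by simp_all
  ultimately have "card (S \<union> T) \<le> dim (span (U \<union> W))"
    using dim_join[OF assms] N(4) by linarith
  moreover have "span (S \<union> T) = span (U \<union> W)" unfolding US WT by (simp add: span_Un span_span)
  ultimately have "independent (S \<union> T)"
    using card_le_dim_spanning[of "S \<union> T" "span (U \<union> W)"] span_superset[of "S \<union> T"] fin by simp
  then obtain B where "basis_of_space B" "S \<union> T \<subseteq> B" by (rule ex_basis_superset)
  then show ?thesis using US WT by blast
qed

lemma span_triple_R_set:
  assumes "independent E" "S \<subseteq> E" "T \<subseteq> E" "X \<subseteq> E" "card S = k" "card T = k" "card X = k"
  shows "R_set k {span S, span T, span X}"
proof -
  obtain B where B: "basis_of_space B" "E \<subseteq> B" using assms(1) by (rule ex_basis_superset)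
  then have "S \<subseteq> B" "T \<subseteq> B" "X \<subseteq> B" using assms by auto
  then have "{span S, span T, span X} \<subseteq> apt k B" using assms unfolding apt_def by blast
  moreover have "apt k B \<in> apts k" using B by (simp add: apts_def)
  ultimately show ?thesis unfolding R_set_iff by blast
qed

lemma span_eq_grassmannian:
  assumes "independent E" "S \<subseteq> E" "card S = k" "S \<subseteq> U" "U \<in> grassmannian k"
  shows "span S = U"
proof (rule grassmannian_eqI)
  show "span S \<in> grassmannian k"
    using dim_span_subset[OF assms(1,2)] assms(3) by (simp add: grassmannian_def del: dim_span)
  show "span S \<subseteq> U" using assms(4,5) by (simp add: grassmannian_def span_minimal)
qed (rule assms(5))

text \<open>A basis of the common intersection is completed by one vector from each plane; these are
  independent because the third is chosen outside the sum of \<open>U\<close> and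
  \<open>V\<close>.\<close>

lemma strict_star_R_set:
  assumes "star_triple k U V W" "\<not> top_triple k U V W"
  shows "R_set k {U, V, W}"
proof -
  obtain P where P: "P \<in> grassmannian (k - 1)" "Suc (dim P) = k" "U \<inter> V = P" "U \<inter> W = P" "V \<inter> W = P"
    using assms(1) by (rule star_tripleE)
  have c: "adjacent k U V" "adjacent k U W" "adjacent k V W" "\<not> W \<subseteq> span (U \<union> V)"
    using assms by (auto simp: star_triple_def top_triple_def clique_triple_def)
  have G: "U \<in> grassmannian k" "V \<in> grassmannian k" "W \<in> grassmannian k"
    using c adjacent_grassmannian by blast+
  obtain E where E: "E \<subseteq> P" "independent E" "span E = P" "card E = dim P" "finite E"
    using basis_subspace_exists[OF grassmannianD(1)[OF P(1)]] by metis
  have "\<not> U \<subseteq> V" "\<not> V \<subseteq> U" using grassmannian_eqI G c(1) by (metis adjacent_grassmannian(3))+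
  then obtain x y where xy: "x \<in> U" "x \<notin> V" "y \<in> V" "y \<notin> U" by blast
  obtain z where z: "z \<in> W" "z \<notin> span (U \<union> V)" using c by blast
  have zUV: "z \<notin> U" "z \<notin> V" using z span_superset[of "U \<union> V"] by auto
  have EU: "E \<subseteq> U" "E \<subseteq> V" "E \<subseteq> W" using E(1) P by auto
  have ix: "independent (insert x E)" using E(3) xy P(3) by (intro independent_insertI[OF _ E(2)]) auto
  have "span (insert x E) \<subseteq> U" using G xy EU by (intro span_minimal) (auto simp: grassmannian_def)
  then have iy: "independent (insert y (insert x E))" using xy by (intro independent_insertI[OF _ ix]) auto
  have "span (insert y (insert x E)) \<subseteq> span (U \<union> V)" using xy EU by (intro span_mono) auto
  then have iz: "independent (insert z (insert y (insert x E)))" using z by (intro independent_insertI[OF _ iy]) auto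
  have nE: "x \<notin> E" "y \<notin> E" "z \<notin> E" using xy zUV EU by auto
  have card: "card (insert x E) = k" "card (insert y E) = k" "card (insert z E) = k"
    using nE E P by simp_all
  have "span (insert x E) = U" by (rule span_eq_grassmannian[OF iz _ card(1) _ G(1)]) (use xy EU in auto)
  moreover have "span (insert y E) = V" by (rule span_eq_grassmannian[OF iz _ card(2) _ G(2)]) (use xy EU in auto)
  moreover have "span (insert z E) = W" by (rule span_eq_grassmannian[OF iz _ card(3) _ G(3)]) (use z EU in auto)
  moreover have "R_set k {span (insert x E), span (insert y E), span (insert z E)}"
    using card by (intro span_triple_R_set[OF iz]) auto
  ultimately show ?thesis by simp
qed

text \<open>Dually, a basis of \<open>U \<inter> V \<inter> W\<close> is completed by one vector
  from each pairwise intersection outside the third plane; each plane contains exactly two of the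
  three.\<close>

lemma strict_top_R_set:
  assumes "top_triple k U V W" "\<not> star_triple k U V W"
  shows "R_set k {U, V, W}"
proof -
  have c: "adjacent k U V" "adjacent k U W" "adjacent k V W" "\<not> U \<inter> V \<subseteq> W"
    using assms by (auto simp: star_triple_def top_triple_def clique_triple_def)
  note G1 = adjacent_grassmannian[OF c(1)] and G2 = adjacent_grassmannian[OF c(2)] and G3 = adjacent_grassmannian[OF c(3)]
  have neq: "\<not> U \<inter> W \<subseteq> V" "\<not> V \<inter> W \<subseteq> U"
  proof -
    have "U \<inter> W \<subseteq> V \<Longrightarrow> U \<inter> W = U \<inter> V" "V \<inter> W \<subseteq> U \<Longrightarrow> V \<inter> W = U \<inter> V"
      using grassmannian_eqI[OF G2(4) G1(4)] grassmannian_eqI[OF G3(4) G1(4)] by blast+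
    then show "\<not> U \<inter> W \<subseteq> V" "\<not> V \<inter> W \<subseteq> U" using c(4) by blast+
  qed
  obtain x y z where xyz: "x \<in> U" "x \<in> V" "x \<notin> W" "y \<in> U" "y \<in> W" "y \<notin> V" "z \<in> V" "z \<in> W" "z \<notin> U"
    using c(4) neq by blast
  define N where "N = U \<inter> V \<inter> W"
  have N: "subspace N" using G1 G2 by (auto simp: N_def grassmannian_def subspace_inter)
  have kk: "Suc (k - 1) = k" using G1 by simp
  have "U \<in> grassmannian (Suc (k - 1))" "U \<inter> V \<noteq> U \<inter> W" using G1(1) kk xyz by auto
  \<comment> \<open>Two distinct hyperplanes of \<open>U\<close> meet in dimension k-2.\<close>
  then have "adjacent (k - 1) (U \<inter> V) (U \<inter> W)"
    using adjacentI_join[OF G1(4) G2(4), of U] by blast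
  then have dN: "Suc (dim N) = k - 1" by (simp add: adjacent_def N_def Int_ac)
  obtain E where E: "E \<subseteq> N" "independent E" "span E = N" "card E = dim N" "finite E"
    using basis_subspace_exists[OF N] by metis
  have sub: "subspace U" "subspace V" "subspace W" using G1 G2 by (auto simp: grassmannian_def)
  have EN: "E \<subseteq> U" "E \<subseteq> V" "E \<subseteq> W" using E(1) by (auto simp: N_def)
  have ix: "independent (insert x E)" using E(3) xyz by (intro independent_insertI[OF _ E(2)]) (auto simp: N_def)
  have "span (insert x E) \<subseteq> V" using xyz EN sub by (intro span_minimal) auto
  then have iy: "independent (insert y (insert x E))" using xyz by (intro independent_insertI[OF _ ix]) auto
  have "span (insert y (insert x E)) \<subseteq> U" using xyz EN sub by (intro span_minimal) auto
  then have iz: "independent (insert z (insert y (insert x E)))" using xyz by (intro independent_insertI[OF _ iy]) auto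
  have nE: "x \<notin> E" "y \<notin> E" "z \<notin> E" "x \<noteq> y" "x \<noteq> z" "y \<noteq> z" using xyz EN by auto
  have card: "card (insert x (insert y E)) = k" "card (insert x (insert z E)) = k" "card (insert y (insert z E)) = k"
    using nE E(4,5) dN by simp_all
  have "span (insert x (insert y E)) = U"
    by (rule span_eq_grassmannian[OF iz _ card(1) _ G1(1)]) (use xyz EN in auto)
  moreover have "span (insert x (insert z E)) = V"
    by (rule span_eq_grassmannian[OF iz _ card(2) _ G1(2)]) (use xyz EN in auto)
  moreover have "span (insert y (insert z E)) = W"
    by (rule span_eq_grassmannian[OF iz _ card(3) _ G2(2)]) (use xyz EN in auto)
  moreover have "R_set k {span (insert x (insert y E)), span (insert x (insert z E)), span (insert y (insert z E))}"
    using card by (intro span_triple_R_set[OF iz]) auto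
  ultimately show ?thesis by simp
qed

lemma triple_in_apt:
  assumes "basis_of_space B" "S \<subseteq> B" "T \<subseteq> B" "X \<subseteq> B"
    and "clique_triple k (span S) (span T) (span X)"
  shows "star_triple k (span S) (span T) (span X) \<longleftrightarrow> S \<inter> T \<subseteq> X"
    and "top_triple k (span S) (span T) (span X) \<longleftrightarrow> X \<subseteq> S \<union> T"
    and "card S = k" "card T = k" "card X = k" "Suc (card (S \<inter> T)) = k" "Suc (card (S \<inter> X)) = k" "Suc (card (T \<inter> X)) = k"
proof -
  note b = basis_of_spaceD[OF assms(1)]
  note Int = span_Int[OF b(1)]
  have "span (span S \<union> span T) = span (S \<union> T)" by (simp add: span_Un span_span)
  then show "star_triple k (span S) (span T) (span X) \<longleftrightarrow> S \<inter> T \<subseteq> X"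
    "top_triple k (span S) (span T) (span X) \<longleftrightarrow> X \<subseteq> S \<union> T"
    using assms(5) Int[OF assms(2,3)] span_subset_iff[OF b(1), of "S \<inter> T" X]
      span_subset_iff[OF b(1), of X "S \<union> T"] assms(2-4)
    by (auto simp: star_triple_def top_triple_def)
  have "adjacent k (span S) (span T)" "adjacent k (span S) (span X)" "adjacent k (span T) (span X)"
    using assms(5) by (auto simp: clique_triple_def)
  then show "card S = k" "card T = k" "card X = k" "Suc (card (S \<inter> T)) = k" "Suc (card (S \<inter> X)) = k" "Suc (card (T \<inter> X)) = k"
    using Int[OF assms(2,3)] Int[OF assms(2,4)] Int[OF assms(3,4)] dim_span_subset[OF b(1)] assms(2-4)
    by (auto simp: adjacent_def grassmannian_def le_infI1 simp del: dim_span)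
qed

lemma R_set_triple_spans:
  assumes "R_set k {U, V, W}"
  obtains B S T X where "basis_of_space B" "S \<subseteq> B" "T \<subseteq> B" "X \<subseteq> B" "U = span S" "V = span T" "W = span X"
    "card S = k" "card T = k" "card X = k"
proof -
  obtain A where A: "A \<in> apts k" "{U, V, W} \<subseteq> A" using assms R_set_iff by blast
  then obtain B where B: "basis_of_space B" "A = apt k B" by (auto simp: apts_def)
  then have "U \<in> apt k B" "V \<in> apt k B" "W \<in> apt k B" using A by auto
  then show ?thesis using that[OF B(1)] by (metis apt_memE)
qed

text \<open>Besides \<open>S \<inter> T\<close>, the set \<open>X\<close> would need an element
  outside \<open>S\<close> and another outside \<open>T\<close>, distinct since \<open>X\<close>
  lies in the union: k+1 elements in all.\<close>

lemma triple_sets_distinct_type: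
  assumes "finite S" "finite T" "finite X" "card S = k" "card T = k" "card X = k"
    and "Suc (card (S \<inter> T)) = k" "X \<noteq> S" "X \<noteq> T" "S \<inter> T \<subseteq> X" "X \<subseteq> S \<union> T"
  shows False
proof -
  have "\<not> X \<subseteq> S" "\<not> X \<subseteq> T" using assms by (metis card_subset_eq)+
  then obtain x y where xy: "x \<in> X" "x \<notin> S" "y \<in> X" "y \<notin> T" by blast
  then have "x \<noteq> y" using assms by blast
  have "insert x (insert y (S \<inter> T)) \<subseteq> X" using xy assms by blast
  then have "card (insert x (insert y (S \<inter> T))) \<le> k" using assms by (metis card_mono)
  moreover have "card (insert x (insert y (S \<inter> T))) = Suc (Suc (card (S \<inter> T)))"
    using xy \<open>x \<noteq> y\<close> assms(1) by simp
  ultimately show False using assms by simp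
qed

lemma pencil_not_R_set:
  assumes "star_triple k U V W" "top_triple k U V W"
  shows "\<not> R_set k {U, V, W}"
proof
  assume "R_set k {U, V, W}"
  then obtain B S T X where B: "basis_of_space B" "S \<subseteq> B" "T \<subseteq> B" "X \<subseteq> B" "U = span S" "V = span T" "W = span X"
    by (rule R_set_triple_spans)
  have c: "clique_triple k (span S) (span T) (span X)" using assms B by (simp add: star_triple_def)
  note t = triple_in_apt[OF B(1-4) c]
  have "X \<noteq> S" "X \<noteq> T" using c by (auto simp: clique_triple_def adjacent_def)
  moreover have "finite S" "finite T" "finite X" using B(2-4) basis_of_spaceD(3)[OF B(1)] finite_subset by blast+
  ultimately show False using triple_sets_distinct_type[of S T X k] t assms B by simp
qed

lemma R_set_triple_iff:
  assumes "clique_triple k U V W"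
  shows "R_set k {U, V, W} \<longleftrightarrow> \<not> (star_triple k U V W \<and> top_triple k U V W)"
  using pencil_not_R_set strict_star_R_set strict_top_R_set clique_triple_cases[OF assms] by blast

text \<open>By inclusion-exclusion, a star has an intersection of size k-1 and a union of size k+2;
  inside an apartment every other clique triple is a top, with sizes k-2 and k+1.\<close>

lemma missing_triple:
  assumes B: "basis_of_space B" "S \<subseteq> B" "T \<subseteq> B" "X \<subseteq> B"
    and c: "clique_triple k (span S) (span T) (span X)"
    and k: "2 \<le> k" "k + 2 \<le> dim (UNIV :: 'b set)"
  shows "star_triple k (span S) (span T) (span X) \<Longrightarrow>
      missing k (apt k B) {span S, span T, span X} = (k - 1) * (dim (UNIV :: 'b set) - (k + 2))"
    and "\<not> star_triple k (span S) (span T) (span X) \<Longrightarrow>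
      missing k (apt k B) {span S, span T, span X} = (k - 2) * (dim (UNIV :: 'b set) - (k + 1))"
proof -
  note t = triple_in_apt[OF B c]
  have m: "missing k (apt k B) {span S, span T, span X}
      = card (S \<inter> T \<inter> X) * (dim (UNIV :: 'b set) - card (S \<union> T \<union> X))"
    using missing_eq[OF B(1) k, of "{S, T, X}"] t B by (auto simp: Int_assoc Un_assoc)
  have fin: "finite S" "finite T" "finite X" using B(2-4) basis_of_spaceD(3)[OF B(1)] finite_subset by blast+
  have ne: "X \<noteq> S" "X \<noteq> T" using c by (auto simp: clique_triple_def adjacent_def)
  have ST: "card (S \<union> T) = k + 1" using card_Un_Int[OF fin(1,2)] t by simp
  have STX: "card (S \<union> T \<union> X) + card ((S \<union> T) \<inter> X) = card (S \<union> T) + card X"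
    using card_Un_Int[of "S \<union> T" X] fin by simp
  have "(S \<union> T) \<inter> X = (S \<inter> X) \<union> (T \<inter> X)" "(S \<inter> X) \<inter> (T \<inter> X) = S \<inter> T \<inter> X" by blast+
  then have IX: "card ((S \<union> T) \<inter> X) + card (S \<inter> T \<inter> X) = card (S \<inter> X) + card (T \<inter> X)"
    using card_Un_Int[of "S \<inter> X" "T \<inter> X"] fin by simp
  {
    assume "star_triple k (span S) (span T) (span X)"
    then have "S \<inter> T \<inter> X = S \<inter> T" using t(1) by blast
    then have "card (S \<inter> T \<inter> X) = k - 1" using t(6) by simp
    moreover from this have "card (S \<union> T \<union> X) = k + 2" using STX IX ST t(5,7,8) by linarith
    ultimately show "missing k (apt k B) {span S, span T, span X} = (k - 1) * (dim (UNIV :: 'b set) - (k + 2))"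
      using m by simp
  next
    assume "\<not> star_triple k (span S) (span T) (span X)"
    then have "top_triple k (span S) (span T) (span X)" using clique_triple_cases[OF c] by blast
    then have "X \<subseteq> S \<union> T" using t(2) by blast
    then have "S \<union> T \<union> X = S \<union> T" "(S \<union> T) \<inter> X = X" by blast+
    then have "card (S \<union> T \<union> X) = k + 1" "card (S \<inter> T \<inter> X) = k - 2" using ST IX t(5,7,8) by simp_all
    then show "missing k (apt k B) {span S, span T, span X} = (k - 2) * (dim (UNIV :: 'b set) - (k + 1))"
      using m by simp
  }
qed

text \<open>Rewriting the size of the union as 2k minus that of the intersection turns the count
  into a function of the latter alone, increasing in it.\<close>

lemma missing_pair:
  assumes "basis_of_space B" "S \<subseteq> B" "T \<subseteq> B" "card S = k" "card T = k"
    and "2 \<le> k" "k + 2 \<le> dim (UNIV :: 'b set)"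
  shows "missing k (apt k B) {span S, span T}
    = card (S \<inter> T) * (dim (UNIV :: 'b set) + card (S \<inter> T) - 2 * k)"
proof -
  have "finite S" "finite T" using assms(1-3) basis_of_spaceD(3) finite_subset by blast+
  then have "card (S \<union> T) = 2 * k - card (S \<inter> T)" "card (S \<inter> T) \<le> 2 * k"
    using card_Un_Int[of S T] assms by simp_all
  then have "dim (UNIV :: 'b set) - card (S \<union> T) = dim (UNIV :: 'b set) + card (S \<inter> T) - 2 * k" by linarith
  moreover have "missing k (apt k B) {span S, span T} = card (S \<inter> T) * (dim (UNIV :: 'b set) - card (S \<union> T))"
    using missing_eq[OF assms(1,6,7), of "{S, T}"] assms by auto
  ultimately show ?thesis by simp
qed

text \<open>Both factors increase with \<open>m\<close>, the second strictly; the bounds keep the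
  truncated subtraction exact.\<close>

lemma mult_diff_inject:
  fixes m m' :: nat
  assumes "m * (n + m - q) = m' * (n + m' - q)" "q \<le> n + m" "q \<le> n + m'"
  shows "m = m'"
proof -
  have less: False if "a < b" "a * (n + a - q) = b * (n + b - q)" "q \<le> n + a" for a b :: nat
  proof -
    have "a * (n + a - q) \<le> b * (n + a - q)" using that by (intro mult_right_mono) auto
    also have "\<dots> < b * (n + b - q)" using that by (intro mult_strict_left_mono) auto
    finally show False using that by simp
  qed
  then show ?thesis using less[of m m'] less[of m' m] assms by (metis nat_neq_iff)
qed

lemma apt_iso_dim_Int:
  assumes f: "apt_iso k f f'" and k: "2 \<le> k" "k + 2 \<le> dim (UNIV :: 'b set)"
    and UW: "U \<in> grassmannian k" "W \<in> grassmannian k"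
  shows "dim (f U \<inter> f W) = dim (U \<inter> W)"
proof -
  obtain B S T where B: "basis_of_space B" "S \<subseteq> B" "T \<subseteq> B" "U = span S" "W = span T"
    using ex_common_basis[of U W] UW by (auto simp: grassmannian_def)
  note b = basis_of_spaceD[OF B(1)]
  have c: "card S = k" "card T = k"
    using dim_span_subset[OF b(1) B(2)] dim_span_subset[OF b(1) B(3)] B(4,5) UW
    by (simp_all add: grassmannian_def del: dim_span)
  have A: "apt k B \<in> apts k" using B(1) by (simp add: apts_def)
  obtain C where C: "basis_of_space C" "f ` apt k B = apt k C"
    using apt_isoD(3)[OF f A] unfolding apts_def by blast
  have UWB: "{U, W} \<subseteq> apt k B" using B c by (auto simp: span_mem_apt)
  then have "f U \<in> apt k C" "f W \<in> apt k C" using C(2) by auto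
  then obtain S' T' where S': "S' \<subseteq> C" "T' \<subseteq> C" "card S' = k" "card T' = k" "f U = span S'" "f W = span T'"
    by (metis apt_memE)
  note c' = basis_of_spaceD[OF C(1)]
  have "missing k (apt k C) {f U, f W} = missing k (apt k B) {U, W}"
    using missing_image[OF f A UWB] C(2) by simp
  then have "card (S' \<inter> T') * (dim (UNIV :: 'b set) + card (S' \<inter> T') - 2 * k)
      = card (S \<inter> T) * (dim (UNIV :: 'b set) + card (S \<inter> T) - 2 * k)"
    using missing_pair[OF B(1-3) c k] missing_pair[OF C(1) S'(1-4) k] B S' by simp
  \<comment> \<open>Two k-subsets of a basis have a union of size at most n.\<close>
  moreover have bound: "2 * k \<le> dim (UNIV :: 'b set) + card (X \<inter> Y)"
    if D: "basis_of_space D" "X \<subseteq> D" "Y \<subseteq> D" "card X = k" "card Y = k" for D X Y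
  proof -
    note d = basis_of_spaceD[OF D(1)]
    have "finite X" "finite Y" "card (X \<union> Y) \<le> card D"
      using D d(3) by (auto intro: finite_subset card_mono)
    then show ?thesis using card_Un_Int[of X Y] D d(4) by simp
  qed
  ultimately have "card (S' \<inter> T') = card (S \<inter> T)"
    using mult_diff_inject[OF _ bound[OF C(1) S'(1-4)] bound[OF B(1-3) c]] by blast
  then show ?thesis
    using span_Int[OF b(1) B(2,3)] span_Int[OF c'(1) S'(1,2)] B S'
      dim_span_subset[OF b(1), of "S \<inter> T"] dim_span_subset[OF c'(1), of "S' \<inter> T'"]
    by (simp add: le_infI1 del: dim_span)
qed

lemma apt_iso_adjacent:
  assumes f: "apt_iso k f f'" and k: "1 \<le> k" "k < dim (UNIV :: 'b set)"
    and a: "adjacent k U W"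
  shows "adjacent k (f U) (f W)"
proof -
  note G = adjacent_grassmannian[OF a]
  have fG: "f U \<in> grassmannian k" "f W \<in> grassmannian k" "f U \<noteq> f W"
    using apt_isoD(1,2)[OF f] G by metis+
  consider "k = 1" | "Suc k = dim (UNIV :: 'b set)" | "2 \<le> k" "k + 2 \<le> dim (UNIV :: 'b set)"
    using k by linarith
  then show ?thesis
  proof cases
    case 1
    then show ?thesis
      using fG subspace_0 by (intro adjacentI_common[where P = "{0}"]) (auto simp: grassmannian_def)
  next
    case 2
    then show ?thesis using fG by (intro adjacentI_join[where Q = UNIV]) (auto simp: grassmannian_def)
  next
    case 3
    then show ?thesis using apt_iso_dim_Int[OF f 3 G(1,2)] fG a by (simp add: adjacent_def)
  qed
qed

lemma apt_iso_clique:
  assumes "apt_iso k f f'" "1 \<le> k" "k < dim (UNIV :: 'b set)" "clique_triple k U V W"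
  shows "clique_triple k (f U) (f V) (f W)"
  using assms apt_iso_adjacent unfolding clique_triple_def by blast

lemma clique_grassmannian:
  assumes "clique_triple k U V W"
  shows "U \<in> grassmannian k" "V \<in> grassmannian k" "W \<in> grassmannian k"
  using assms by (auto simp: clique_triple_def adjacent_def)

lemma apt_iso_pencil:
  assumes f: "apt_iso k f f'" and k: "1 \<le> k" "k < dim (UNIV :: 'b set)"
    and c: "clique_triple k U V W"
  shows "star_triple k (f U) (f V) (f W) \<and> top_triple k (f U) (f V) (f W)
    \<longleftrightarrow> star_triple k U V W \<and> top_triple k U V W"
proof -
  note G = clique_grassmannian[OF c]
  have "R_set k {U, V, W} \<longleftrightarrow> R_set k {f U, f V, f W}"
  proof
    assume "R_set k {U, V, W}"
    from R_set_image[OF f this] show "R_set k {f U, f V, f W}" by simp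
  next
    assume "R_set k {f U, f V, f W}"
    from R_set_image[OF apt_iso_sym[OF f] this] show "R_set k {U, V, W}"
      using apt_isoD(2)[OF f] G by simp
  qed
  then show ?thesis
    using R_set_triple_iff[OF c] R_set_triple_iff[OF apt_iso_clique[OF f k c]] by blast
qed

lemma apt_iso_star:
  assumes f: "apt_iso k f f'" and k: "1 \<le> k" "k < dim (UNIV :: 'b set)" and n: "dim (UNIV :: 'b set) \<noteq> 2 * k"
    and st: "star_triple k U V W"
  shows "star_triple k (f U) (f V) (f W)"
proof (cases "top_triple k U V W")
  case True
  then show ?thesis using apt_iso_pencil[OF f k, of U V W] st unfolding star_triple_def by blast
next
  case nt: False
  have c: "clique_triple k U V W" using st by (simp add: star_triple_def)
  note G = clique_grassmannian[OF c]
  have c': "clique_triple k (f U) (f V) (f W)" by (rule apt_iso_clique[OF f k c])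
  note G' = clique_grassmannian[OF c']
  have d': "f U \<noteq> f V" "f U \<noteq> f W" "f V \<noteq> f W" using c' by (auto simp: clique_triple_def adjacent_def)
  consider "k = 1" | "Suc k = dim (UNIV :: 'b set)" | "2 \<le> k" "k + 2 \<le> dim (UNIV :: 'b set)"
    using k by linarith
  then show ?thesis
  proof cases
    case 1
    then show ?thesis
      using G' d' subspace_0 by (intro star_tripleI[where P = "{0}"]) (auto simp: grassmannian_def)
  next
    case 2
    \<comment> \<open>For k = n-1 every clique triple is a top, so there is no strict star.\<close>
    have "U \<noteq> V" "U \<noteq> W" "V \<noteq> W" using c by (auto simp: clique_triple_def adjacent_def)
    then have "top_triple k U V W"
      using G 2 by (intro top_tripleI[where Q = UNIV]) (auto simp: grassmannian_def)
    then show ?thesis using nt by blast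
  next
    case 3
    obtain B S T X where B: "basis_of_space B" "S \<subseteq> B" "T \<subseteq> B" "X \<subseteq> B" "U = span S" "V = span T" "W = span X"
      "card S = k" "card T = k" "card X = k"
      using strict_star_R_set[OF st nt] by (rule R_set_triple_spans)
    have A: "apt k B \<in> apts k" using B(1) by (simp add: apts_def)
    obtain C where C: "basis_of_space C" "f ` apt k B = apt k C"
      using apt_isoD(3)[OF f A] unfolding apts_def by blast
    have sub: "{U, V, W} \<subseteq> apt k B" using B by (auto simp: span_mem_apt)
    then have "f U \<in> apt k C" "f V \<in> apt k C" "f W \<in> apt k C" using C(2) by auto
    then obtain S' T' X' where S': "S' \<subseteq> C" "T' \<subseteq> C" "X' \<subseteq> C" "f U = span S'" "f V = span T'" "f W = span X'"
      by (metis apt_memE)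
    have "missing k (apt k C) {f U, f V, f W} = missing k (apt k B) {U, V, W}"
      using missing_image[OF f A sub] C(2) by simp
    also have "\<dots> = (k - 1) * (dim (UNIV :: 'b set) - (k + 2))"
      using missing_triple(1)[OF B(1-4) _ 3] c st B by simp
    finally have m: "missing k (apt k C) {f U, f V, f W} = (k - 1) * (dim (UNIV :: 'b set) - (k + 2))" .
    show ?thesis
    proof (rule ccontr)
      assume "\<not> star_triple k (f U) (f V) (f W)"
      then have eq: "(k - 2) * (dim (UNIV :: 'b set) - (k + 1)) = (k - 1) * (dim (UNIV :: 'b set) - (k + 2))"
        using missing_triple(2)[OF C(1) S'(1-3) _ 3] c' S' m by simp
      \<comment> \<open>With a = k-2 and b = n-k-2 the counts are a(b+1) for a strict top and (a+1)b
        for a star; equality gives a = b, that is n = 2k.\<close>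
      obtain a where a: "k = a + 2" using 3(1) by (metis add.commute le_Suc_ex)
      obtain b where b: "dim (UNIV :: 'b set) = k + 2 + b" using 3(2) le_Suc_ex by blast
      have "a * (b + 1) = (a + 1) * b" using eq unfolding b unfolding a by simp
      then show False using n a b by simp
    qed
  qed
qed

end

section \<open>Stars and tops\<close>

context finite_dimensional_vector_space
begin

text \<open>This is what a regular transformation preserves even if n = 2k. In contrast to
  \<open>star_map\<close>, it does not tell stars from tops, so orthogonal complements have it
  too.\<close>

definition clique_map :: "nat \<Rightarrow> ('b set \<Rightarrow> 'b set) \<Rightarrow> ('b set \<Rightarrow> 'b set) \<Rightarrow> bool" where
  "clique_map k f f' \<longleftrightarrow> (\<forall>U\<in>grassmannian k. f U \<in> grassmannian k \<and> f' (f U) = U) \<and>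
     (\<forall>U W. adjacent k U W \<longrightarrow> adjacent k (f U) (f W)) \<and>
     (\<forall>U V W. star_triple k U V W \<and> top_triple k U V W \<longrightarrow>
        star_triple k (f U) (f V) (f W) \<and> top_triple k (f U) (f V) (f W))"

definition clique_iso :: "nat \<Rightarrow> ('b set \<Rightarrow> 'b set) \<Rightarrow> ('b set \<Rightarrow> 'b set) \<Rightarrow> bool" where
  "clique_iso k f f' \<longleftrightarrow> clique_map k f f' \<and> clique_map k f' f"

lemma clique_iso_sym: "clique_iso k f f' \<Longrightarrow> clique_iso k f' f"
  by (simp add: clique_iso_def)

lemma clique_isoD:
  assumes "clique_iso k f f'"
  shows "U \<in> grassmannian k \<Longrightarrow> f U \<in> grassmannian k" "U \<in> grassmannian k \<Longrightarrow> f' (f U) = U"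
    and "adjacent k U W \<Longrightarrow> adjacent k (f U) (f W)"
    and "star_triple k U V W \<Longrightarrow> top_triple k U V W \<Longrightarrow> star_triple k (f U) (f V) (f W)"
    and "star_triple k U V W \<Longrightarrow> top_triple k U V W \<Longrightarrow> top_triple k (f U) (f V) (f W)"
  using assms unfolding clique_iso_def clique_map_def by simp_all

lemma apt_iso_clique_map:
  assumes f: "apt_iso k f f'" and k: "1 \<le> k" "k < dim (UNIV :: 'b set)"
  shows "clique_map k f f'"
  unfolding clique_map_def
proof (intro conjI ballI allI impI)
  fix U V W
  show "U \<in> grassmannian k \<Longrightarrow> f U \<in> grassmannian k" "U \<in> grassmannian k \<Longrightarrow> f' (f U) = U"
    using apt_isoD(1,2)[OF f] by blast+
  show "adjacent k U W \<Longrightarrow> adjacent k (f U) (f W)" by (rule apt_iso_adjacent[OF f k])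
  assume a: "star_triple k U V W \<and> top_triple k U V W"
  then have "clique_triple k U V W" by (simp add: star_triple_def)
  from apt_iso_pencil[OF f k this] a
  show "star_triple k (f U) (f V) (f W)" "top_triple k (f U) (f V) (f W)" by simp_all
qed

lemma apt_iso_clique_iso:
  assumes "apt_iso k f f'" "1 \<le> k" "k < dim (UNIV :: 'b set)"
  shows "clique_iso k f f'"
  using apt_iso_clique_map[OF assms] apt_iso_clique_map[OF apt_iso_sym[OF assms(1)] assms(2,3)]
  by (simp add: clique_iso_def)

text \<open>Reflexivity is included so that the members of a triple count among its own common
  neighbours.\<close>

definition near :: "nat \<Rightarrow> 'b set \<Rightarrow> 'b set \<Rightarrow> bool" where
  "near k U W \<longleftrightarrow> U = W \<or> adjacent k U W"

lemma near_image_iff: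
  assumes "clique_iso k f f'" "U \<in> grassmannian k" "W \<in> grassmannian k"
  shows "near k (f U) (f W) \<longleftrightarrow> near k U W"
  using clique_isoD(2,3)[OF assms(1)] clique_isoD(3)[OF clique_iso_sym[OF assms(1)], of "f U" "f W"] assms(2,3)
  unfolding near_def by metis

lemma strict_triple_image:
  assumes f: "clique_iso k f f'" and c: "clique_triple k U V W" and s: "\<not> (star_triple k U V W \<and> top_triple k U V W)"
  shows "clique_triple k (f U) (f V) (f W)"
    and "\<not> (star_triple k (f U) (f V) (f W) \<and> top_triple k (f U) (f V) (f W))"
proof -
  show "clique_triple k (f U) (f V) (f W)"
    using c clique_isoD(3)[OF f] by (simp add: clique_triple_def)
  show "\<not> (star_triple k (f U) (f V) (f W) \<and> top_triple k (f U) (f V) (f W))"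
  proof
    assume "star_triple k (f U) (f V) (f W) \<and> top_triple k (f U) (f V) (f W)"
    then have "star_triple k (f' (f U)) (f' (f V)) (f' (f W))" "top_triple k (f' (f U)) (f' (f V)) (f' (f W))"
      using clique_isoD(4,5)[OF clique_iso_sym[OF f]] by blast+
    then show False using s clique_isoD(2)[OF f] clique_grassmannian[OF c] by simp
  qed
qed

text \<open>A strict triple determines its whole star by adjacency alone. If \<open>X\<close> is
  adjacent to all three but not above \<open>U \<inter> V\<close>, then \<open>U\<close>,
  \<open>V\<close>, \<open>X\<close> and \<open>U\<close>, \<open>W\<close>, \<open>X\<close> are
  tops; the sums of \<open>U\<close> with \<open>V\<close>, \<open>X\<close> and \<open>W\<close>
  then coincide, and the triple would be a top.\<close>

lemma common_neighbours_star:
  assumes s: "star_triple k U V W" "\<not> top_triple k U V W" and X: "X \<in> grassmannian k"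
  shows "near k X U \<and> near k X V \<and> near k X W \<longleftrightarrow> U \<inter> V \<subseteq> X"
proof
  obtain P where P: "P \<in> grassmannian (k - 1)" "Suc (dim P) = k" "U \<inter> V = P" "U \<inter> W = P" "V \<inter> W = P"
    using s(1) by (rule star_tripleE)
  have c: "clique_triple k U V W" using s by (simp add: star_triple_def)
  note G = clique_grassmannian[OF c]
  have sub: "P \<subseteq> U" "P \<subseteq> V" "P \<subseteq> W" using P by blast+
  have "near k X Y" if "P \<subseteq> X" "Y \<in> grassmannian k" "P \<subseteq> Y" for Y
    using adjacentI_common[OF X that(2) _ that(1,3) P(2)] by (auto simp: near_def)
  then show "U \<inter> V \<subseteq> X \<Longrightarrow> near k X U \<and> near k X V \<and> near k X W" using G P(3) sub by simp
  assume n: "near k X U \<and> near k X V \<and> near k X W"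
  show "U \<inter> V \<subseteq> X"
  proof (cases "X = U \<or> X = V \<or> X = W")
    case True
    then show ?thesis using P by blast
  next
    case False
    then have a: "adjacent k U X" "adjacent k V X" "adjacent k W X"
      using n adjacent_sym by (auto simp: near_def)
    have a': "adjacent k U V" "adjacent k U W" using c by (simp_all add: clique_triple_def)
    show ?thesis
    proof (rule ccontr)
      assume ns: "\<not> U \<inter> V \<subseteq> X"
      have "clique_triple k U V X" "clique_triple k U W X" using a a' by (simp_all add: clique_triple_def)
      moreover have "\<not> star_triple k U V X" "\<not> star_triple k U W X" using ns P by (simp_all add: star_triple_def)
      ultimately have "X \<subseteq> span (U \<union> V)" "X \<subseteq> span (U \<union> W)"
        using clique_triple_cases unfolding top_triple_def by blast+
      moreover have "U \<subseteq> span (U \<union> V)" "U \<subseteq> span (U \<union> W)"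
        using span_superset[of "U \<union> V"] span_superset[of "U \<union> W"] by auto
      ultimately have "span (U \<union> X) = span (U \<union> V)" "span (U \<union> X) = span (U \<union> W)"
        using join_eq[OF adjacent_grassmannian(1-3)[OF a(1)]] a'[THEN adjacent_grassmannian(5)] by blast+
      then have "W \<subseteq> span (U \<union> V)" using span_superset[of "U \<union> W"] by auto
      then show False using s(2) c by (simp add: top_triple_def)
    qed
  qed
qed

text \<open>Dually, an adjacent \<open>X\<close> outside the top would contain the distinct
  hyperplanes \<open>U \<inter> V\<close> and \<open>U \<inter> W\<close> of \<open>U\<close>, hence
  \<open>U\<close> itself.\<close>

lemma common_neighbours_top:
  assumes s: "top_triple k U V W" "\<not> star_triple k U V W" and X: "X \<in> grassmannian k"
  shows "near k X U \<and> near k X V \<and> near k X W \<longleftrightarrow> X \<subseteq> span (U \<union> V)"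
proof
  obtain Q where Q: "Q \<in> grassmannian (Suc k)" "span (U \<union> V) = Q" "span (U \<union> W) = Q" "span (V \<union> W) = Q"
    "U \<subseteq> Q" "V \<subseteq> Q" "W \<subseteq> Q"
    using s(1) by (rule top_tripleE)
  have c: "clique_triple k U V W" using s by (simp add: top_triple_def)
  note G = clique_grassmannian[OF c]
  have "near k X Y" if "X \<subseteq> Q" "Y \<in> grassmannian k" "Y \<subseteq> Q" for Y
    using adjacentI_join[OF X that(2) _ that(1,3) Q(1)] by (auto simp: near_def)
  then show "X \<subseteq> span (U \<union> V) \<Longrightarrow> near k X U \<and> near k X V \<and> near k X W" using G Q by simp
  assume n: "near k X U \<and> near k X V \<and> near k X W"
  show "X \<subseteq> span (U \<union> V)"
  proof (cases "X = U \<or> X = V \<or> X = W")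
    case True
    then show ?thesis using Q by auto
  next
    case False
    then have a: "adjacent k U X" "adjacent k V X" "adjacent k W X"
      using n adjacent_sym by (auto simp: near_def)
    have a': "adjacent k U V" "adjacent k U W" using c by (simp_all add: clique_triple_def)
    show ?thesis
    proof (rule ccontr)
      assume ns: "\<not> X \<subseteq> span (U \<union> V)"
      have "clique_triple k U V X" "clique_triple k U W X" using a a' by (simp_all add: clique_triple_def)
      moreover have "\<not> top_triple k U V X" "\<not> top_triple k U W X" using ns Q by (simp_all add: top_triple_def)
      ultimately have sub: "U \<inter> V \<subseteq> X" "U \<inter> W \<subseteq> X"
        using clique_triple_cases unfolding star_triple_def by blast+
      have ne: "U \<inter> V \<noteq> U \<inter> W" using s(2) c by (auto simp: star_triple_def)
      have U: "U \<in> grassmannian (Suc (k - 1))" using G(1) adjacent_grassmannian(6)[OF a'(1)] by simp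
      have "U = span (U \<inter> V \<union> U \<inter> W)"
        using join_eq[OF adjacent_grassmannian(4)[OF a'(1)] adjacent_grassmannian(4)[OF a'(2)] ne _ _ U] by blast
      also have "\<dots> \<subseteq> X" using sub X by (intro span_minimal) (auto simp: grassmannian_def)
      finally show False using grassmannian_eqI[OF G(1) X] a(1) by (simp add: adjacent_def)
    qed
  qed
qed

section \<open>The type of the image of a star\<close>

definition to_star :: "nat \<Rightarrow> ('b set \<Rightarrow> 'b set) \<Rightarrow> 'b set \<Rightarrow> bool" where
  "to_star k f P \<longleftrightarrow> (\<exists>P'\<in>grassmannian (k - 1). \<forall>X\<in>grassmannian k. P \<subseteq> X \<longleftrightarrow> P' \<subseteq> f X)"

definition to_top :: "nat \<Rightarrow> ('b set \<Rightarrow> 'b set) \<Rightarrow> 'b set \<Rightarrow> bool" where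
  "to_top k f P \<longleftrightarrow> (\<exists>Q\<in>grassmannian (Suc k). \<forall>X\<in>grassmannian k. P \<subseteq> X \<longleftrightarrow> f X \<subseteq> Q)"

lemma ex_strict_star:
  assumes k: "1 \<le> k" "k + 2 \<le> dim (UNIV :: 'b set)" and P: "P \<in> grassmannian (k - 1)"
  shows "\<exists>U V W. star_triple k U V W \<and> \<not> top_triple k U V W \<and> U \<inter> V = P"
proof -
  have k1: "Suc (k - 1) = k" using k by simp
  have sP: "subspace P" "Suc (dim P) = k" using P k by (auto simp: grassmannian_def)
  obtain U where U: "U \<in> grassmannian k" "P \<subseteq> U" using ex_above[OF P] k k1 by auto
  obtain V where V: "V \<in> grassmannian k" "V \<noteq> U" "P \<subseteq> V" using other_above[OF P, of U] U k k1 by auto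
  have a: "adjacent k U V" using adjacentI_common[OF U(1) V(1)] U V sP by blast
  have "dim (span (U \<union> V)) \<noteq> dim (UNIV :: 'b set)"
    using grassmannianD(2)[OF adjacent_grassmannian(5)[OF a]] k by linarith
  then have "span (U \<union> V) \<noteq> UNIV" by metis
  then obtain x where x: "x \<notin> span (U \<union> V)" by blast
  let ?W = "span (insert x P)"
  have sub: "insert x P \<subseteq> ?W" by (rule span_superset)
  have UV: "U \<subseteq> span (U \<union> V)" "V \<subseteq> span (U \<union> V)" using span_superset[of "U \<union> V"] by auto
  have "x \<notin> span P" using x UV U(2) grassmannianD(3)[OF P] by blast
  then have W: "?W \<in> grassmannian k" using sP by (auto intro!: grassmannianI simp: dim_insert)
  have "star_triple k U V ?W"
    by (rule star_tripleI[where P = P]) (use U V W sP sub x UV in auto)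
  moreover have "\<not> top_triple k U V ?W" using sub x by (auto simp: top_triple_def)
  moreover have "U \<inter> V = P" using adjacent_Int_eq[OF a] sP U V by blast
  ultimately show ?thesis by blast
qed

text \<open>The star over \<open>P\<close> is the set of common neighbours of a strict triple. The
  image triple is again strict, of one of the two types, and its common neighbours form the star or
  top that is sought.\<close>

lemma to_star_or_to_top:
  assumes f: "clique_iso k f f'" and k: "1 \<le> k" "k + 2 \<le> dim (UNIV :: 'b set)" and P: "P \<in> grassmannian (k - 1)"
  shows "to_star k f P \<or> to_top k f P"
proof -
  obtain U V W where s: "star_triple k U V W" "\<not> top_triple k U V W" "U \<inter> V = P"
    using ex_strict_star[OF k P] by blast
  have c: "clique_triple k U V W" using s by (simp add: star_triple_def)
  note G = clique_grassmannian[OF c]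
  have i: "clique_triple k (f U) (f V) (f W)" "\<not> (star_triple k (f U) (f V) (f W) \<and> top_triple k (f U) (f V) (f W))"
    using strict_triple_image[OF f c] s by blast+
  have eq: "P \<subseteq> X \<longleftrightarrow> near k (f X) (f U) \<and> near k (f X) (f V) \<and> near k (f X) (f W)" if "X \<in> grassmannian k" for X
    using common_neighbours_star[OF s(1,2) that] s(3) near_image_iff[OF f that] G by simp
  have a: "adjacent k (f U) (f V)" using i by (simp add: clique_triple_def)
  show ?thesis
  proof (cases "star_triple k (f U) (f V) (f W)")
    case True
    then have "\<forall>X\<in>grassmannian k. P \<subseteq> X \<longleftrightarrow> f U \<inter> f V \<subseteq> f X"
      using common_neighbours_star[OF True] i eq clique_isoD(1)[OF f] by simp
    then show ?thesis using adjacent_grassmannian(4)[OF a] unfolding to_star_def by blast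
  next
    case False
    then have "top_triple k (f U) (f V) (f W)" using clique_triple_cases[OF i(1)] by blast
    then have "\<forall>X\<in>grassmannian k. P \<subseteq> X \<longleftrightarrow> f X \<subseteq> span (f U \<union> f V)"
      using common_neighbours_top[OF _ False] eq clique_isoD(1)[OF f] by simp
    then show ?thesis using adjacent_grassmannian(5)[OF a] unfolding to_top_def by blast
  qed
qed

text \<open>Two stars over adjacent planes share exactly one element, while a star and a top that
  meet share a whole pencil.\<close>

lemma to_star_to_top_not_adjacent:
  assumes f: "clique_iso k f f'" and k: "1 \<le> k"
    and P: "adjacent (k - 1) P R" and PR: "to_star k f P" "to_top k f R"
  shows False
proof -
  have k1: "Suc (k - 1) = k" using k by simp
  obtain P' where P': "P' \<in> grassmannian (k - 1)" "\<And>X. X \<in> grassmannian k \<Longrightarrow> P \<subseteq> X \<longleftrightarrow> P' \<subseteq> f X"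
    using PR(1) by (auto simp: to_star_def)
  obtain Q where Q: "Q \<in> grassmannian (Suc k)" "\<And>X. X \<in> grassmannian k \<Longrightarrow> R \<subseteq> X \<longleftrightarrow> f X \<subseteq> Q"
    using PR(2) by (auto simp: to_top_def)
  let ?U = "span (P \<union> R)"
  have U: "?U \<in> grassmannian k" using adjacent_grassmannian(5)[OF P] k1 by simp
  have fU: "f ?U \<in> grassmannian k" using clique_isoD(1)[OF f U] .
  have "P \<subseteq> ?U" "R \<subseteq> ?U" using span_superset[of "P \<union> R"] by auto
  then have sub: "P' \<subseteq> f ?U" "f ?U \<subseteq> Q" using P' Q U by blast+
  have "\<not> Q \<subseteq> f ?U"
  proof
    assume "Q \<subseteq> f ?U"
    then have "dim Q \<le> dim (f ?U)" by (rule dim_subset)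
    then show False using Q(1) fU by (simp add: grassmannian_def)
  qed
  then obtain x where x: "x \<in> Q" "x \<notin> f ?U" by blast
  \<comment> \<open>A second plane between \<open>P'\<close> and \<open>Q\<close>: its preimage
    contains both \<open>P\<close> and \<open>R\<close>, so it can only be \<open>?U\<close>,
    although \<open>?Y\<close> differs from \<open>f ?U\<close>.\<close>
  let ?Y = "span (insert x P')"
  have "x \<notin> span P'" using x sub grassmannianD(3)[OF P'(1)] by blast
  then have Y: "?Y \<in> grassmannian k" using P'(1) k1 by (auto simp: grassmannian_def dim_insert)
  have PY: "insert x P' \<subseteq> ?Y" by (rule span_superset)
  have YQ: "?Y \<subseteq> Q" using x sub Q(1) by (intro span_minimal) (auto simp: grassmannian_def)
  define X where "X = f' ?Y"
  have X: "X \<in> grassmannian k" "f X = ?Y"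
    using clique_isoD(1,2)[OF clique_iso_sym[OF f] Y] by (simp_all add: X_def)
  then have "P \<subseteq> X" "R \<subseteq> X" using P'(2)[OF X(1)] Q(2)[OF X(1)] PY YQ by auto
  then have "?U \<subseteq> X" using X(1) by (intro span_minimal) (auto simp: grassmannian_def)
  then have "?U = X" using grassmannian_eqI U X(1) by blast
  then show False using X(2) PY x by auto
qed

text \<open>\<open>P\<close> is moved to an adjacent plane \<open>?S\<close> that meets
  \<open>R\<close> in a larger dimension: a hyperplane of \<open>P\<close> through
  \<open>P \<inter> R\<close> is kept, and a vector of \<open>R\<close> is added. As the star over
  \<open>?S\<close> cannot go to a top, the type is passed on.\<close>

lemma to_star_connected:
  assumes f: "clique_iso k f f'" and k: "1 \<le> k" "k + 2 \<le> dim (UNIV :: 'b set)"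
  shows "P \<in> grassmannian (k - 1) \<Longrightarrow> to_star k f P \<Longrightarrow> R \<in> grassmannian (k - 1) \<Longrightarrow> to_star k f R"
proof (induction "k - 1 - dim (P \<inter> R)" arbitrary: P rule: less_induct)
  case less
  show ?case
  proof (cases "P = R")
    case False
    have sub: "subspace (P \<inter> R)" "subspace P" "subspace R" "dim P = k - 1" "dim R = k - 1"
      using less.prems by (auto simp: grassmannian_def subspace_inter)
    have lt: "dim (P \<inter> R) < k - 1" using dim_Int_less[OF less.prems(1,3) False] .
    obtain x where x: "x \<in> R" "x \<notin> P" using grassmannian_eqI[OF less.prems(3,1)] False by blast
    \<comment> \<open>Here k-2 is a genuine subtraction, since \<open>lt\<close> forces k-1 to be
      positive.\<close>
    obtain M where M: "M \<in> grassmannian (k - 2)" "P \<inter> R \<subseteq> M" "M \<subseteq> P"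
      using ex_intermediate[OF sub(1,2) Int_lower1, of "k - 2"] lt sub(4) by fastforce
    have dM: "Suc (dim M) = k - 1" using M(1) lt by (simp add: grassmannian_def)
    let ?S = "span (insert x M)"
    have "x \<notin> span M" using x M(3) grassmannianD(3)[OF M(1)] by blast
    then have S: "?S \<in> grassmannian (k - 1)" using dM by (auto intro!: grassmannianI simp: dim_insert)
    have MS: "insert x M \<subseteq> ?S" by (rule span_superset)
    have a: "adjacent (k - 1) P ?S"
      by (rule adjacentI_common[where P = M]) (use less.prems(1) S MS x M dM in auto)
    have "to_star k f ?S"
      using to_star_or_to_top[OF f k S] to_star_to_top_not_adjacent[OF f k(1) a less.prems(2)] by blast
    moreover have "dim (P \<inter> R) < dim (?S \<inter> R)"
    proof -
      have "span (P \<inter> R) = P \<inter> R" using sub(1) by simp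
      then have "x \<notin> span (P \<inter> R)" using x by blast
      then have "dim (insert x (P \<inter> R)) = Suc (dim (P \<inter> R))" by (simp add: dim_insert)
      moreover have "insert x (P \<inter> R) \<subseteq> ?S \<inter> R" using MS M(2) x by auto
      ultimately show ?thesis using dim_subset[of "insert x (P \<inter> R)" "?S \<inter> R"] by linarith
    qed
    moreover have "dim (?S \<inter> R) \<le> k - 1" using dim_subset[of "?S \<inter> R" R] sub by simp
    ultimately have "k - 1 - dim (?S \<inter> R) < k - 1 - dim (P \<inter> R)" using lt by linarith
    then show ?thesis using less.hyps S \<open>to_star k f ?S\<close> less.prems(3) by blast
  qed (use less.prems in simp)
qed

lemma to_star_star_map:
  assumes f: "clique_iso k f f'" and k: "1 \<le> k" "k + 2 \<le> dim (UNIV :: 'b set)"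
    and P: "P \<in> grassmannian (k - 1)" "to_star k f P"
  shows "star_map k f f'"
proof -
  have "star_triple k (f U) (f V) (f W)" if s: "star_triple k U V W" for U V W
  proof -
    obtain R where R: "R \<in> grassmannian (k - 1)" "U \<inter> V = R" "U \<inter> W = R" "V \<inter> W = R"
      using s by (rule star_tripleE)
    have c: "clique_triple k U V W" using s by (simp add: star_triple_def)
    note G = clique_grassmannian[OF c]
    have c': "clique_triple k (f U) (f V) (f W)"
      using c clique_isoD(3)[OF f] by (simp add: clique_triple_def)
    note G' = clique_grassmannian[OF c']
    obtain R' where R': "R' \<in> grassmannian (k - 1)" "\<And>X. X \<in> grassmannian k \<Longrightarrow> R \<subseteq> X \<longleftrightarrow> R' \<subseteq> f X"
      using to_star_connected[OF f k P R(1)] by (auto simp: to_star_def)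
    have "R \<subseteq> U" "R \<subseteq> V" "R \<subseteq> W" using R by blast+
    then have "R' \<subseteq> f U" "R' \<subseteq> f V" "R' \<subseteq> f W" using R'(2) G by blast+
    moreover have "f U \<noteq> f V" "f U \<noteq> f W" "f V \<noteq> f W" using c' by (auto simp: clique_triple_def adjacent_def)
    ultimately show ?thesis
      using star_tripleI[OF G', of R'] R'(1) k(1) by (simp add: grassmannian_def)
  qed
  then show ?thesis unfolding star_map_def using clique_isoD[OF f] by simp
qed

text \<open>The equivalence defining \<open>to_star\<close> can be read from the side of the
  inverse, where it says that the star over \<open>P'\<close> goes to the star over
  \<open>P\<close>.\<close>

lemma to_star_star_iso:
  assumes f: "clique_iso k f f'" and k: "1 \<le> k" "k + 2 \<le> dim (UNIV :: 'b set)"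
    and P: "P \<in> grassmannian (k - 1)" "to_star k f P"
  shows "star_iso k f f'"
proof -
  obtain P' where P': "P' \<in> grassmannian (k - 1)" "\<And>X. X \<in> grassmannian k \<Longrightarrow> P \<subseteq> X \<longleftrightarrow> P' \<subseteq> f X"
    using P(2) by (auto simp: to_star_def)
  note f' = clique_iso_sym[OF f]
  have "\<forall>X\<in>grassmannian k. P' \<subseteq> X \<longleftrightarrow> P \<subseteq> f' X"
    using P'(2) clique_isoD(1,2)[OF f'] by simp
  then have "to_star k f' P'" using P(1) by (auto simp: to_star_def)
  then show ?thesis
    using to_star_star_map[OF f k P] to_star_star_map[OF f' k P'(1)] by (simp add: star_iso_def)
qed

section \<open>Orthogonal complements for a symmetric form\<close>

definition dot :: "'b \<Rightarrow> 'b \<Rightarrow> 'a" where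
  "dot x y = (\<Sum>b\<in>Basis. representation Basis x b * representation Basis y b)"

lemma dot_commute: "dot x y = dot y x"
  by (simp add: dot_def mult.commute)

lemma dot_add: "dot x (y + z) = dot x y + dot x z"
  by (simp add: dot_def representation_add independent_Basis span_Basis distrib_left sum.distrib)

lemma dot_scale: "dot x (a *s y) = a * dot x y"
  by (simp add: dot_def representation_scale independent_Basis span_Basis sum_distrib_left mult_ac)

lemma dot_zero: "dot x 0 = 0"
  using dot_scale[of x 0 0] by simp

lemma dot_Basis:
  assumes "b \<in> Basis"
  shows "dot b y = representation Basis y b"
proof -
  have "dot b y = (\<Sum>c\<in>Basis. if c = b then representation Basis y b else 0)"
    unfolding dot_def using assms
    by (intro sum.cong) (auto simp: representation_basis independent_Basis)
  then show ?thesis using assms finite_Basis by simp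
qed

lemma dot_nondegenerate:
  assumes "\<And>x. dot x y = 0"
  shows "y = 0"
proof -
  have "representation Basis y b = 0" for b
    using assms[of b] dot_Basis[of b y] representation_ne_zero[of Basis y b] by metis
  then show ?thesis
    using sum_representation_eq[OF independent_Basis, of y Basis] finite_Basis span_Basis by simp
qed

text \<open>Over a general field a vector can be orthogonal to itself, so a plane and its complement
  may intersect; the facts below rest on dimension counts, not on a direct sum.\<close>

abbreviation perp :: "'b set \<Rightarrow> 'b set" where
  "perp \<equiv> orthogonal_complement dot"

lemma subspace_perp: "subspace (perp A)"
  by (rule subspaceI) (auto simp: orthogonal_complement_def dot_zero dot_add dot_scale)

lemma perp_antimono: "A \<subseteq> B \<Longrightarrow> perp B \<subseteq> perp A"
  by (auto simp: orthogonal_complement_def)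

lemma perp_span: "perp (span A) = perp A"
proof
  show "perp A \<subseteq> perp (span A)"
  proof
    fix y assume y: "y \<in> perp A"
    have "A \<subseteq> perp {y}" using y by (auto simp: orthogonal_complement_def dot_commute)
    then have "span A \<subseteq> perp {y}" by (rule span_minimal) (rule subspace_perp)
    then show "y \<in> perp (span A)" by (auto simp: orthogonal_complement_def dot_commute)
  qed
qed (rule perp_antimono[OF span_superset])

text \<open>The intersection is the kernel of a linear functional on \<open>W\<close>, so its
  codimension is at most 1.\<close>

lemma dim_Int_perp_single:
  assumes "subspace W"
  shows "dim W \<le> Suc (dim (W \<inter> perp {x}))"
proof (cases "W \<subseteq> perp {x}")
  case True
  then show ?thesis by (simp add: Int_absorb2)
next
  case False
  then obtain w where w: "w \<in> W" "dot x w \<noteq> 0" by (auto simp: orthogonal_complement_def)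
  have "y \<in> span (insert w (W \<inter> perp {x}))" if y: "y \<in> W" for y
  proof -
    let ?a = "dot x y / dot x w"
    have "y - ?a *s w \<in> W" using assms w y by (simp add: subspace_diff subspace_scale)
    moreover have "dot x y = dot x (y - ?a *s w) + dot x (?a *s w)" by (simp flip: dot_add)
    then have "dot x (y - ?a *s w) = 0" using w by (simp add: dot_scale)
    ultimately have "y - ?a *s w \<in> W \<inter> perp {x}" by (simp add: orthogonal_complement_def)
    then show ?thesis using span_base unfolding span_breakdown_eq by blast
  qed
  then have "dim W \<le> dim (insert w (W \<inter> perp {x}))" by (intro dim_mono) blast
  then show ?thesis by (simp add: dim_insert split: if_splits)
qed

lemma dim_Int_perp:
  assumes "finite A" "subspace W"
  shows "dim W \<le> dim (W \<inter> perp A) + card A"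
  using assms(1)
proof (induction A rule: finite_induct)
  case empty
  then show ?case by (simp add: orthogonal_complement_def)
next
  case (insert x A)
  have "W \<inter> perp A \<inter> perp {x} = W \<inter> perp (insert x A)" by (auto simp: orthogonal_complement_def)
  moreover have "subspace (W \<inter> perp A)" using assms(2) subspace_perp by (rule subspace_inter)
  ultimately show ?case using insert dim_Int_perp_single[of "W \<inter> perp A" x] by simp
qed

text \<open>A basis \<open>S\<close> of \<open>U\<close> imposes at most \<open>dim U\<close>
  conditions on the space, which bounds \<open>perp U\<close> from below. The at most n -
  \<open>dim U\<close> further conditions from \<open>B - S\<close> reduce \<open>perp U\<close> to
  0 by nondegeneracy, which bounds it from above.\<close>

lemma dim_perp:
  assumes "subspace U"
  shows "dim (perp U) + dim U = dim (UNIV :: 'b set)"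
proof -
  obtain S where S: "finite S" "S \<subseteq> U" "independent S" "span S = U" "card S = dim U"
    using assms by (rule basis_subspace_exists)
  obtain B where B: "basis_of_space B" "S \<subseteq> B" using S(3) by (rule ex_basis_superset)
  note b = basis_of_spaceD[OF B(1)]
  have "dim (UNIV :: 'b set) \<le> dim (perp U) + dim U"
    using dim_Int_perp[OF S(1) subspace_UNIV] perp_span[of S] S by simp
  moreover have "perp U \<inter> perp (B - S) \<subseteq> perp B"
    using perp_span[of S] S(4) by (auto simp: orthogonal_complement_def)
  moreover have "perp B \<subseteq> {0}"
  proof
    fix y assume "y \<in> perp B"
    then have "y \<in> perp UNIV" using perp_span[of B] b(2) by simp
    then have "dot x y = 0" for x by (simp add: orthogonal_complement_def)
    then show "y \<in> {0}" using dot_nondegenerate by blast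
  qed
  ultimately have "dim (perp U \<inter> perp (B - S)) = 0" "dim (UNIV :: 'b set) \<le> dim (perp U) + dim U" by simp_all
  moreover have "dim (perp U) \<le> dim (perp U \<inter> perp (B - S)) + card (B - S)"
    using b(3) by (intro dim_Int_perp subspace_perp) simp
  moreover have "card (B - S) + card S = dim (UNIV :: 'b set)"
    using card_Diff_subset[OF S(1) B(2)] card_mono[OF b(3) B(2)] b(4) by simp
  ultimately show ?thesis using S(5) by linarith
qed

lemma perp_grassmannian:
  assumes "U \<in> grassmannian k"
  shows "perp U \<in> grassmannian (dim (UNIV :: 'b set) - k)"
  using dim_perp[of U] assms subspace_perp by (auto simp: grassmannian_def simp del: dim_UNIV)

lemma perp_perp:
  assumes "subspace U"
  shows "perp (perp U) = U"
proof (rule subspace_dim_equal[symmetric])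
  show "U \<subseteq> perp (perp U)" by (auto simp: orthogonal_complement_def dot_commute)
  show "dim (perp (perp U)) \<le> dim U"
    using dim_perp[OF assms] dim_perp[OF subspace_perp, of U] by linarith
qed (rule assms subspace_perp)+

text \<open>Reversal of inclusions exchanges the common (k-1)-plane of a triple with a common
  (k+1)-plane, so triples with both stay such.\<close>

lemma perp_clique_map:
  assumes n: "dim (UNIV :: 'b set) = 2 * k"
  shows "clique_map k perp perp"
proof -
  have G: "perp U \<in> grassmannian k" "perp (perp U) = U" if "U \<in> grassmannian k" for U
    using perp_grassmannian[OF that] perp_perp grassmannianD(1)[OF that] n by simp_all
  have up: "perp P \<in> grassmannian (Suc k)" if "Suc (dim P) = k" "subspace P" for P
    using perp_grassmannian[of P "dim P"] that n by (simp add: grassmannian_def)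
  have adj: "adjacent k (perp U) (perp W)" if a: "adjacent k U W" for U W
  proof -
    have P: "subspace (U \<inter> W)" "Suc (dim (U \<inter> W)) = k"
      using a by (auto simp: adjacent_def grassmannian_def subspace_inter)
    note g = adjacent_grassmannian[OF a]
    show ?thesis
    proof (rule adjacentI_join[OF G(1)[OF g(1)] G(1)[OF g(2)]])
      show "perp U \<noteq> perp W" using G(2) g by metis
    qed (use up[OF P(2,1)] perp_antimono in auto)
  qed
  moreover have "star_triple k (perp U) (perp V) (perp W) \<and> top_triple k (perp U) (perp V) (perp W)"
    if st: "star_triple k U V W \<and> top_triple k U V W" for U V W
  proof -
    obtain P where P: "P \<in> grassmannian (k - 1)" "Suc (dim P) = k" "U \<inter> V = P" "U \<inter> W = P" "V \<inter> W = P"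
      using st star_tripleE by metis
    obtain Q where Q: "Q \<in> grassmannian (Suc k)" "U \<subseteq> Q" "V \<subseteq> Q" "W \<subseteq> Q"
      using st top_tripleE by metis
    have "clique_triple k U V W" using st by (simp add: star_triple_def)
    then have c: "clique_triple k (perp U) (perp V) (perp W)" using adj by (simp add: clique_triple_def)
    note g = clique_grassmannian[OF c]
    have d: "perp U \<noteq> perp V" "perp U \<noteq> perp W" "perp V \<noteq> perp W" using c by (auto simp: clique_triple_def adjacent_def)
    have Q': "perp Q \<in> grassmannian (k - 1)" using perp_grassmannian[OF Q(1)] n by simp
    have "0 < k" using P(2) by simp
    then have "star_triple k (perp U) (perp V) (perp W)"
      using star_tripleI[OF g d, of "perp Q"] perp_antimono Q Q' by (simp add: grassmannian_def)
    moreover have "P \<subseteq> U" "P \<subseteq> V" "P \<subseteq> W" using P by blast+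
    then have "top_triple k (perp U) (perp V) (perp W)"
      using top_tripleI[OF g d up[OF P(2) grassmannianD(1)[OF P(1)]]] perp_antimono by blast
    ultimately show ?thesis by blast
  qed
  ultimately show ?thesis unfolding clique_map_def using G by blast
qed

lemma clique_map_comp:
  assumes "clique_map k f f'" "clique_map k g g'"
  shows "clique_map k (\<lambda>U. g (f U)) (\<lambda>U. f' (g' U))"
  using assms unfolding clique_map_def by simp

lemma field_automorphism_inv:
  assumes "field_automorphism \<sigma>"
  shows "field_automorphism (inv \<sigma>)"
proof -
  have b: "bij \<sigma>" and s: "\<sigma> 1 = 1" "\<And>a b. \<sigma> (a + b) = \<sigma> a + \<sigma> b" "\<And>a b. \<sigma> (a * b) = \<sigma> a * \<sigma> b"
    using assms by (auto simp: field_automorphism_def)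
  have i: "\<sigma> (inv \<sigma> a) = a" "inv \<sigma> (\<sigma> a) = a" for a
    using b by (simp_all add: bij_def surj_f_inv_f)
  have "inv \<sigma> (a + b) = inv \<sigma> a + inv \<sigma> b" for a b
    using s(2)[of "inv \<sigma> a" "inv \<sigma> b"] i by metis
  moreover have "inv \<sigma> (a * b) = inv \<sigma> a * inv \<sigma> b" for a b
    using s(3)[of "inv \<sigma> a" "inv \<sigma> b"] i by metis
  moreover have "inv \<sigma> 1 = 1" using s(1) i(2) by metis
  ultimately show ?thesis using b by (simp add: field_automorphism_def bij_imp_bij_inv)
qed

lemma perp_collineation_defined_by_form:
  assumes g: "collineation g" and f: "\<And>U. U \<in> grassmannian k \<Longrightarrow> f U = perp (g ` U)"
  shows "defined_by_form k f"
proof -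
  obtain \<sigma> where \<sigma>: "field_automorphism \<sigma>" "\<And>a x. g (a *s x) = \<sigma> a *s g x"
    using g by (auto simp: collineation_def)
  have gb: "bij g" "\<And>x y. g (x + y) = g x + g y" using g by (auto simp: collineation_def)
  have g0: "g 0 = 0" using gb(2)[of 0 0] by simp
  have "field_automorphism (inv \<sigma>)" by (rule field_automorphism_inv[OF \<sigma>(1)])
  then have i: "bij (inv \<sigma>)" "\<And>a b. inv \<sigma> (a + b) = inv \<sigma> a + inv \<sigma> b" "\<And>a b. inv \<sigma> (a * b) = inv \<sigma> a * inv \<sigma> b"
    by (auto simp: field_automorphism_def)
  have i0: "inv \<sigma> a = 0 \<longleftrightarrow> a = 0" for a
    using i(1) i(2)[of 0 0] by (metis add_cancel_right_right bij_pointE)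
  have inv_\<sigma>: "inv \<sigma> (\<sigma> a) = a" for a using \<sigma>(1) by (simp add: field_automorphism_def bij_def)
  \<comment> \<open>\<open>dot (g x) y\<close> is semilinear in \<open>x\<close> and linear in
    \<open>y\<close>. Applying \<open>inv \<sigma>\<close> makes it linear in \<open>x\<close> and
    semilinear in \<open>y\<close> with respect to \<open>inv \<sigma>\<close>, as the convention
    requires, and keeps its zeros.\<close>
  define \<Omega> where "\<Omega> x y = inv \<sigma> (dot (g x) y)" for x y
  have dot_add_left: "dot (x + x') y = dot x y + dot x' y" for x x' y
    using dot_add[of y x x'] by (simp add: dot_commute)
  have dot_scale_left: "dot (a *s x) y = a * dot x y" for a x y
    using dot_scale[of y a x] by (simp add: dot_commute)
  have "\<Omega> (a *s x) (b *s y) = a * inv \<sigma> b * \<Omega> x y" for a b x y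
    by (simp add: \<Omega>_def \<sigma>(2) dot_scale dot_scale_left i(3) inv_\<sigma>)
  then have "sesquilinear_form \<Omega>"
    unfolding sesquilinear_form_def using field_automorphism_inv[OF \<sigma>(1)]
    by (auto simp: \<Omega>_def gb(2) dot_add dot_add_left i(2))
  moreover have "nondegenerate_form \<Omega>"
    unfolding nondegenerate_form_def
  proof (intro conjI allI impI)
    fix x assume "\<forall>y. \<Omega> x y = 0"
    then have "g x = 0" using dot_nondegenerate[of "g x"] by (simp add: \<Omega>_def i0 dot_commute)
    then show "x = 0" using g0 gb(1) by (metis bij_pointE)
  next
    fix y assume "\<forall>x. \<Omega> x y = 0"
    then have "dot (g x) y = 0" for x by (simp add: \<Omega>_def i0)
    then have "dot x y = 0" for x using gb(1) by (metis bij_pointE)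
    then show "y = 0" by (rule dot_nondegenerate)
  qed
  moreover have "perp (g ` U) = orthogonal_complement \<Omega> U" for U
    by (auto simp: orthogonal_complement_def \<Omega>_def i0)
  ultimately show ?thesis unfolding defined_by_form_def using f by blast
qed

section \<open>The two cases for regular transformations\<close>

lemma regular_unequal:
  assumes f: "regular_transformation k f" and n: "3 \<le> dim (UNIV :: 'b set)"
    and k: "1 \<le> k" "k < dim (UNIV :: 'b set)" "dim (UNIV :: 'b set) \<noteq> 2 * k"
  shows "induced_by_collineation k f"
proof -
  let ?f' = "the_inv_into (grassmannian k) f"
  have a: "apt_iso k f ?f'" by (rule regular_apt_iso[OF f])
  have "star_map k h h'" if "apt_iso k h h'" for h h'
    unfolding star_map_def
    using apt_isoD(1,2)[OF that] apt_iso_star[OF that k] clique_isoD(5)[OF apt_iso_clique_iso[OF that k(1,2)]]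
    by simp
  then have "star_iso k f ?f'" using a apt_iso_sym by (auto simp: star_iso_def)
  then show ?thesis by (rule star_iso_induced[OF _ k(1,2) n])
qed

lemma regular_equal:
  assumes f: "regular_transformation k f" and n: "3 \<le> dim (UNIV :: 'b set)"
    and k: "dim (UNIV :: 'b set) = 2 * k"
  shows "induced_by_collineation k f \<or> defined_by_form k f"
proof -
  let ?f' = "the_inv_into (grassmannian k) f"
  have k': "1 \<le> k" "k < dim (UNIV :: 'b set)" "k + 2 \<le> dim (UNIV :: 'b set)" using n k by linarith+
  have c: "clique_iso k f ?f'" by (rule apt_iso_clique_iso[OF regular_apt_iso[OF f] k'(1,2)])
  \<comment> \<open>One star decides: if it goes to a star, \<open>to_star_star_iso\<close> extends
    this to all; if it goes to the top of \<open>Q\<close>, then after composition with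
    \<open>perp\<close> it goes to the star over \<open>perp Q\<close>.\<close>
  obtain P where P: "P \<in> grassmannian (k - 1)"
    using ex_intermediate[of "{0}" UNIV "k - 1"] k' by fastforce
  consider "to_star k f P" | "to_top k f P" using to_star_or_to_top[OF c k'(1,3) P] by blast
  then show ?thesis
  proof cases
    case 1
    then show ?thesis using star_iso_induced[OF to_star_star_iso[OF c k'(1,3) P] k'(1,2) n] by blast
  next
    case 2
    then obtain Q where Q: "Q \<in> grassmannian (Suc k)" "\<And>X. X \<in> grassmannian k \<Longrightarrow> P \<subseteq> X \<longleftrightarrow> f X \<subseteq> Q"
      by (auto simp: to_top_def)
    let ?h = "\<lambda>U. perp (f U)" and ?h' = "\<lambda>U. ?f' (perp U)"
    have h: "clique_iso k ?h ?h'"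
      using clique_map_comp[OF _ perp_clique_map[OF k]] clique_map_comp[OF perp_clique_map[OF k]] c
      by (simp add: clique_iso_def)
    have inv: "perp (perp (f X)) = f X" if "X \<in> grassmannian k" for X
      using perp_perp clique_isoD(1)[OF c that] grassmannianD(1) by blast
    have Q': "perp Q \<in> grassmannian (k - 1)" "perp (perp Q) = Q"
      using perp_grassmannian[OF Q(1)] perp_perp[OF grassmannianD(1)[OF Q(1)]] k by simp_all
    have "P \<subseteq> X \<longleftrightarrow> perp Q \<subseteq> perp (f X)" if X: "X \<in> grassmannian k" for X
      using Q(2)[OF X] inv[OF X] Q'(2) perp_antimono by metis
    then have "to_star k ?h P" using Q'(1) by (auto simp: to_star_def)
    then have "induced_by_collineation k ?h"
      by (intro star_iso_induced[OF to_star_star_iso[OF h k'(1,3) P] k'(1,2) n])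
    then obtain g where g: "collineation g" "\<And>U. U \<in> grassmannian k \<Longrightarrow> perp (f U) = g ` U"
      by (auto simp: induced_by_collineation_def)
    have "f U = perp (g ` U)" if "U \<in> grassmannian k" for U using g(2)[OF that] inv[OF that] by simp
    then show ?thesis using perp_collineation_defined_by_form[OF g(1)] by blast
  qed
qed

end

theorem theorem1p1:
  fixes smul :: "'a::field \<Rightarrow> 'b::ab_group_add \<Rightarrow> 'b"
    and B :: "'b set" and n k :: nat
  assumes "finite_dimensional_vector_space smul B"
    and "vector_space.dim smul (UNIV :: 'b set) = n"
    and "n \<ge> 3" and "1 \<le> k" and "k \<le> n - 1"
  shows "(n \<noteq> 2 * k \<longrightarrow>
           (\<forall>f. vector_space.regular_transformation smul k f \<longrightarrow>
                vector_space.induced_by_collineation smul k f)) \<and>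
         (n = 2 * k \<longrightarrow>
           (\<forall>f. vector_space.regular_transformation smul k f \<longrightarrow>
                vector_space.induced_by_collineation smul k f \<or>
                vector_space.defined_by_form smul k f))"
proof -
  interpret finite_dimensional_vector_space smul B by (rule assms(1))
  show ?thesis using regular_unequal[of k] regular_equal[of k] assms(2-5) by auto
qed

end
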